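(* Let $\Omega \subset \mathbb{R}^d$ be a bounded domain and $p \in (1,\infty)$. Let $D \subset \partial\Omega$ be porous and $l$-thick for some $l \in (d-p,d]$. Finally assume that for every $\mathrm{x} \in \overline{\partial\Omega \setminus D}$ there is an open neighborhood $U_{\mathrm{x}}$ of $\mathrm{x}$ such that $\Omega \cap U_{\mathrm{x}}$ is a $W^{1,p}$-extension domain. If $u \in W^{1,p}(\Omega)$ is such that $u/\operatorname{dist}_D \in L^p(\Omega)$, then already $u \in W_D^{1,p}(\Omega)$.
   Context: The space dimension is $d \ge 1$; a domain is a non-empty connected open set; $B(\mathrm{x},r)$ is the open ball; $\operatorname{dist}_D$ is the Euclidean distance function to $D$. For $\Lambda \subset \mathbb{R}^d$ open, $E \subset \overline{\Lambda}$ closed and $p \in [1,\infty)$, put $C^\infty_E(\Lambda) := \{ v|_\Lambda : v \in C_0^\infty(\mathbb{R}^d),\ \operatorname{supp}(v) \cap E = \emptyset \}$, and let $W^{1,p}_E(\Lambda)$ be the completion of $C^\infty_E(\Lambda)$ with respect to the norm $v \mapsto \big( \int_\Lambda |\nabla v|^p + |v|^p \, d\mathrm{x} \big)^{1/p}$, i.e. its closure in $W^{1,p}(\Lambda)$. $W^{k,p}(\Lambda)$ is the usual space of $L^p(\Lambda)$ functions with distributional derivatives up to order $k$ in $L^p(\Lambda)$. A domain $\Lambda \subset \mathbb{R}^d$ is a $W^{k,p}$-extension domain ($k \in \mathbb{N}$, $p \in [1,\infty)$) if there exists a continuous linear extension operator $W^{k,p}(\Lambda) \to W^{k,p}(\mathbb{R}^d)$,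 i.e. one whose values restrict on $\Lambda$ to the original function. For $l>0$ the centered Hausdorff content of $F \subset \mathbb{R}^d$ is $\mathcal{H}_l^\infty(F) := \inf \{ \sum_{j=1}^\infty r_j^l : \mathrm{x}_j \in F,\ r_j>0,\ F \subset \bigcup_{j=1}^\infty B(\mathrm{x}_j,r_j) \}$. For $l \in (0,\infty)$, a non-empty compact set $F \subset \mathbb{R}^d$ is called $l$-thick if there exist $R>0$ and $\gamma>0$ such that $\mathcal{H}^\infty_l(F \cap B(\mathrm{x},r)) \ge \gamma r^l$ for all $\mathrm{x} \in F$ and all $r \in (0,R]$. ($l$-thickness is defined only for $l>0$.) A set $F \subset \mathbb{R}^d$ is porous if there is $\kappa \in (0,1]$ such that for every ball $B(\mathrm{x},r)$ with $\mathrm{x} \in \mathbb{R}^d$ and $0<r\le 1$ there is $\mathrm{y} \in B(\mathrm{x},r)$ with $B(\mathrm{y},\kappa r) \cap F = \emptyset$. *)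

theory Defs
  imports "HOL-Analysis.Analysis"
begin

text \<open>
  Functions on a set \<open>\<Lambda>\<close> are represented by total functions whose values off \<open>\<Lambda>\<close> are
  irrelevant, and elements of Lebesgue and Sobolev spaces by arbitrary representatives. The scalar
  field is a type of sort \<open>{real_normed_field, euclidean_space}\<close>, which has both \<open>real\<close> and
  \<open>complex\<close> as instances.
\<close>

subsection \<open>Smooth functions\<close>

definition partial_deriv ::
    "'a \<Rightarrow> ('a::euclidean_space \<Rightarrow> 'b::real_normed_vector) \<Rightarrow> 'a \<Rightarrow> 'b" where
  "partial_deriv i f x = frechet_derivative f (at x) i"

primrec C_k :: "nat \<Rightarrow> ('a::euclidean_space \<Rightarrow> 'b::real_normed_vector) \<Rightarrow> bool" where
  "C_k 0 f \<longleftrightarrow> continuous_on UNIV f"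
| "C_k (Suc k) f \<longleftrightarrow>
     (\<forall>x. f differentiable (at x)) \<and> (\<forall>i\<in>Basis. C_k k (partial_deriv i f))"

definition supp :: "('a::topological_space \<Rightarrow> 'b::zero) \<Rightarrow> 'a set" where
  "supp f = closure {x. f x \<noteq> 0}"

definition Cc_inf :: "'a set \<Rightarrow> ('a::euclidean_space \<Rightarrow> 'b::real_normed_vector) set" where
  "Cc_inf \<Lambda> = {\<phi>. (\<forall>k. C_k k \<phi>) \<and> compact (supp \<phi>) \<and> supp \<phi> \<subseteq> \<Lambda>}"

subsection \<open>Sobolev spaces\<close>

definition L_p :: "real \<Rightarrow> 'a set \<Rightarrow> ('a::euclidean_space \<Rightarrow> 'b::euclidean_space) set" where
  "L_p p \<Lambda> = {u. u \<in> borel_measurable (lebesgue_on \<Lambda>) \<and>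
                 integrable (lebesgue_on \<Lambda>) (\<lambda>x. norm (u x) powr p)}"

definition locally_integrable_on ::
    "('a::euclidean_space \<Rightarrow> 'b::euclidean_space) \<Rightarrow> 'a set \<Rightarrow> bool" where
  "locally_integrable_on u \<Lambda> \<longleftrightarrow>
     (\<forall>K. compact K \<and> K \<subseteq> \<Lambda> \<longrightarrow> u absolutely_integrable_on K)"

definition has_weak_deriv ::
    "'a set \<Rightarrow> 'a \<Rightarrow> ('a::euclidean_space \<Rightarrow> 'b::{real_normed_field, euclidean_space})
      \<Rightarrow> ('a \<Rightarrow> 'b) \<Rightarrow> bool" where
  "has_weak_deriv \<Lambda> i u g \<longleftrightarrow>
     locally_integrable_on u \<Lambda> \<and> locally_integrable_on g \<Lambda> \<and>
     (\<forall>\<phi>\<in>Cc_inf \<Lambda>. (LINT x|lebesgue_on \<Lambda>. u x * partial_deriv i \<phi> x)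
                    = - (LINT x|lebesgue_on \<Lambda>. g x * \<phi> x))"

definition W1p ::
    "real \<Rightarrow> 'a set \<Rightarrow> ('a::euclidean_space \<Rightarrow> 'b::{real_normed_field, euclidean_space}) set" where
  "W1p p \<Lambda> = {u \<in> L_p p \<Lambda>. \<forall>i\<in>Basis. \<exists>g\<in>L_p p \<Lambda>. has_weak_deriv \<Lambda> i u g}"

text \<open>The choice below is harmless: on open sets weak derivatives are unique up to null sets.\<close>

definition weak_deriv ::
    "'a set \<Rightarrow> 'a \<Rightarrow> ('a::euclidean_space \<Rightarrow> 'b::{real_normed_field, euclidean_space})
      \<Rightarrow> 'a \<Rightarrow> 'b" where
  "weak_deriv \<Lambda> i u = (SOME g. has_weak_deriv \<Lambda> i u g)"

definition norm_weak_grad ::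
    "'a set \<Rightarrow> ('a::euclidean_space \<Rightarrow> 'b::{real_normed_field, euclidean_space}) \<Rightarrow> 'a \<Rightarrow> real" where
  "norm_weak_grad \<Lambda> u x = L2_set (\<lambda>i. norm (weak_deriv \<Lambda> i u x)) Basis"

definition W1p_norm ::
    "real \<Rightarrow> 'a set \<Rightarrow> ('a::euclidean_space \<Rightarrow> 'b::{real_normed_field, euclidean_space}) \<Rightarrow> real" where
  "W1p_norm p \<Lambda> u =
     (LINT x|lebesgue_on \<Lambda>. norm_weak_grad \<Lambda> u x powr p + norm (u x) powr p) powr (1 / p)"

definition C_inf_vanishing ::
    "'a set \<Rightarrow> 'a set \<Rightarrow> ('a::euclidean_space \<Rightarrow> 'b::real_normed_vector) set" where
  "C_inf_vanishing E \<Lambda> = {w. \<exists>v\<in>Cc_inf UNIV. supp v \<inter> E = {} \<and> (\<forall>x\<in>\<Lambda>. w x = v x)}"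

definition W1p_vanishing ::
    "'a set \<Rightarrow> real \<Rightarrow> 'a set
      \<Rightarrow> ('a::euclidean_space \<Rightarrow> 'b::{real_normed_field, euclidean_space}) set" where
  "W1p_vanishing E p \<Lambda> =
     {u \<in> W1p p \<Lambda>. \<forall>\<epsilon>>0. \<exists>v\<in>C_inf_vanishing E \<Lambda>. W1p_norm p \<Lambda> (\<lambda>x. u x - v x) < \<epsilon>}"

subsection \<open>Extension domains\<close>

definition is_domain :: "'a::topological_space set \<Rightarrow> bool" where
  "is_domain \<Lambda> \<longleftrightarrow> \<Lambda> \<noteq> {} \<and> open \<Lambda> \<and> connected \<Lambda>"

text \<open>
  The operator acts on representatives. Compatibility with equality almost everywhere need not be
  demanded separately, as it follows from linearity and boundedness.
\<close>

definition W1p_extension_operator ::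
    "real \<Rightarrow> 'a set
      \<Rightarrow> (('a::euclidean_space \<Rightarrow> 'b::{real_normed_field, euclidean_space}) \<Rightarrow> 'a \<Rightarrow> 'b)
      \<Rightarrow> bool" where
  "W1p_extension_operator p \<Lambda> E \<longleftrightarrow>
     (\<forall>u\<in>W1p p \<Lambda>. E u \<in> W1p p UNIV \<and> (AE x in lebesgue_on \<Lambda>. E u x = u x)) \<and>
     (\<forall>u\<in>W1p p \<Lambda>. \<forall>v\<in>W1p p \<Lambda>. AE x in lebesgue. E (\<lambda>y. u y + v y) x = E u x + E v x) \<and>
     (\<forall>u\<in>W1p p \<Lambda>. \<forall>c. AE x in lebesgue. E (\<lambda>y. c * u y) x = c * E u x) \<and>
     (\<exists>C. \<forall>u\<in>W1p p \<Lambda>. W1p_norm p UNIV (E u) \<le> C * W1p_norm p \<Lambda> u)"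

text \<open>The first argument records the scalar field, which the type of \<open>\<Lambda>\<close> does not mention.\<close>

definition W1p_extension_domain ::
    "'b::{real_normed_field, euclidean_space} itself \<Rightarrow> real \<Rightarrow> 'a::euclidean_space set \<Rightarrow> bool" where
  "W1p_extension_domain _ p \<Lambda> \<longleftrightarrow>
     is_domain \<Lambda> \<and> (\<exists>E :: ('a \<Rightarrow> 'b) \<Rightarrow> 'a \<Rightarrow> 'b. W1p_extension_operator p \<Lambda> E)"

subsection \<open>Thick and porous sets\<close>

definition Hausdorff_content :: "real \<Rightarrow> 'a::metric_space set \<Rightarrow> ennreal" where
  "Hausdorff_content l F =
     Inf {(\<Sum>j. ennreal (r j powr l)) | (x :: nat \<Rightarrow> 'a) r.
            (\<forall>j. x j \<in> F \<and> 0 < r j) \<and> F \<subseteq> (\<Union>j. ball (x j) (r j))}"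

definition l_thick :: "real \<Rightarrow> 'a::metric_space set \<Rightarrow> bool" where
  "l_thick l F \<longleftrightarrow> 0 < l \<and> F \<noteq> {} \<and> compact F \<and>
     (\<exists>R>0. \<exists>\<gamma>>0. \<forall>x\<in>F. \<forall>r\<in>{0<..R}.
        ennreal (\<gamma> * r powr l) \<le> Hausdorff_content l (F \<inter> ball x r))"

definition porous :: "'a::metric_space set \<Rightarrow> bool" where
  "porous F \<longleftrightarrow>
     (\<exists>\<kappa>\<in>{0<..1}. \<forall>x. \<forall>r\<in>{0<..1}. \<exists>y\<in>ball x r. ball y (\<kappa> * r) \<inter> F = {})"

end

theory Submission
  imports Defs
begin

text \<open>
  The function \<open>u\<close> is approximated in two steps, by functions vanishing near \<open>D\<close> and then by smooth ones.

  Multiply \<open>u\<close> by \<open>1 - \<theta>\<close>, where \<open>\<theta>\<close> equals one near \<open>D\<close>, vanishes at distance \<open>3 r\<close> from \<open>D\<close> and has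
  gradient at most \<open>C / r\<close>. The error consists of \<open>\<theta> u\<close>, \<open>\<theta> \<nabla>u\<close> and \<open>u \<nabla>\<theta>\<close>. The last term is dominated
  by \<open>3 C |u| / infdist x D\<close> on the set where the distance to \<open>D\<close> is at most \<open>3 r\<close>, so by the integrability
  assumption on \<open>u / infdist x D\<close> all three tend to zero as \<open>r\<close> does (\<open>Hardy_cutoff\<close>).

  The function \<open>(1 - \<theta>) u\<close> only sees points off \<open>D\<close>. Around such a point \<open>u\<close> can be extended: by zero if
  the point lies in \<open>\<Omega>\<close> and a compactly supported cutoff is applied, trivially if it lies outside the
  closure of \<open>\<Omega>\<close>, and by the extension operator if it lies on the rest of the boundary. A finite
  splitting of the cutoff function (\<open>extendable_on_Un\<close>, \<open>extendable_on_local\<close>) glues these extensions to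
  a Sobolev function \<open>w\<close> on the whole space that equals \<open>(1 - \<theta>) u\<close> on \<open>\<Omega>\<close> and has compact support
  disjoint from \<open>D\<close>. Mollifying \<open>w\<close> at a scale below the distance between its support and \<open>D\<close> gives an
  admissible smooth function (\<open>Sobolev_mollification\<close>).

  The first half of the text supplies the calculus behind this: smooth bump and cutoff functions,
  differentiation of convolutions, convergence of mollifications in the Lebesgue spaces, uniqueness of
  weak derivatives and the product rule.
\<close>

section \<open>Smooth functions\<close>

text \<open>
  Smoothness is proved by coinduction: a set of differentiable functions that is closed under partial
  derivatives consists of smooth functions. The closure properties below, the bump function and
  convolutions all exhibit such a set.
\<close>

definition smooth :: "('a::euclidean_space \<Rightarrow> 'b::real_normed_vector) \<Rightarrow> bool" where
  "smooth f \<longleftrightarrow> (\<forall>k. C_k k f)"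

lemma smooth_coinduct:
  assumes "f \<in> S"
    and diff: "\<And>f x. f \<in> S \<Longrightarrow> f differentiable (at x)"
    and closed: "\<And>f i. f \<in> S \<Longrightarrow> i \<in> Basis \<Longrightarrow> partial_deriv i f \<in> S"
  shows "smooth f"
proof -
  have "\<forall>f\<in>S. C_k k f" for k
  proof (induction k)
    case 0
    show ?case
      using diff by (auto intro!: differentiable_imp_continuous_on simp: differentiable_on_def
          intro: differentiable_at_withinI)
  next
    case (Suc k)
    then show ?case using diff closed by simp
  qed
  then show ?thesis using assms(1) by (simp add: smooth_def)
qed

lemma smooth_differentiable: "smooth f \<Longrightarrow> f differentiable (at x)"
  unfolding smooth_def by (metis C_k.simps(2))

lemma smooth_partial_deriv: "smooth f \<Longrightarrow> i \<in> Basis \<Longrightarrow> smooth (partial_deriv i f)"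
  unfolding smooth_def by (metis C_k.simps(2))

lemma smooth_continuous_on: "smooth f \<Longrightarrow> continuous_on S f"
  unfolding smooth_def by (metis C_k.simps(1) continuous_on_subset subset_UNIV)

lemma partial_deriv_eq: "(f has_derivative f') (at x) \<Longrightarrow> partial_deriv i f x = f' i"
  unfolding partial_deriv_def using frechet_derivative_at by metis

lemma has_derivative_partial_deriv:
  assumes "f differentiable (at x)"
  shows "(f has_derivative (\<lambda>h. \<Sum>i\<in>Basis. (h \<bullet> i) *\<^sub>R partial_deriv i f x)) (at x)"
proof -
  have D: "(f has_derivative frechet_derivative f (at x)) (at x)"
    using assms frechet_derivative_works by blast
  interpret linear "frechet_derivative f (at x)"
    using assms by (rule linear_frechet_derivative)
  have "frechet_derivative f (at x) = (\<lambda>h. \<Sum>i\<in>Basis. (h \<bullet> i) *\<^sub>R partial_deriv i f x)"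
  proof
    fix h :: 'a
    have "frechet_derivative f (at x) (\<Sum>i\<in>Basis. (h \<bullet> i) *\<^sub>R i) =
        (\<Sum>i\<in>Basis. (h \<bullet> i) *\<^sub>R frechet_derivative f (at x) i)"
      by (simp add: sum scaleR)
    then show "frechet_derivative f (at x) h = (\<Sum>i\<in>Basis. (h \<bullet> i) *\<^sub>R partial_deriv i f x)"
      by (simp add: euclidean_representation partial_deriv_def)
  qed
  with D show ?thesis by simp
qed

lemmas has_derivative_works = frechet_derivative_works[THEN iffD1]

lemma partial_deriv_add:
  assumes "f differentiable (at x)" "g differentiable (at x)"
  shows "partial_deriv i (\<lambda>x. f x + g x) x = partial_deriv i f x + partial_deriv i g x"
  unfolding partial_deriv_eq[OF has_derivative_add[OF assms[THEN has_derivative_works]]]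
  by (simp add: partial_deriv_def)

lemma partial_deriv_mult:
  fixes f g :: "'a::euclidean_space \<Rightarrow> 'b::real_normed_algebra"
  assumes "f differentiable (at x)" "g differentiable (at x)"
  shows "partial_deriv i (\<lambda>x. f x * g x) x = f x * partial_deriv i g x + partial_deriv i f x * g x"
  unfolding partial_deriv_eq[OF has_derivative_mult[OF assms[THEN has_derivative_works]]]
  by (simp add: partial_deriv_def)

lemma has_derivative_affine:
  assumes "f differentiable (at (c *\<^sub>R x + a))"
  shows "((\<lambda>x. f (c *\<^sub>R x + a)) has_derivative
     (\<lambda>h. frechet_derivative f (at (c *\<^sub>R x + a)) (c *\<^sub>R h))) (at x)"
  by (rule has_derivative_compose[of "\<lambda>x. c *\<^sub>R x + a" "\<lambda>h. c *\<^sub>R h" x UNIV f])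
    (use assms[THEN has_derivative_works] in \<open>auto intro!: derivative_eq_intros\<close>)

lemma partial_deriv_affine:
  assumes "f differentiable (at (c *\<^sub>R x + a))"
  shows "partial_deriv i (\<lambda>x. f (c *\<^sub>R x + a)) x = c *\<^sub>R partial_deriv i f (c *\<^sub>R x + a)"
  unfolding partial_deriv_eq[OF has_derivative_affine[OF assms]]
  using linear_scale[OF linear_frechet_derivative[OF assms]] by (simp add: partial_deriv_def)

lemma partial_deriv_linear:
  assumes "bounded_linear T" "f differentiable (at x)"
  shows "partial_deriv i (\<lambda>x. T (f x)) x = T (partial_deriv i f x)"
  unfolding partial_deriv_eq[OF bounded_linear.has_derivative[OF assms(1) assms(2)[THEN has_derivative_works]]]
  by (simp add: partial_deriv_def)

lemma smooth_linear:
  fixes f :: "'a::euclidean_space \<Rightarrow> 'b::real_normed_vector"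
  assumes T: "bounded_linear T" and f: "smooth f"
  shows "smooth (\<lambda>x. T (f x))"
proof -
  let ?S = "(\<lambda>(f :: 'a \<Rightarrow> 'b) x. T (f x)) ` Collect smooth"
  show ?thesis
  proof (rule smooth_coinduct[of _ ?S])
  show "(\<lambda>x. T (f x)) \<in> ?S" using f by (intro imageI) simp
  show "g differentiable (at x)" if "g \<in> ?S" for g x
  proof -
    from that obtain f where f: "smooth f" "g = (\<lambda>x. T (f x))" by (elim imageE) simp
    show ?thesis
      unfolding f(2) differentiable_def
      using bounded_linear.has_derivative[OF T smooth_differentiable[OF f(1), THEN has_derivative_works]]
      by blast
  qed
  fix g and i :: 'a assume "g \<in> ?S" and i: "i \<in> Basis"
  then obtain f where f: "smooth f" "g = (\<lambda>x. T (f x))" by (elim imageE) simp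
  have "partial_deriv i g = (\<lambda>x. T (partial_deriv i f x))"
    unfolding f(2) by (rule ext, rule partial_deriv_linear[OF T smooth_differentiable[OF f(1)]])
  with smooth_partial_deriv[OF f(1) i] show "partial_deriv i g \<in> ?S"
    by simp
  qed
qed

text \<open>
  The product rule turns one product into a sum of two, so the set of products of two smooth functions
  is not closed under partial derivatives. The algebra generated by the smooth functions is.
\<close>

inductive smooth_algebra :: "('a::euclidean_space \<Rightarrow> 'b::real_normed_algebra) \<Rightarrow> bool" where
  base: "smooth f \<Longrightarrow> smooth_algebra f"
| add: "smooth_algebra f \<Longrightarrow> smooth_algebra g \<Longrightarrow> smooth_algebra (\<lambda>x. f x + g x)"
| mult: "smooth_algebra f \<Longrightarrow> smooth_algebra g \<Longrightarrow> smooth_algebra (\<lambda>x. f x * g x)"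
| affine: "smooth_algebra f \<Longrightarrow> smooth_algebra (\<lambda>x. c *\<^sub>R f (b *\<^sub>R x + a))"

lemma smooth_algebra_differentiable:
  "smooth_algebra f \<Longrightarrow> f differentiable (at x)"
proof (induction arbitrary: x rule: smooth_algebra.induct)
  case (affine f c b a)
  show ?case
    unfolding differentiable_def
    using has_derivative_scaleR_right[OF has_derivative_affine[OF affine.IH]] by blast
qed (auto intro: smooth_differentiable)

lemma smooth_algebra_partial_deriv:
  "smooth_algebra f \<Longrightarrow> i \<in> Basis \<Longrightarrow> smooth_algebra (partial_deriv i f)"
proof (induction rule: smooth_algebra.induct)
  case (base f)
  then show ?case by (intro smooth_algebra.base smooth_partial_deriv)
next
  case (add f g)
  then have "partial_deriv i (\<lambda>x. f x + g x) = (\<lambda>x. partial_deriv i f x + partial_deriv i g x)"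
    by (intro ext partial_deriv_add smooth_algebra_differentiable)
  with add show ?case by (simp add: smooth_algebra.add)
next
  case (mult f g)
  then have "partial_deriv i (\<lambda>x. f x * g x) = (\<lambda>x. f x * partial_deriv i g x + partial_deriv i f x * g x)"
    by (intro ext partial_deriv_mult smooth_algebra_differentiable)
  with mult show ?case by (simp add: smooth_algebra.add smooth_algebra.mult)
next
  case (affine f c b a)
  have "partial_deriv i (\<lambda>x. c *\<^sub>R f (b *\<^sub>R x + a)) = (\<lambda>x. (c * b) *\<^sub>R partial_deriv i f (b *\<^sub>R x + a))"
  proof
    fix x
    have "(\<lambda>x. f (b *\<^sub>R x + a)) differentiable (at x)"
      using has_derivative_affine[OF smooth_algebra_differentiable[OF affine(1)]]
      unfolding differentiable_def by blast
    then show "partial_deriv i (\<lambda>x. c *\<^sub>R f (b *\<^sub>R x + a)) x = (c * b) *\<^sub>R partial_deriv i f (b *\<^sub>R x + a)"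
      by (simp add: partial_deriv_linear[OF bounded_linear_scaleR_right]
          partial_deriv_affine[OF smooth_algebra_differentiable[OF affine(1)]])
  qed
  with affine show ?case by (simp add: smooth_algebra.affine)
qed

lemma smooth_algebra_smooth: "smooth_algebra f \<Longrightarrow> smooth f"
  by (rule smooth_coinduct[of _ "Collect smooth_algebra"])
    (auto intro: smooth_algebra_differentiable smooth_algebra_partial_deriv)

lemma smooth_add:
  fixes f g :: "'a::euclidean_space \<Rightarrow> 'b::real_normed_algebra"
  shows "smooth f \<Longrightarrow> smooth g \<Longrightarrow> smooth (\<lambda>x. f x + g x)"
  by (rule smooth_algebra_smooth[OF smooth_algebra.add[OF smooth_algebra.base smooth_algebra.base]])

lemma smooth_mult:
  fixes f g :: "'a::euclidean_space \<Rightarrow> 'b::real_normed_algebra"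
  shows "smooth f \<Longrightarrow> smooth g \<Longrightarrow> smooth (\<lambda>x. f x * g x)"
  by (rule smooth_algebra_smooth[OF smooth_algebra.mult[OF smooth_algebra.base smooth_algebra.base]])

lemma smooth_affine:
  fixes f :: "'a::euclidean_space \<Rightarrow> 'b::real_normed_algebra"
  shows "smooth f \<Longrightarrow> smooth (\<lambda>x. c *\<^sub>R f (b *\<^sub>R x + a))"
  by (rule smooth_algebra_smooth[OF smooth_algebra.affine[OF smooth_algebra.base]])

lemma smooth_diff:
  fixes f g :: "'a::euclidean_space \<Rightarrow> 'b::real_normed_algebra"
  assumes "smooth f" "smooth g"
  shows "smooth (\<lambda>x. f x - g x)"
  using smooth_add[OF assms(1) smooth_affine[OF assms(2), of "-1" 1 0]] by simp

lemma smooth_const: "smooth (\<lambda>x. c)"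
proof (rule smooth_coinduct[of _ "range (\<lambda>c x. c)"])
  fix f :: "'a \<Rightarrow> 'b" and i :: 'a assume "f \<in> range (\<lambda>c x. c)"
  then obtain c where "f = (\<lambda>x. c)" by (elim rangeE)
  then have "partial_deriv i f = (\<lambda>x. 0)"
    by (simp only:) (rule ext, rule partial_deriv_eq[OF has_derivative_const])
  then show "partial_deriv i f \<in> range (\<lambda>c x. c)" by (metis rangeI)
qed (auto simp del: image_iff)

section \<open>A bump function\<close>

text \<open>
  For \<open>n = 0\<close> this is the classical flat function \<open>exp (-1/t)\<close> on the positive half line. The factor
  \<open>t\<^sup>-\<^sup>n\<close> is there because differentiation produces such factors: the family over all \<open>n\<close> is closed
  under derivatives up to linear combinations.
\<close>

definition flat_exp :: "nat \<Rightarrow> real \<Rightarrow> real" where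
  "flat_exp n t = (if 0 < t then exp (- inverse t) * inverse t ^ n else 0)"

lemma flat_exp_tendsto_0: "(flat_exp n \<longlongrightarrow> 0) (at 0)"
proof -
  have "((\<lambda>s::real. s ^ n / exp s) \<longlongrightarrow> 0) at_top"
    by (rule tendsto_power_div_exp_0)
  then have "((\<lambda>t::real. inverse t ^ n / exp (inverse t)) \<longlongrightarrow> 0) (at_right 0)"
    by (rule filterlim_compose[OF _ filterlim_inverse_at_top_right])
  then have "(flat_exp n \<longlongrightarrow> 0) (at_right 0)"
    by (rule Lim_transform_eventually)
      (auto simp: flat_exp_def exp_minus field_simps eventually_at_right_less intro: eventually_mono[OF eventually_at_right_less])
  moreover have "(flat_exp n \<longlongrightarrow> 0) (at_left 0)"
    by (rule tendsto_eventually, rule eventually_at_leftI[of "-1"]) (auto simp: flat_exp_def)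
  ultimately show ?thesis by (simp add: filterlim_split_at)
qed

lemma flat_exp_has_derivative:
  "(flat_exp n has_real_derivative flat_exp (n + 2) t - n * flat_exp (Suc n) t) (at t)"
proof -
  consider "t > 0" | "t < 0" | "t = 0" by linarith
  then show ?thesis
  proof cases
    case 1
    have inv: "(inverse has_real_derivative - (inverse t * inverse t)) (at t)"
      using DERIV_inverse[of t UNIV] 1 by (simp add: power2_eq_square)
    have "real n * (- (inverse t * inverse t) * inverse t ^ (n - Suc 0)) = - n * inverse t ^ Suc n"
      by (cases n) (simp_all add: algebra_simps)
    then have pow: "((\<lambda>t. inverse t ^ n) has_real_derivative - n * inverse t ^ Suc n) (at t)"
      using DERIV_power[OF inv, of n] by (simp only:)
    have "((\<lambda>t. exp (- inverse t)) has_real_derivative exp (- inverse t) * (inverse t * inverse t)) (at t)"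
      using DERIV_fun_exp[OF DERIV_minus[OF inv]] by simp
    from DERIV_mult[OF this pow]
    have "((\<lambda>t. exp (- inverse t) * inverse t ^ n) has_real_derivative
        flat_exp (n + 2) t - n * flat_exp (Suc n) t) (at t)"
      using 1 by (simp add: flat_exp_def algebra_simps)
    then show ?thesis
      by (rule has_field_derivative_transform_within_open[where S="{0<..}"])
        (use 1 in \<open>auto simp: flat_exp_def\<close>)
  next
    case 2
    have "((\<lambda>t. 0) has_real_derivative flat_exp (n + 2) t - n * flat_exp (Suc n) t) (at t)"
      using 2 by (simp add: flat_exp_def)
    then show ?thesis
      by (rule has_field_derivative_transform_within_open[where S="{..<0}"])
        (use 2 in \<open>auto simp: flat_exp_def\<close>)
  next
    case 3
    \<comment> \<open>The difference quotient at the origin is the next member of the family, which tends to zero.\<close>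
    have "((\<lambda>h. flat_exp n h / h) \<longlongrightarrow> 0) (at 0)"
      by (rule Lim_transform_eventually[OF flat_exp_tendsto_0[of "Suc n"]])
        (auto simp: flat_exp_def field_simps eventually_at_filter)
    then show ?thesis using 3 by (simp add: DERIV_def flat_exp_def)
  qed
qed

text \<open>
  The coinduction set that shows smoothness of \<open>exp (- 1 / (1 - |x|\<^sup>2))\<close>: besides the flat functions it
  contains the coordinates, which enter through the inner derivative of \<open>1 - |x|\<^sup>2\<close>.
\<close>

inductive bump_algebra :: "('a::euclidean_space \<Rightarrow> real) \<Rightarrow> bool" where
  const: "bump_algebra (\<lambda>x. c)"
| inner: "bump_algebra (\<lambda>x. x \<bullet> b)"
| flat: "bump_algebra (\<lambda>x. flat_exp n (1 - x \<bullet> x))"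
| add: "bump_algebra f \<Longrightarrow> bump_algebra g \<Longrightarrow> bump_algebra (\<lambda>x. f x + g x)"
| mult: "bump_algebra f \<Longrightarrow> bump_algebra g \<Longrightarrow> bump_algebra (\<lambda>x. f x * g x)"

lemma flat_has_derivative:
  "((\<lambda>x. flat_exp n (1 - x \<bullet> x)) has_derivative
    (\<lambda>h. (flat_exp (n + 2) (1 - x \<bullet> x) - n * flat_exp (Suc n) (1 - x \<bullet> x)) * (- 2 * (x \<bullet> h)))) (at x)"
proof -
  have "(flat_exp n has_derivative (\<lambda>h. (flat_exp (n + 2) (1 - x \<bullet> x) - n * flat_exp (Suc n) (1 - x \<bullet> x)) * h))
     (at (1 - x \<bullet> x))"
    using flat_exp_has_derivative[of n "1 - x \<bullet> x"] by (simp add: has_field_derivative_def)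
  moreover have "((\<lambda>x. 1 - x \<bullet> x) has_derivative (\<lambda>h. - 2 * (x \<bullet> h))) (at x)"
    by (auto intro!: derivative_eq_intros simp: inner_commute)
  ultimately show ?thesis
    using has_derivative_compose[of "\<lambda>x. 1 - x \<bullet> x" "\<lambda>h. - 2 * (x \<bullet> h)" x UNIV "flat_exp n"] by blast
qed

lemma bump_algebra_differentiable: "bump_algebra f \<Longrightarrow> f differentiable (at x)"
proof (induction rule: bump_algebra.induct)
  case (inner b)
  have "((\<lambda>x. x \<bullet> b) has_derivative (\<lambda>h. h \<bullet> b)) (at x)" by (auto intro!: derivative_eq_intros)
  then show ?case unfolding differentiable_def by blast
next
  case (flat n)
  then show ?case using flat_has_derivative unfolding differentiable_def by blast
qed auto

lemma bump_algebra_partial_deriv: "bump_algebra f \<Longrightarrow> bump_algebra (partial_deriv i f)"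
proof (induction rule: bump_algebra.induct)
  case (const c)
  have "partial_deriv i (\<lambda>x. c) = (\<lambda>x. 0)"
    by (rule ext, rule partial_deriv_eq[OF has_derivative_const])
  then show ?case by (auto intro: bump_algebra.const)
next
  case (inner b)
  have "((\<lambda>x. x \<bullet> b) has_derivative (\<lambda>h. h \<bullet> b)) (at x)" for x by (auto intro!: derivative_eq_intros)
  then have "partial_deriv i (\<lambda>x. x \<bullet> b) = (\<lambda>x. i \<bullet> b)"
    using partial_deriv_eq by blast
  then show ?case by (auto intro: bump_algebra.const)
next
  case (flat n)
  have "partial_deriv i (\<lambda>x. flat_exp n (1 - x \<bullet> x)) =
    (\<lambda>x. (flat_exp (n + 2) (1 - x \<bullet> x) + (- n) * flat_exp (Suc n) (1 - x \<bullet> x)) * (- 2 * (x \<bullet> i)))"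
    using partial_deriv_eq[OF flat_has_derivative] by auto
  then show ?case
    by (simp only:) (intro bump_algebra.add bump_algebra.mult bump_algebra.const bump_algebra.inner bump_algebra.flat)
next
  case (add f g)
  then have "partial_deriv i (\<lambda>x. f x + g x) = (\<lambda>x. partial_deriv i f x + partial_deriv i g x)"
    by (intro ext partial_deriv_add bump_algebra_differentiable)
  with add show ?case by (simp add: bump_algebra.add)
next
  case (mult f g)
  then have "partial_deriv i (\<lambda>x. f x * g x) = (\<lambda>x. f x * partial_deriv i g x + partial_deriv i f x * g x)"
    by (intro ext partial_deriv_mult bump_algebra_differentiable)
  with mult show ?case by (simp add: bump_algebra.add bump_algebra.mult)
qed

lemma smooth_bump: "smooth (\<lambda>x. flat_exp n (1 - x \<bullet> x))"
  by (rule smooth_coinduct[of _ "Collect bump_algebra"])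
    (auto intro: bump_algebra_differentiable bump_algebra_partial_deriv bump_algebra.flat)

section \<open>Test functions\<close>

lemma eq_0_if_notin_supp: "x \<notin> supp f \<Longrightarrow> f x = 0"
  unfolding supp_def by (metis (mono_tags) closure_subset mem_Collect_eq subsetD)

lemma supp_minimal: "closed K \<Longrightarrow> (\<And>x. x \<notin> K \<Longrightarrow> f x = 0) \<Longrightarrow> supp f \<subseteq> K"
  unfolding supp_def by (rule closure_minimal) auto

lemma closed_supp: "closed (supp f)"
  by (simp add: supp_def)

lemma Cc_inf_iff: "\<phi> \<in> Cc_inf \<Lambda> \<longleftrightarrow> smooth \<phi> \<and> compact (supp \<phi>) \<and> supp \<phi> \<subseteq> \<Lambda>"
  by (auto simp: Cc_inf_def smooth_def)

lemma Cc_infI: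
  assumes "smooth \<phi>" "compact K" "K \<subseteq> \<Lambda>" "\<And>x. x \<notin> K \<Longrightarrow> \<phi> x = 0"
  shows "\<phi> \<in> Cc_inf \<Lambda>"
proof -
  have "supp \<phi> \<subseteq> K" using assms by (intro supp_minimal) (auto simp: compact_imp_closed)
  moreover from this have "compact (supp \<phi>)"
    using compact_Int_closed[OF assms(2) closed_supp[of \<phi>]] by (simp add: Int_absorb1)
  ultimately show ?thesis using assms by (auto simp: Cc_inf_iff)
qed

lemma Cc_inf_smooth: "\<phi> \<in> Cc_inf \<Lambda> \<Longrightarrow> smooth \<phi>"
  by (simp add: Cc_inf_iff)

lemma Cc_inf_differentiable: "\<phi> \<in> Cc_inf \<Lambda> \<Longrightarrow> \<phi> differentiable (at x)"
  by (simp add: Cc_inf_iff smooth_differentiable)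

lemma Cc_inf_mono: "\<phi> \<in> Cc_inf \<Lambda> \<Longrightarrow> \<Lambda> \<subseteq> \<Lambda>' \<Longrightarrow> \<phi> \<in> Cc_inf \<Lambda>'"
  by (auto simp: Cc_inf_iff)

lemma partial_deriv_notin_supp:
  assumes "x \<notin> supp f"
  shows "partial_deriv i f x = 0"
proof -
  have "((\<lambda>x. 0) has_derivative (\<lambda>h. 0)) (at x)" by simp
  then have "(f has_derivative (\<lambda>h. 0)) (at x)"
    by (rule has_derivative_transform_within_open[where s="- supp f"])
      (use assms closed_supp[of f] eq_0_if_notin_supp[of _ f] in \<open>auto simp: open_Compl\<close>)
  then show ?thesis by (rule partial_deriv_eq)
qed

lemma Cc_inf_partial_deriv: "\<phi> \<in> Cc_inf \<Lambda> \<Longrightarrow> i \<in> Basis \<Longrightarrow> partial_deriv i \<phi> \<in> Cc_inf \<Lambda>"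
  by (rule Cc_infI[of _ "supp \<phi>"]) (auto simp: Cc_inf_iff smooth_partial_deriv partial_deriv_notin_supp)

lemma Cc_inf_mult:
  fixes \<eta> \<phi> :: "'a::euclidean_space \<Rightarrow> 'b::real_normed_algebra"
  shows "smooth \<eta> \<Longrightarrow> \<phi> \<in> Cc_inf \<Lambda> \<Longrightarrow> (\<lambda>x. \<eta> x * \<phi> x) \<in> Cc_inf \<Lambda>"
  using eq_0_if_notin_supp[of _ \<phi>]
  by (intro Cc_infI[of _ "supp \<phi>"]) (auto simp: Cc_inf_iff intro: smooth_mult)

lemma Cc_inf_bounded:
  assumes "\<phi> \<in> Cc_inf \<Lambda>"
  obtains B where "0 \<le> B" "\<And>x. norm (\<phi> x) \<le> B"
proof -
  have "compact (\<phi> ` supp \<phi>)"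
    using assms by (intro compact_continuous_image) (auto simp: Cc_inf_iff smooth_continuous_on)
  then obtain B where B: "\<And>x. x \<in> supp \<phi> \<Longrightarrow> norm (\<phi> x) \<le> B"
    by (meson compact_imp_bounded bounded_iff imageI)
  show ?thesis
  proof (rule that[of "max 0 B"])
    show "norm (\<phi> x) \<le> max 0 B" for x
      using B[of x] eq_0_if_notin_supp[of x \<phi>] by (cases "x \<in> supp \<phi>") auto
  qed simp
qed

lemma smooth_borel_measurable: "smooth \<phi> \<Longrightarrow> \<phi> \<in> borel_measurable borel"
  by (simp add: borel_measurable_continuous_onI smooth_continuous_on)

lemma Cc_inf_lipschitz:
  assumes "\<phi> \<in> Cc_inf \<Lambda>"
  obtains L where "0 \<le> L" "\<And>x y. norm (\<phi> y - \<phi> x) \<le> L * norm (y - x)"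
proof -
  have "\<exists>B. 0 \<le> B \<and> (\<forall>x. norm (partial_deriv i \<phi> x) \<le> B)" if "i \<in> Basis" for i
    using Cc_inf_bounded[OF Cc_inf_partial_deriv[OF assms that]] by metis
  then obtain B where B: "\<And>i x. i \<in> Basis \<Longrightarrow> norm (partial_deriv i \<phi> x) \<le> B i" "\<And>i. i \<in> Basis \<Longrightarrow> 0 \<le> B i"
    by metis
  have "norm (\<phi> y - \<phi> x) \<le> (\<Sum>i\<in>Basis. B i) * norm (y - x)" for x y
  proof (rule differentiable_bound[of UNIV])
    fix z
    show "(\<phi> has_derivative (\<lambda>h. \<Sum>i\<in>Basis. (h \<bullet> i) *\<^sub>R partial_deriv i \<phi> z)) (at z within UNIV)"
      using has_derivative_partial_deriv[OF Cc_inf_differentiable[OF assms]] by simp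
    show "onorm (\<lambda>h. \<Sum>i\<in>Basis. (h \<bullet> i) *\<^sub>R partial_deriv i \<phi> z) \<le> (\<Sum>i\<in>Basis. B i)"
    proof (rule onorm_bound)
      fix h :: 'a
      have "norm (\<Sum>i\<in>Basis. (h \<bullet> i) *\<^sub>R partial_deriv i \<phi> z) \<le> (\<Sum>i\<in>Basis. norm h * B i)"
        by (rule sum_norm_le) (auto intro!: mult_mono B simp: Basis_le_norm)
      then show "norm (\<Sum>i\<in>Basis. (h \<bullet> i) *\<^sub>R partial_deriv i \<phi> z) \<le> (\<Sum>i\<in>Basis. B i) * norm h"
        by (simp add: sum_distrib_left mult.commute)
    qed (auto intro: sum_nonneg B)
  qed auto
  then show ?thesis by (intro that[of "\<Sum>i\<in>Basis. B i"]) (auto intro: sum_nonneg B)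
qed

text \<open>
  The remainder is quadratic uniformly in the base point, because the partial derivatives are again
  test functions and hence Lipschitz. This uniformity allows differentiation under the integral sign
  against any integrable function.
\<close>

lemma Cc_inf_Taylor:
  assumes "\<phi> \<in> Cc_inf \<Lambda>"
  obtains L where "0 \<le> L"
    "\<And>x y. norm (\<phi> y - \<phi> x - (\<Sum>i\<in>Basis. ((y - x) \<bullet> i) *\<^sub>R partial_deriv i \<phi> x)) \<le> L * norm (y - x) ^ 2"
proof -
  have "\<exists>L. 0 \<le> L \<and> (\<forall>x y. norm (partial_deriv i \<phi> y - partial_deriv i \<phi> x) \<le> L * norm (y - x))"
    if "i \<in> Basis" for i
    using Cc_inf_lipschitz[OF Cc_inf_partial_deriv[OF assms that]] by metis
  then obtain L where L: "\<And>i x y. i \<in> Basis \<Longrightarrow> norm (partial_deriv i \<phi> y - partial_deriv i \<phi> x) \<le> L i * norm (y - x)"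
    "\<And>i. i \<in> Basis \<Longrightarrow> 0 \<le> L i"
    by metis
  let ?d = "\<lambda>z h. \<Sum>i\<in>Basis. (h \<bullet> i) *\<^sub>R partial_deriv i \<phi> z"
  have "norm (\<phi> y - \<phi> x - ?d x (y - x)) \<le> norm (y - x) * ((\<Sum>i\<in>Basis. L i) * norm (y - x))" for x y
  proof (rule differentiable_bound_linearization[of _ _ "closed_segment x y"])
    show "x + t *\<^sub>R (y - x) \<in> closed_segment x y" if "t \<in> {0..1}" for t
      using that by (auto simp: in_segment algebra_simps intro!: exI[of _ t])
    fix z assume z: "z \<in> closed_segment x y"
    show "(\<phi> has_derivative ?d z) (at z within closed_segment x y)"
      using has_derivative_partial_deriv[OF Cc_inf_differentiable[OF assms]]
      by (rule has_derivative_at_withinI)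
    have zx: "norm (z - x) \<le> norm (y - x)"
      using segment_bound1[OF z] by simp
    show "onorm (?d z - ?d x) \<le> (\<Sum>i\<in>Basis. L i) * norm (y - x)"
    proof (rule onorm_bound)
      fix h :: 'a
      have "norm ((?d z - ?d x) h) = norm (\<Sum>i\<in>Basis. (h \<bullet> i) *\<^sub>R (partial_deriv i \<phi> z - partial_deriv i \<phi> x))"
        by (simp add: sum_subtractf scaleR_diff_right)
      also have "\<dots> \<le> (\<Sum>i\<in>Basis. norm h * (L i * norm (y - x)))"
      proof (rule sum_norm_le)
        fix i :: 'a assume i: "i \<in> Basis"
        have "norm (partial_deriv i \<phi> z - partial_deriv i \<phi> x) \<le> L i * norm (y - x)"
          using L[OF i] zx by (meson mult_left_mono order_trans)
        then show "norm ((h \<bullet> i) *\<^sub>R (partial_deriv i \<phi> z - partial_deriv i \<phi> x)) \<le> norm h * (L i * norm (y - x))"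
          using i by (auto intro!: mult_mono simp: Basis_le_norm)
      qed
      finally show "norm ((?d z - ?d x) h) \<le> (\<Sum>i\<in>Basis. L i) * norm (y - x) * norm h"
        by (simp add: sum_distrib_left sum_distrib_right mult_ac)
    qed (auto intro!: mult_nonneg_nonneg sum_nonneg L)
  qed auto
  then show ?thesis
    by (intro that[of "\<Sum>i\<in>Basis. L i"]) (auto intro: sum_nonneg L simp: power2_eq_square mult_ac)
qed

section \<open>Affine changes of variables\<close>

lemma lborel_integral_affine:
  fixes g :: "'a::euclidean_space \<Rightarrow> 'c::{banach, second_countable_topology}"
  assumes c: "c \<noteq> 0" and [measurable]: "g \<in> borel_measurable borel"
  shows "(\<integral>x. g x \<partial>lborel) = (\<bar>c\<bar> ^ DIM('a)) *\<^sub>R (\<integral>x. g (t + c *\<^sub>R x) \<partial>lborel)"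
  by (subst lborel_affine[OF c, of t]) (simp add: integral_density integral_distr ennreal_power)

lemma lborel_nn_integral_affine:
  fixes g :: "'a::euclidean_space \<Rightarrow> ennreal"
  assumes c: "c \<noteq> 0" and [measurable]: "g \<in> borel_measurable borel"
  shows "(\<integral>\<^sup>+x. g x \<partial>lborel) = ennreal (\<bar>c\<bar> ^ DIM('a)) * (\<integral>\<^sup>+x. g (t + c *\<^sub>R x) \<partial>lborel)"
  by (subst lborel_affine[OF c, of t])
    (simp add: nn_integral_density nn_integral_distr nn_integral_cmult)

lemma lborel_integrable_affine:
  fixes g :: "'a::euclidean_space \<Rightarrow> 'c::{banach, second_countable_topology}"
  assumes c: "c \<noteq> 0" and "integrable lborel g"
  shows "integrable lborel (\<lambda>x. g (t + c *\<^sub>R x))"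
proof -
  have [measurable]: "g \<in> borel_measurable borel"
    using assms(2) by (simp add: integrable_iff_bounded)
  have "(\<integral>\<^sup>+x. norm (g x) \<partial>lborel) < \<infinity>" using assms(2) by (simp add: integrable_iff_bounded)
  then have "(\<integral>\<^sup>+x. norm (g (t + c *\<^sub>R x)) \<partial>lborel) < \<infinity>"
    using c lborel_nn_integral_affine[OF c, of "\<lambda>x. ennreal (norm (g x))" t]
    by (auto simp: ennreal_mult_less_top less_top[symmetric] ennreal_mult_eq_top_iff)
  then show ?thesis by (simp add: integrable_iff_bounded)
qed

lemma Cc_inf_integrable:
  fixes \<phi> :: "'a::euclidean_space \<Rightarrow> 'b::euclidean_space"
  assumes "\<phi> \<in> Cc_inf \<Lambda>"
  shows "integrable lborel \<phi>"
proof -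
  have "integrable lborel (\<lambda>x. indicator (supp \<phi>) x *\<^sub>R \<phi> x)"
    using assms by (intro borel_integrable_compact) (auto simp: Cc_inf_iff smooth_continuous_on)
  moreover have "(\<lambda>x. indicator (supp \<phi>) x *\<^sub>R \<phi> x) = \<phi>"
    using eq_0_if_notin_supp[of _ \<phi>] by (auto simp: indicator_def)
  ultimately show ?thesis by simp
qed

section \<open>Convolution\<close>

definition conv :: "('a::euclidean_space \<Rightarrow> 'b) \<Rightarrow> ('a \<Rightarrow> 'b::{real_normed_field, euclidean_space}) \<Rightarrow> 'a \<Rightarrow> 'b" where
  "conv f \<phi> x = (\<integral>y. f y * \<phi> (x - y) \<partial>lborel)"

lemma integrable_mult_bounded:
  fixes f g :: "'a \<Rightarrow> 'b::{real_normed_field, euclidean_space}"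
  assumes f: "integrable M f" and g[measurable]: "g \<in> borel_measurable M" and B: "\<And>x. norm (g x) \<le> B"
  shows "integrable M (\<lambda>x. f x * g x)"
proof (rule Bochner_Integration.integrable_bound)
  show "integrable M (\<lambda>x. B * norm (f x))" using f by auto
  have [measurable]: "f \<in> borel_measurable M" using f by auto
  show "(\<lambda>x. f x * g x) \<in> borel_measurable M" by measurable
  show "AE x in M. norm (f x * g x) \<le> norm (B * norm (f x))"
    using order_trans[OF norm_ge_zero B] B
    by (intro AE_I2) (auto simp: norm_mult abs_mult mult.commute[of B] intro!: mult_left_mono)
qed

lemma conv_integrable:
  fixes f :: "'a::euclidean_space \<Rightarrow> 'b::{real_normed_field, euclidean_space}"
  assumes f: "integrable lborel f" and \<phi>: "\<phi> \<in> Cc_inf \<Lambda>"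
  shows "integrable lborel (\<lambda>y. f y * \<phi> (x - y))"
proof -
  have [measurable]: "\<phi> \<in> borel_measurable borel"
    using \<phi> by (auto intro: smooth_borel_measurable Cc_inf_smooth)
  from \<phi> obtain B where B: "\<And>x. norm (\<phi> x) \<le> B" using Cc_inf_bounded by blast
  show ?thesis
    by (rule integrable_mult_bounded[OF f _ B]) measurable
qed

text \<open>
  Integrating the uniform Taylor estimate of \<open>\<phi>\<close> against \<open>|f|\<close> leaves an error that is quadratic in
  \<open>y - x\<close>.
\<close>

lemma conv_has_derivative:
  fixes f :: "'a::euclidean_space \<Rightarrow> 'b::{real_normed_field, euclidean_space}"
  assumes f: "integrable lborel f" and \<phi>: "\<phi> \<in> Cc_inf \<Lambda>"
  shows "(conv f \<phi> has_derivative (\<lambda>h. \<Sum>i\<in>Basis. (h \<bullet> i) *\<^sub>R conv f (partial_deriv i \<phi>) x)) (at x)"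
    (is "(_ has_derivative ?D) _")
  unfolding has_derivative_at_alt
proof (intro conjI allI impI)
  show "bounded_linear ?D"
    by (intro bounded_linear_sum bounded_linear_scaleR_const bounded_linear_inner_left)
  fix e :: real assume e: "0 < e"
  from Cc_inf_Taylor[OF \<phi>] obtain L where L: "0 \<le> L"
    "\<And>x y. norm (\<phi> y - \<phi> x - (\<Sum>i\<in>Basis. ((y - x) \<bullet> i) *\<^sub>R partial_deriv i \<phi> x)) \<le> L * norm (y - x) ^ 2"
    by blast
  define I where "I = (\<integral>z. norm (f z) \<partial>lborel)"
  have I: "0 \<le> I" by (simp add: I_def)
  have key: "norm (conv f \<phi> y - conv f \<phi> x - ?D (y - x)) \<le> I * (L * norm (y - x) ^ 2)" for y
  proof -
    have 1: "integrable lborel (\<lambda>z. f z * \<phi> (y - z))" "integrable lborel (\<lambda>z. f z * \<phi> (x - z))"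
      using conv_integrable[OF f \<phi>] by auto
    have 2: "integrable lborel (\<lambda>z. f z * partial_deriv i \<phi> (x - z))" if "i \<in> Basis" for i
      using conv_integrable[OF f Cc_inf_partial_deriv[OF \<phi> that]] by auto
    let ?R = "\<lambda>z. \<phi> (y - z) - \<phi> (x - z) - (\<Sum>i\<in>Basis. ((y - x) \<bullet> i) *\<^sub>R partial_deriv i \<phi> (x - z))"
    have R: "(\<lambda>z. f z * ?R z) = (\<lambda>z. f z * \<phi> (y - z) - f z * \<phi> (x - z) -
        (\<Sum>i\<in>Basis. ((y - x) \<bullet> i) *\<^sub>R (f z * partial_deriv i \<phi> (x - z))))"
      by (simp add: right_diff_distrib sum_distrib_left)
    have i: "integrable lborel (\<lambda>z. f z * ?R z)"
      unfolding R using 1 2 by (intro Bochner_Integration.integrable_diff Bochner_Integration.integrable_sum integrable_scaleR_right) auto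
    have "conv f \<phi> y - conv f \<phi> x - ?D (y - x) = (\<integral>z. f z * ?R z \<partial>lborel)"
      unfolding R conv_def using 1 2 by simp
    also have "norm \<dots> \<le> (\<integral>z. norm (f z) * (L * norm (y - x) ^ 2) \<partial>lborel)"
    proof (rule order_trans[OF integral_norm_bound], rule integral_mono)
      show "norm (f z * ?R z) \<le> norm (f z) * (L * norm (y - x) ^ 2)" for z
        using L(2)[of "y - z" "x - z"] by (auto simp: norm_mult intro!: mult_left_mono)
    qed (use f i in \<open>auto\<close>)
    finally show ?thesis by (simp add: I_def)
  qed
  let ?d = "e / (I * L + 1)"
  have IL: "0 \<le> I * L" using I L by simp
  show "\<exists>d>0. \<forall>y. norm (y - x) < d \<longrightarrow> norm (conv f \<phi> y - conv f \<phi> x - ?D (y - x)) \<le> e * norm (y - x)"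
  proof (intro exI[of _ ?d] conjI allI impI)
    show "0 < ?d" using e IL by simp
    fix y assume "norm (y - x) < ?d"
    then have "(I * L + 1) * norm (y - x) < e" using IL by (simp add: field_simps)
    moreover have "I * L * norm (y - x) \<le> (I * L + 1) * norm (y - x)" by (simp add: mult_right_mono)
    ultimately have "I * L * norm (y - x) * norm (y - x) \<le> e * norm (y - x)"
      by (intro mult_right_mono) auto
    then show "norm (conv f \<phi> y - conv f \<phi> x - ?D (y - x)) \<le> e * norm (y - x)"
      using key[of y] by (simp add: power2_eq_square mult_ac)
  qed
qed

lemma partial_deriv_conv:
  assumes "integrable lborel f" "\<phi> \<in> Cc_inf \<Lambda>" "i \<in> Basis"
  shows "partial_deriv i (conv f \<phi>) = conv f (partial_deriv i \<phi>)"
proof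
  fix x
  show "partial_deriv i (conv f \<phi>) x = conv f (partial_deriv i \<phi>) x"
    using partial_deriv_eq[OF conv_has_derivative[OF assms(1,2)], of i x] assms(3)
    by (simp add: inner_Basis if_distrib if_distribR cong: if_cong)
qed

lemma smooth_conv:
  assumes f: "integrable lborel f" and \<phi>: "\<phi> \<in> Cc_inf \<Lambda>"
  shows "smooth (conv f \<phi>)"
proof (rule smooth_coinduct[of _ "conv f ` Cc_inf \<Lambda>"])
  show "conv f \<phi> \<in> conv f ` Cc_inf \<Lambda>" using \<phi> by (rule imageI)
  fix g assume "g \<in> conv f ` Cc_inf \<Lambda>"
  then obtain \<psi> where \<psi>: "\<psi> \<in> Cc_inf \<Lambda>" and g: "g = conv f \<psi>" by (elim imageE)
  show "g differentiable (at x)" for x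
    unfolding differentiable_def g using conv_has_derivative[OF f \<psi>] by blast
  show "partial_deriv i g \<in> conv f ` Cc_inf \<Lambda>" if i: "i \<in> Basis" for i
    unfolding g partial_deriv_conv[OF f \<psi> i]
    by (rule imageI[OF Cc_inf_partial_deriv[OF \<psi> i]])
qed

lemma conv_eq_0:
  assumes f: "\<And>y. y \<notin> K \<Longrightarrow> f y = 0" and \<phi>: "\<And>y. r \<le> norm y \<Longrightarrow> \<phi> y = 0"
    and x: "\<And>y. y \<in> K \<Longrightarrow> r \<le> dist x y"
  shows "conv f \<phi> x = 0"
proof -
  have "f y * \<phi> (x - y) = 0" for y
    using f[of y] \<phi>[of "x - y"] x[of y] by (cases "y \<in> K") (auto simp: dist_norm)
  then have "(\<lambda>y. f y * \<phi> (x - y)) = (\<lambda>y. 0)" by (rule ext)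
  then show ?thesis unfolding conv_def by (simp only: Bochner_Integration.integral_zero)
qed

section \<open>Mollifiers\<close>

definition bump :: "'a::euclidean_space \<Rightarrow> real" where
  "bump x = flat_exp 0 (1 - x \<bullet> x)"

text \<open>
  The rescaled bump function of total mass one, supported in the closed ball of radius \<open>e\<close>. It takes
  values in the scalar field, like the test functions; being nonnegative it agrees with its norm, and
  its real-valued instance serves as the corresponding probability density.
\<close>

definition mollifier :: "real \<Rightarrow> 'a::euclidean_space \<Rightarrow> 'b::real_normed_field" where
  "mollifier e x = of_real ((1 / (e ^ DIM('a) * (\<integral>y. bump y \<partial>(lborel :: 'a measure)))) * bump ((1 / e) *\<^sub>R x))"

lemma bump_nonneg: "0 \<le> bump x"
  by (simp add: bump_def flat_exp_def)

lemma bump_eq_0: "1 \<le> norm x \<Longrightarrow> bump x = 0"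
  by (simp add: bump_def flat_exp_def dot_square_norm abs_square_less_1)

lemma bump_in_Cc_inf: "bump \<in> Cc_inf (UNIV :: 'a::euclidean_space set)"
proof (rule Cc_infI)
  show "smooth (bump :: 'a \<Rightarrow> real)"
    using smooth_bump[of 0] by (simp add: bump_def[abs_def])
  show "bump x = 0" if "x \<notin> cball 0 1" for x :: 'a
    using that by (intro bump_eq_0) simp
qed auto

lemma integral_bump_pos: "0 < (\<integral>y. bump y \<partial>(lborel :: 'a::euclidean_space measure))"
proof -
  have I: "integrable lborel (bump :: 'a \<Rightarrow> real)" by (rule Cc_inf_integrable[OF bump_in_Cc_inf])
  have "(\<integral>y. bump y \<partial>(lborel :: 'a measure)) \<noteq> 0"
  proof
    assume "(\<integral>y. bump y \<partial>(lborel :: 'a measure)) = 0"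
    then have "AE x in lborel. bump (x :: 'a) = 0"
      using integral_nonneg_eq_0_iff_AE[OF I] bump_nonneg by auto
    then have "AE x in lborel. (x :: 'a) \<notin> ball 0 1"
      by (rule AE_mp) (auto simp: bump_def flat_exp_def dot_square_norm abs_square_less_1)
    then have "ball (0 :: 'a) 1 \<in> null_sets lborel"
      by (subst AE_iff_null_sets) auto
    then have "ball (0 :: 'a) 1 \<in> null_sets lebesgue"
      by (rule null_sets_completionI)
    then show False
      using open_not_negligible[of "ball (0 :: 'a) 1"] by (simp add: negligible_iff_null_sets)
  qed
  moreover have "0 \<le> (\<integral>y. bump y \<partial>(lborel :: 'a measure))"
    by (simp add: bump_nonneg)
  ultimately show ?thesis by linarith
qed

context
  fixes e :: real
  assumes e: "0 < e"
begin

lemma norm_mollifier: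
  "norm (mollifier e (x :: 'a::euclidean_space) :: 'b::real_normed_field) = mollifier e x"
  using e integral_bump_pos[where ?'a = 'a] bump_nonneg[of "(1 / e) *\<^sub>R x"]
  by (auto simp: mollifier_def abs_mult simp del: of_real_divide of_real_mult)

lemma of_real_mollifier: "of_real (mollifier e x) = mollifier e x"
  by (simp add: mollifier_def)

lemma mollifier_eq_0: "e \<le> norm x \<Longrightarrow> mollifier e x = 0"
  using e by (simp add: mollifier_def bump_eq_0 field_simps)

lemma smooth_mollifier: "smooth (mollifier e :: 'a::euclidean_space \<Rightarrow> 'b::real_normed_field)"
proof -
  have "smooth (\<lambda>x :: 'a. (1 / (e ^ DIM('a) * (\<integral>y. bump y \<partial>(lborel :: 'a measure)))) *\<^sub>R bump ((1 / e) *\<^sub>R x + 0))"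
    by (rule smooth_affine[OF Cc_inf_smooth[OF bump_in_Cc_inf]])
  from smooth_linear[OF bounded_linear_of_real this]
  show ?thesis by (simp add: mollifier_def[abs_def] del: of_real_divide of_real_mult)
qed

lemma mollifier_in_Cc_inf: "(mollifier e :: 'a::euclidean_space \<Rightarrow> 'b::real_normed_field) \<in> Cc_inf UNIV"
  by (rule Cc_infI[OF smooth_mollifier, of "cball 0 e"]) (auto intro: mollifier_eq_0)

lemma integral_mollifier:
  "(\<integral>x. mollifier e (x :: 'a::euclidean_space) \<partial>lborel) = (1 :: 'b::{real_normed_field, euclidean_space})"
proof -
  have [measurable]: "bump \<in> borel_measurable (borel :: 'a measure)"
    by (rule smooth_borel_measurable[OF Cc_inf_smooth[OF bump_in_Cc_inf]])
  have "(\<integral>x. bump ((1 / e) *\<^sub>R (x :: 'a)) \<partial>lborel) = e ^ DIM('a) * (\<integral>x. bump (x :: 'a) \<partial>lborel)"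
    using lborel_integral_affine[of e "\<lambda>x :: 'a. bump ((1 / e) *\<^sub>R x)" 0] e by simp
  then have "(\<integral>x. mollifier e (x :: 'a) \<partial>lborel) = (1 :: real)"
    using e integral_bump_pos[where ?'a = 'a] by (simp add: mollifier_def)
  moreover have "(\<integral>x. mollifier e (x :: 'a) \<partial>lborel) = (of_real (\<integral>x. mollifier e (x :: 'a) \<partial>lborel) :: 'b)"
    by (subst integral_of_real[symmetric])
      (simp_all add: of_real_mollifier Cc_inf_integrable[OF mollifier_in_Cc_inf])
  ultimately show ?thesis by simp
qed

end

text \<open>
  By scaling. The rate \<open>1/e\<close> is what makes the cutoff functions below compatible with the weight
  \<open>1 / infdist x D\<close>.
\<close>

lemma integral_partial_deriv_mollifier:
  obtains C where "0 \<le> C" "\<And>e i. 0 < e \<Longrightarrow> i \<in> Basis \<Longrightarrow>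
    (\<integral>x. norm (partial_deriv i (mollifier e :: 'a::euclidean_space \<Rightarrow> 'b::{real_normed_field, euclidean_space}) x) \<partial>lborel) \<le> C / e"
proof -
  let ?I = "\<integral>y. bump y \<partial>(lborel :: 'a measure)"
  let ?J = "\<lambda>i. \<integral>x. norm (partial_deriv i bump x) \<partial>(lborel :: 'a measure)"
  have I: "0 < ?I" by (rule integral_bump_pos)
  have "(\<integral>x. norm (partial_deriv i (mollifier e :: 'a \<Rightarrow> 'b) x) \<partial>lborel) \<le> ((\<Sum>i\<in>Basis. ?J i) / ?I) / e"
    if e: "0 < e" and i: "i \<in> Basis" for e and i :: 'a
  proof -
    have [measurable]: "partial_deriv i bump \<in> borel_measurable (borel :: 'a measure)"
      by (rule smooth_borel_measurable[OF smooth_partial_deriv[OF Cc_inf_smooth[OF bump_in_Cc_inf] i]])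
    define c where "c = 1 / (e ^ DIM('a) * ?I)"
    have m: "(mollifier e :: 'a \<Rightarrow> 'b) = (\<lambda>x. of_real (c *\<^sub>R bump ((1 / e) *\<^sub>R x + 0)))"
      by (simp add: mollifier_def[abs_def] c_def)
    have "smooth (\<lambda>x :: 'a. 1 *\<^sub>R bump ((1 / e) *\<^sub>R x + 0))"
      by (rule smooth_affine[OF Cc_inf_smooth[OF bump_in_Cc_inf]])
    then have s1: "smooth (\<lambda>x :: 'a. bump ((1 / e) *\<^sub>R x + 0))" by simp
    have s2: "smooth (\<lambda>x :: 'a. c *\<^sub>R bump ((1 / e) *\<^sub>R x + 0))"
      by (rule smooth_affine[OF Cc_inf_smooth[OF bump_in_Cc_inf]])
    have "partial_deriv i (mollifier e :: 'a \<Rightarrow> 'b) x = of_real (c * (1 / e) * partial_deriv i bump ((1 / e) *\<^sub>R x))" for x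
      unfolding m
      apply (subst partial_deriv_linear[OF bounded_linear_of_real smooth_differentiable[OF s2]])
      apply (subst partial_deriv_linear[OF bounded_linear_scaleR_right smooth_differentiable[OF s1]])
      apply (subst partial_deriv_affine[OF Cc_inf_differentiable[OF bump_in_Cc_inf]])
      apply simp
      done
    then have "(\<integral>x. norm (partial_deriv i (mollifier e :: 'a \<Rightarrow> 'b) x) \<partial>lborel) =
        \<bar>c\<bar> * (1 / e) * (\<integral>x. norm (partial_deriv i bump ((1 / e) *\<^sub>R (x :: 'a))) \<partial>lborel)"
      using e by (simp add: abs_mult mult_ac del: of_real_divide of_real_mult)
    also have "(\<integral>x. norm (partial_deriv i bump ((1 / e) *\<^sub>R (x :: 'a))) \<partial>lborel) = e ^ DIM('a) * ?J i"
      using lborel_integral_affine[of e "\<lambda>x :: 'a. norm (partial_deriv i bump ((1 / e) *\<^sub>R x))" 0] e by simp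
    also have "\<bar>c\<bar> * (1 / e) * (e ^ DIM('a) * ?J i) = (?J i / ?I) / e"
      using e I by (simp add: c_def field_simps)
    also have "\<dots> \<le> ((\<Sum>i\<in>Basis. ?J i) / ?I) / e"
      using e I i by (intro divide_right_mono member_le_sum) auto
    finally show ?thesis .
  qed
  then show ?thesis
    using I by (intro that[of "(\<Sum>i\<in>Basis. ?J i) / ?I"]) (auto intro!: divide_nonneg_pos sum_nonneg)
qed

section \<open>Cutoff functions\<close>

lemma compact_cball_neighbourhood:
  fixes K :: "'a::euclidean_space set"
  assumes "compact K"
  shows "compact (\<Union>k\<in>K. cball k r)"
proof -
  have "(\<Union>k\<in>K. cball k r) = {x + y | x y. x \<in> K \<and> y \<in> cball 0 r}"
    by (force simp: dist_norm norm_minus_commute intro: exI[of _ "_ - _"])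
  then show ?thesis using compact_sums[OF assms compact_cball[of 0 r]] by simp
qed

lemma lborel_integral_reflect:
  fixes g :: "'a::euclidean_space \<Rightarrow> 'c::{banach, second_countable_topology}"
  assumes "g \<in> borel_measurable borel"
  shows "(\<integral>y. g (x - y) \<partial>lborel) = (\<integral>y. g y \<partial>lborel)"
  using lborel_integral_affine[of "-1" g x] assms by simp

text \<open>
  Mollify the indicator function of the \<open>2\<delta>\<close>-neighbourhood of \<open>K\<close> at scale \<open>\<delta>\<close>.
\<close>

lemma cutoff_exists:
  obtains C where "0 \<le> C" "\<And>K \<delta>. compact (K :: 'a::euclidean_space set) \<Longrightarrow> 0 < \<delta> \<Longrightarrow>
    \<exists>\<theta>. smooth (\<theta> :: 'a \<Rightarrow> 'b::{real_normed_field, euclidean_space}) \<and>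
      supp \<theta> \<subseteq> (\<Union>k\<in>K. cball k (3 * \<delta>)) \<and> (\<forall>x. norm (\<theta> x) \<le> 1) \<and>
      (\<forall>x. (\<exists>k\<in>K. dist x k < \<delta>) \<longrightarrow> \<theta> x = 1) \<and> (\<forall>i\<in>Basis. \<forall>x. norm (partial_deriv i \<theta> x) \<le> C / \<delta>)"
proof -
  obtain C where C: "0 \<le> C" "\<And>e i. 0 < e \<Longrightarrow> i \<in> Basis \<Longrightarrow>
    (\<integral>x. norm (partial_deriv i (mollifier e :: 'a \<Rightarrow> 'b) x) \<partial>lborel) \<le> C / e"
    using integral_partial_deriv_mollifier[where ?'a = 'a and ?'b = 'b] by blast
  show ?thesis
  proof (rule that[OF C(1)])
    fix K :: "'a set" and \<delta> :: real
    assume K: "compact K" and \<delta>: "0 < \<delta>"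
    let ?A = "\<Union>k\<in>K. ball k (2 * \<delta>)"
    let ?m = "mollifier \<delta> :: 'a \<Rightarrow> 'b"
    let ?f = "(\<lambda>x. indicator ?A x *\<^sub>R 1) :: 'a \<Rightarrow> 'b"
    define \<theta> where "\<theta> = conv ?f ?m"
    have [measurable]: "?A \<in> sets borel" by (intro borel_open open_UN) auto
    have "bounded ?A"
      by (rule bounded_subset[OF compact_imp_bounded[OF compact_cball_neighbourhood[OF K, of "2 * \<delta>"]]]) auto
    then have f: "integrable lborel ?f"
      by (intro integrable_scaleR_left integrable_real_indicator emeasure_bounded_finite) auto
    have m: "?m \<in> Cc_inf UNIV" by (rule mollifier_in_Cc_inf[OF \<delta>])
    have [measurable]: "?m \<in> borel_measurable borel" by (rule smooth_borel_measurable[OF smooth_mollifier[OF \<delta>]])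
    have le: "norm (conv ?f \<psi> x) \<le> (\<integral>y. norm (\<psi> y) \<partial>lborel)" if \<psi>: "\<psi> \<in> Cc_inf UNIV" for \<psi> x
    proof -
      have [measurable]: "\<psi> \<in> borel_measurable borel"
        by (rule smooth_borel_measurable[OF Cc_inf_smooth[OF \<psi>]])
      have "integrable lborel (\<lambda>y. \<psi> (x - y))"
        using lborel_integrable_affine[OF _ Cc_inf_integrable[OF \<psi>], of "-1" x] by simp
      then have "norm (conv ?f \<psi> x) \<le> (\<integral>y. norm (\<psi> (x - y)) \<partial>lborel)"
        unfolding conv_def
        by (intro order_trans[OF integral_norm_bound] integral_mono integrable_norm conv_integrable[OF f \<psi>])
           (auto simp: indicator_def)
      also have "\<dots> = (\<integral>y. norm (\<psi> y) \<partial>lborel)"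
        by (rule lborel_integral_reflect) simp
      finally show ?thesis .
    qed
    show "\<exists>\<theta> :: 'a \<Rightarrow> 'b. smooth \<theta> \<and>
      supp \<theta> \<subseteq> (\<Union>k\<in>K. cball k (3 * \<delta>)) \<and> (\<forall>x. norm (\<theta> x) \<le> 1) \<and>
      (\<forall>x. (\<exists>k\<in>K. dist x k < \<delta>) \<longrightarrow> \<theta> x = 1) \<and> (\<forall>i\<in>Basis. \<forall>x. norm (partial_deriv i \<theta> x) \<le> C / \<delta>)"
    proof (intro exI[of _ \<theta>] conjI allI ballI impI)
      show "smooth \<theta>" unfolding \<theta>_def by (rule smooth_conv[OF f m])
      show "supp \<theta> \<subseteq> (\<Union>k\<in>K. cball k (3 * \<delta>))"
      proof (rule supp_minimal)
        fix x assume x: "x \<notin> (\<Union>k\<in>K. cball k (3 * \<delta>))"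
        show "\<theta> x = 0" unfolding \<theta>_def
        proof (rule conv_eq_0[of ?A _ \<delta>])
          fix y assume "y \<in> ?A"
          then obtain k where "k \<in> K" "dist k y < 2 * \<delta>" by auto
          moreover from this x have "3 * \<delta> < dist k x" by auto
          ultimately show "\<delta> \<le> dist x y" using dist_triangle[of k x y] by (simp add: dist_commute)
        qed (auto intro: mollifier_eq_0[OF \<delta>])
      qed (rule compact_imp_closed[OF compact_cball_neighbourhood[OF K]])
      have "(\<integral>y. norm (?m y) \<partial>lborel) = 1"
        by (simp add: norm_mollifier[OF \<delta>] integral_mollifier[OF \<delta>])
      then show "norm (\<theta> x) \<le> 1" for x using le[OF m, of x] by (simp add: \<theta>_def)
      show "\<theta> x = 1" if "\<exists>k\<in>K. dist x k < \<delta>" for x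
      proof -
        from that obtain k where k: "k \<in> K" "dist x k < \<delta>" by auto
        have "?f y * ?m (x - y) = ?m (x - y)" for y
        proof (cases "dist x y < \<delta>")
          case True
          then have "dist k y < 2 * \<delta>" using k(2) dist_triangle[of k y x] by (simp add: dist_commute)
          with k(1) have "y \<in> ?A" by auto
          then show ?thesis by simp
        next
          case False
          then have "?m (x - y) = 0" by (intro mollifier_eq_0[OF \<delta>]) (simp add: dist_norm)
          then show ?thesis by simp
        qed
        then have "\<theta> x = (\<integral>y. ?m (x - y) \<partial>lborel)" by (simp add: \<theta>_def conv_def)
        also have "\<dots> = 1" using lborel_integral_reflect[of ?m x] by (simp add: integral_mollifier[OF \<delta>])
        finally show ?thesis .
      qed
      fix i :: 'a and x assume i: "i \<in> Basis"
      show "norm (partial_deriv i \<theta> x) \<le> C / \<delta>"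
        using le[OF Cc_inf_partial_deriv[OF m i], of x] C(2)[OF \<delta> i]
        unfolding \<theta>_def partial_deriv_conv[OF f m i] by linarith
    qed
  qed
qed

lemma smooth_Urysohn:
  fixes K U :: "'a::euclidean_space set"
  assumes "compact K" "open U" "K \<subseteq> U"
  obtains \<theta> :: "'a \<Rightarrow> 'b::{real_normed_field, euclidean_space}" and V
    where "\<theta> \<in> Cc_inf U" "open V" "K \<subseteq> V" "\<And>x. x \<in> V \<Longrightarrow> \<theta> x = 1"
proof -
  obtain e where e: "0 < e" "(\<Union>k\<in>K. cball k e) \<subseteq> U"
    using compact_subset_open_imp_cball_epsilon_subset[OF assms] by blast
  obtain \<theta> :: "'a \<Rightarrow> 'b" where \<theta>: "smooth \<theta>" "supp \<theta> \<subseteq> (\<Union>k\<in>K. cball k (3 * (e / 3)))"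
      "\<And>x. (\<exists>k\<in>K. dist x k < e / 3) \<Longrightarrow> \<theta> x = 1"
    using cutoff_exists[where ?'a = 'a and ?'b = 'b] assms(1) e(1) by (metis divide_pos_pos zero_less_numeral)
  show ?thesis
  proof (rule that)
    show "\<theta> \<in> Cc_inf U"
    proof (rule Cc_infI[OF \<theta>(1) compact_cball_neighbourhood[OF assms(1), of e] e(2)])
      show "\<theta> x = 0" if "x \<notin> (\<Union>k\<in>K. cball k e)" for x
      proof (rule eq_0_if_notin_supp[of x \<theta>])
        have "supp \<theta> \<subseteq> (\<Union>k\<in>K. cball k e)" using \<theta>(2) by simp
        with that show "x \<notin> supp \<theta>" by blast
      qed
    qed
    show "open (\<Union>k\<in>K. ball k (e / 3))" by auto
    show "K \<subseteq> (\<Union>k\<in>K. ball k (e / 3))" using e(1) by auto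
    show "\<theta> x = 1" if "x \<in> (\<Union>k\<in>K. ball k (e / 3))" for x
      using that by (intro \<theta>(3)) (auto simp: dist_commute)
  qed
qed

section \<open>Inequalities for powers\<close>

lemma powr_above_tangent:
  fixes t c :: real
  assumes p: "1 \<le> p" and "0 \<le> t" "0 \<le> c"
  shows "c powr p + p * c powr (p - 1) * (t - c) \<le> t powr p"
proof -
  consider "c = 0" | "0 < c" "t = 0" | "0 < c" "0 < t" using assms by linarith
  then show ?thesis
  proof cases
    case 2
    have "c powr (p - 1) * c = c powr p" using 2 by (simp add: powr_mult_base mult.commute)
    then have "c powr p + p * c powr (p - 1) * (t - c) = (1 - p) * c powr p"
      using 2 by (simp add: algebra_simps)
    then show ?thesis using p 2 by (simp add: mult_le_0_iff)
  next
    case 3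
    have "p * c powr (p - 1) * (t - c) \<le> t powr p - c powr p"
      using 3 p by (intro convex_on_imp_above_tangent[of "{0<..}" "\<lambda>x. x powr p"] powr_convex)
        (auto simp: interior_open intro!: derivative_eq_intros)
    then show ?thesis by simp
  qed simp
qed

lemma sum_powr_le:
  fixes a :: "'i \<Rightarrow> real"
  assumes "finite I" "\<And>i. i \<in> I \<Longrightarrow> 0 \<le> a i" "0 \<le> p"
  shows "(\<Sum>i\<in>I. a i) powr p \<le> real (card I) powr p * (\<Sum>i\<in>I. a i powr p)"
proof (cases "I = {}")
  case False
  define M where "M = Max (a ` I)"
  have "M \<in> a ` I" unfolding M_def using assms(1) False by (intro Max_in) auto
  then obtain j where j: "j \<in> I" "a j = M" by auto
  have le: "a i \<le> M" if "i \<in> I" for i unfolding M_def using assms(1) that by auto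
  have "(\<Sum>i\<in>I. a i) \<le> real (card I) * M"
    using sum_bounded_above[of I a M] le by simp
  then have "(\<Sum>i\<in>I. a i) powr p \<le> (real (card I) * M) powr p"
    using assms by (intro powr_mono2 sum_nonneg) auto
  also have "\<dots> = real (card I) powr p * a j powr p"
    using j assms(2)[OF j(1)] by (simp add: powr_mult)
  also have "\<dots> \<le> real (card I) powr p * (\<Sum>i\<in>I. a i powr p)"
    using j assms by (intro mult_left_mono member_le_sum) auto
  finally show ?thesis .
qed simp

lemma add_powr_le:
  fixes a b :: real
  assumes "0 \<le> a" "0 \<le> b" "0 \<le> p"
  shows "(a + b) powr p \<le> 2 powr p * (a powr p + b powr p)"
  using sum_powr_le[of "UNIV :: bool set" "\<lambda>i. if i then a else b" p] assms
  by (simp add: UNIV_bool add.commute)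

lemma norm_add_powr_le:
  fixes a b :: "'b::real_normed_vector"
  assumes "0 \<le> p"
  shows "norm (a + b) powr p \<le> 2 powr p * (norm a powr p + norm b powr p)"
  using add_powr_le[of "norm a" "norm b" p] powr_mono2[of p "norm (a + b)" "norm a + norm b"]
    norm_triangle_ineq[of a b] assms by simp

text \<open>
  Jensen's inequality for the probability density \<open>m\<close>: integrate the tangent of \<open>t powr p\<close> at the mean.
\<close>

lemma Jensen_powr:
  fixes g m :: "'c \<Rightarrow> real"
  assumes p: "1 \<le> p" and g[measurable]: "g \<in> borel_measurable M" "\<And>x. 0 \<le> g x"
    and m: "integrable M m" "\<And>x. 0 \<le> m x" "(\<integral>x. m x \<partial>M) = 1"
    and gm: "integrable M (\<lambda>x. g x * m x)"
  shows "ennreal ((\<integral>x. g x * m x \<partial>M) powr p) \<le> (\<integral>\<^sup>+x. ennreal (g x powr p * m x) \<partial>M)"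
proof (cases "(\<integral>\<^sup>+x. ennreal (g x powr p * m x) \<partial>M) = \<infinity>")
  case False
  have [measurable]: "m \<in> borel_measurable M" using m(1) by auto
  have i: "integrable M (\<lambda>x. g x powr p * m x)"
    using False m(2) by (intro integrableI_nonneg) (auto simp: less_top)
  define c where "c = (\<integral>x. g x * m x \<partial>M)"
  have c: "0 \<le> c" unfolding c_def using g m by simp
  have i2: "integrable M (\<lambda>x. (c powr p + p * c powr (p - 1) * (g x - c)) * m x)"
  proof -
    have "(\<lambda>x. (c powr p + p * c powr (p - 1) * (g x - c)) * m x) =
      (\<lambda>x. (c powr p - p * c powr (p - 1) * c) * m x + p * c powr (p - 1) * (g x * m x))"
      by (auto simp: algebra_simps)
    then show ?thesis using m gm by simp
  qed
  have "c powr p = (c powr p - p * c powr (p - 1) * c) * (\<integral>x. m x \<partial>M) + p * c powr (p - 1) * (\<integral>x. g x * m x \<partial>M)"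
    using m by (simp add: c_def)
  also have "\<dots> = (\<integral>x. (c powr p - p * c powr (p - 1) * c) * m x + p * c powr (p - 1) * (g x * m x) \<partial>M)"
    using m gm by (subst Bochner_Integration.integral_add) simp_all
  also have "\<dots> = (\<integral>x. (c powr p + p * c powr (p - 1) * (g x - c)) * m x \<partial>M)"
    by (intro Bochner_Integration.integral_cong) (auto simp: algebra_simps)
  also have "\<dots> \<le> (\<integral>x. g x powr p * m x \<partial>M)"
    using powr_above_tangent[OF p g(2) c] m(2) by (intro integral_mono i i2 mult_right_mono)
  finally have "ennreal (c powr p) \<le> ennreal (\<integral>x. g x powr p * m x \<partial>M)"
    by (rule ennreal_leI)
  also have "\<dots> = (\<integral>\<^sup>+x. ennreal (g x powr p * m x) \<partial>M)"
    using i m(2) by (intro nn_integral_eq_integral[symmetric]) auto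
  finally show ?thesis by (simp add: c_def)
qed simp

section \<open>Translations in Lebesgue spaces\<close>

text \<open>
  Leaving out the root keeps the distance an integral, to which Tonelli's theorem applies; the price is
  the factor \<open>2 powr p\<close> in the triangle inequality.
\<close>

definition Lp_dist_powr :: "real \<Rightarrow> ('a::euclidean_space \<Rightarrow> 'b::real_normed_vector) \<Rightarrow> ('a \<Rightarrow> 'b) \<Rightarrow> ennreal" where
  "Lp_dist_powr p f g = (\<integral>\<^sup>+x. ennreal (norm (f x - g x) powr p) \<partial>lborel)"

lemma Lp_dist_powr_triangle:
  fixes f g h :: "'a::euclidean_space \<Rightarrow> 'b::euclidean_space"
  assumes p: "0 \<le> p" and [measurable]: "f \<in> borel_measurable borel" "g \<in> borel_measurable borel" "h \<in> borel_measurable borel"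
  shows "Lp_dist_powr p f h \<le> ennreal (2 powr p) * (Lp_dist_powr p f g + Lp_dist_powr p g h)"
proof -
  have "Lp_dist_powr p f h \<le> (\<integral>\<^sup>+x. ennreal (2 powr p) * (ennreal (norm (f x - g x) powr p) + ennreal (norm (g x - h x) powr p)) \<partial>lborel)"
    unfolding Lp_dist_powr_def
  proof (rule nn_integral_mono)
    fix x
    show "ennreal (norm (f x - h x) powr p) \<le> ennreal (2 powr p) * (ennreal (norm (f x - g x) powr p) + ennreal (norm (g x - h x) powr p))"
      using norm_add_powr_le[OF p, of "f x - g x" "g x - h x"]
      by (simp flip: ennreal_plus ennreal_mult' add: ennreal_leI)
  qed
  also have "\<dots> = ennreal (2 powr p) * (Lp_dist_powr p f g + Lp_dist_powr p g h)"
    by (simp add: Lp_dist_powr_def nn_integral_cmult nn_integral_add)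
  finally show ?thesis .
qed

lemma tendsto_zero_ennrealE:
  fixes F :: "nat \<Rightarrow> ennreal"
  assumes "F \<longlonglongrightarrow> 0" "0 < e"
  obtains n where "F n < e"
  using order_tendstoD(2)[OF assms] by (auto simp: eventually_sequentially)

lemma Lp_approx_bounded:
  fixes f :: "'a::euclidean_space \<Rightarrow> 'b::euclidean_space"
  assumes p: "1 \<le> p" and [measurable]: "f \<in> borel_measurable borel"
    and fin: "(\<integral>\<^sup>+x. ennreal (norm (f x) powr p) \<partial>lborel) < \<infinity>" and e: "0 < e"
  obtains g :: "'a \<Rightarrow> 'b" and n :: nat where "g \<in> borel_measurable borel" "\<And>x. norm (g x) \<le> n" "\<And>x. n < norm x \<Longrightarrow> g x = 0"
    "Lp_dist_powr p f g < e"
proof -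
  define g where "g n x = (if norm (f x) \<le> real n \<and> norm x \<le> real n then f x else 0)" for n x
  have [measurable]: "g n \<in> borel_measurable borel" for n unfolding g_def[abs_def] by measurable
  have "(\<lambda>n. \<integral>\<^sup>+x. ennreal (norm (f x - g n x) powr p) \<partial>lborel) \<longlonglongrightarrow> (\<integral>\<^sup>+x. 0 \<partial>(lborel :: 'a measure))"
  proof (rule nn_integral_dominated_convergence[where w = "\<lambda>x. ennreal (norm (f x) powr p)"])
    show "AE x in lborel. ennreal (norm (f x - g j x) powr p) \<le> ennreal (norm (f x) powr p)" for j
      by (auto simp: g_def)
    show "AE x in lborel. (\<lambda>i. ennreal (norm (f x - g i x) powr p)) \<longlonglongrightarrow> 0"
    proof (rule AE_I2)
      fix x
      obtain N :: nat where N: "norm (f x) + norm x \<le> N" using real_arch_simple by blast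
      have "\<forall>\<^sub>F i in sequentially. ennreal (norm (f x - g i x) powr p) = 0"
        using eventually_ge_at_top[of N]
      proof eventually_elim
        case (elim i)
        then have "norm (f x) + norm x \<le> i" using N by linarith
        then have "norm (f x) \<le> i" "norm x \<le> i" using norm_ge_zero[of x] norm_ge_zero[of "f x"] by linarith+
        then show ?case by (simp add: g_def)
      qed
      then show "(\<lambda>i. ennreal (norm (f x - g i x) powr p)) \<longlonglongrightarrow> 0" by (rule tendsto_eventually)
    qed
  qed (use fin in auto)
  then obtain n where n: "Lp_dist_powr p f (g n) < e"
    using tendsto_zero_ennrealE[OF _ e] unfolding Lp_dist_powr_def by auto
  show ?thesis
    by (rule that[of "g n" n]) (use n in \<open>auto simp: g_def\<close>)
qed

text \<open>
  A measurable function is almost everywhere a limit of continuous functions. Projecting these onto the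
  ball of radius \<open>n\<close> in the range and damping them outside the ball of radius \<open>n\<close> in the domain gives
  a dominating function without spoiling the limit.
\<close>

lemma Lp_approx_continuous_bounded:
  fixes f :: "'a::euclidean_space \<Rightarrow> 'b::euclidean_space" and n :: nat
  assumes p: "1 \<le> p" and f[measurable]: "f \<in> borel_measurable borel"
    and bounded: "\<And>x. norm (f x) \<le> n" and supp: "\<And>x. n < norm x \<Longrightarrow> f x = 0" and e: "0 < e"
  obtains h :: "'a \<Rightarrow> 'b" where "continuous_on UNIV h" "\<And>x. real n + 1 \<le> norm x \<Longrightarrow> h x = 0"
    "Lp_dist_powr p f h < e"
proof -
  have "f \<in> borel_measurable lebesgue" by (rule measurable_completion) simp
  then have "f measurable_on UNIV" by (rule lebesgue_measurable_imp_measurable_on) simp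
  then obtain N g where N: "negligible N" and g: "\<And>k. continuous_on UNIV (g k)"
      "\<And>x. x \<notin> N \<Longrightarrow> (\<lambda>k. g k x) \<longlonglongrightarrow> f x"
    unfolding measurable_on_def by (simp only: UNIV_I if_True) blast
  define c where "c = closest_point (cball (0 :: 'b) (real n))"
  define \<theta> where "\<theta> x = max 0 (min 1 (real n + 1 - norm x))" for x :: 'a
  define h where "h k x = \<theta> x *\<^sub>R c (g k x)" for k x
  have c: "continuous_on S c" for S
    unfolding c_def by (rule continuous_on_closest_point) auto
  have c_le: "norm (c y) \<le> real n" for y
    using closest_point_in_set[of "cball (0 :: 'b) (real n)" y] by (simp add: c_def)
  have \<theta>: "continuous_on S \<theta>" for S unfolding \<theta>_def by (intro continuous_intros)
  have \<theta>_le: "0 \<le> \<theta> x" "\<theta> x \<le> 1" for x by (auto simp: \<theta>_def)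
  have h: "continuous_on UNIV (h k)" for k
    unfolding h_def by (intro continuous_intros \<theta> continuous_on_compose2[OF c[of UNIV] g(1)]) auto
  have h0: "h k x = 0" if "real n + 1 \<le> norm x" for k x
    using that by (simp add: h_def \<theta>_def)
  have [measurable]: "h k \<in> borel_measurable borel" for k
    by (rule borel_measurable_continuous_onI[OF h])
  have h_le: "norm (h k x) \<le> real n" for k x
    using mult_mono[OF \<theta>_le(2) c_le] \<theta>_le(1)[of x] by (simp add: h_def)
  have diff: "(\<lambda>x. f x - h k x) \<in> borel_measurable lborel" for k by simp
  have m1: "(\<lambda>x. ennreal (norm (f x - h k x) powr p)) \<in> borel_measurable lborel" for k
    by (intro measurable_compose[OF _ measurable_ennreal] powr_real_measurable
        measurable_compose[OF diff borel_measurable_norm] borel_measurable_const)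
  let ?w = "\<lambda>x :: 'a. ennreal ((2 * real n) powr p) * indicator (cball 0 (real n + 1)) x"
  have cb: "cball (0 :: 'a) (real n + 1) \<in> sets lborel" by simp
  have m2: "?w \<in> borel_measurable lborel"
    by (intro borel_measurable_times_ennreal borel_measurable_const borel_measurable_indicator cb)
  have "(\<lambda>k. \<integral>\<^sup>+x. ennreal (norm (f x - h k x) powr p) \<partial>lborel) \<longlonglongrightarrow> (\<integral>\<^sup>+x. 0 \<partial>(lborel :: 'a measure))"
  proof (rule nn_integral_dominated_convergence[where w = ?w])
    show "AE x in lborel. ennreal (norm (f x - h j x) powr p) \<le> ?w x" for j
    proof (rule AE_I2)
      fix x
      show "ennreal (norm (f x - h j x) powr p) \<le> ?w x"
      proof (cases "norm x \<le> real n + 1")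
        case True
        have "norm (f x - h j x) \<le> 2 * real n"
          using norm_triangle_ineq4[of "f x" "h j x"] bounded[of x] h_le[of j x] by linarith
        then show ?thesis using True p by (auto intro!: ennreal_leI powr_mono2)
      next
        case False
        then have "f x = 0" "h j x = 0" using supp[of x] h0[of x j] by auto
        then show ?thesis by simp
      qed
    qed
    show "(\<integral>\<^sup>+x. ?w x \<partial>lborel) < \<infinity>"
      using emeasure_lborel_cball_finite[of "0 :: 'a" "real n + 1"]
      by (simp add: nn_integral_cmult_indicator ennreal_mult_less_top)
    have "AE x in lebesgue. x \<notin> N"
      using N by (intro AE_not_in) (simp add: negligible_iff_null_sets)
    then have "AE x in lborel. x \<notin> N" by (simp add: AE_completion_iff)
    then show "AE x in lborel. (\<lambda>k. ennreal (norm (f x - h k x) powr p)) \<longlonglongrightarrow> 0"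
    proof eventually_elim
      case (elim x)
      have "(\<lambda>k. h k x) \<longlonglongrightarrow> \<theta> x *\<^sub>R c (f x)"
        unfolding h_def
        by (intro tendsto_intros continuous_on_tendsto_compose[OF c[of UNIV] g(2)[OF elim]]) auto
      also have "\<theta> x *\<^sub>R c (f x) = f x"
        using bounded[of x] supp[of x]
        by (cases "norm x \<le> real n") (auto simp: c_def \<theta>_def closest_point_self)
      finally have "(\<lambda>k. norm (f x - h k x)) \<longlonglongrightarrow> norm (f x - f x)"
        by (intro tendsto_norm tendsto_diff tendsto_const)
      then have "(\<lambda>k. norm (f x - h k x)) \<longlonglongrightarrow> 0" by simp
      then have "(\<lambda>k. norm (f x - h k x) powr p) \<longlonglongrightarrow> 0"
        by (rule tendsto_zero_powrI[OF _ tendsto_const]) (use p in simp_all)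
      then have "(\<lambda>k. ennreal (norm (f x - h k x) powr p)) \<longlonglongrightarrow> ennreal 0"
        by (rule tendsto_ennrealI)
      then show ?case by simp
    qed
  qed (rule m1 m2 borel_measurable_const)+
  then obtain k where k: "Lp_dist_powr p f (h k) < e"
    using tendsto_zero_ennrealE[OF _ e] unfolding Lp_dist_powr_def by auto
  show ?thesis
    by (rule that[of "h k"]) (use h h0 k in auto)
qed

lemma Lp_dist_powr_translate_continuous:
  fixes h :: "'a::euclidean_space \<Rightarrow> 'b::euclidean_space"
  assumes p: "1 \<le> p" and h: "continuous_on UNIV h" "\<And>x. r \<le> norm x \<Longrightarrow> h x = 0" and e: "0 < (e :: real)"
  obtains d where "0 < d" "\<And>z. norm z < d \<Longrightarrow> Lp_dist_powr p (\<lambda>x. h (x - z)) h \<le> e"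
proof -
  define V where "V = measure lborel (cball (0 :: 'a) (\<bar>r\<bar> + 1))"
  have V: "0 \<le> V" by (simp add: V_def)
  define s where "s = (e / (V + 1)) powr (1 / p)"
  have s: "0 < s" and sp: "s powr p = e / (V + 1)" using e V p by (auto simp: s_def powr_powr)
  have "uniformly_continuous_on (cball 0 (\<bar>r\<bar> + 2)) h"
    using h(1) by (intro compact_uniformly_continuous) (auto intro: continuous_on_subset)
  then obtain d where d: "0 < d" "\<And>x y. x \<in> cball 0 (\<bar>r\<bar> + 2) \<Longrightarrow> y \<in> cball 0 (\<bar>r\<bar> + 2) \<Longrightarrow> dist x y < d \<Longrightarrow> dist (h x) (h y) < s"
    using s unfolding uniformly_continuous_on_def by metis
  show ?thesis
  proof (rule that[of "min d 1"])
    show "0 < min d 1" using d by simp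
    fix z :: 'a assume z: "norm z < min d 1"
    have "ennreal (norm (h (x - z) - h x) powr p) \<le> ennreal (s powr p) * indicator (cball 0 (\<bar>r\<bar> + 1)) x" for x
    proof (cases "norm x \<le> \<bar>r\<bar> + 1")
      case True
      then have "norm (x - z) \<le> \<bar>r\<bar> + 2" using z norm_triangle_ineq4[of x z] by linarith
      then have "dist (h (x - z)) (h x) < s" using True z by (intro d(2)) (auto simp: dist_norm norm_minus_commute)
      then show ?thesis using True p by (auto simp: dist_norm intro!: ennreal_leI powr_mono2)
    next
      case False
      moreover have "\<bar>r\<bar> \<le> norm (x - z)" using False z norm_triangle_ineq2[of x z] by linarith
      ultimately show ?thesis by (simp add: h(2))
    qed
    then have "Lp_dist_powr p (\<lambda>x. h (x - z)) h \<le> (\<integral>\<^sup>+x. ennreal (s powr p) * indicator (cball 0 (\<bar>r\<bar> + 1)) x \<partial>(lborel :: 'a measure))"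
      unfolding Lp_dist_powr_def by (intro nn_integral_mono)
    also have "\<dots> = ennreal (s powr p * V)"
      using emeasure_lborel_cball_finite[of "0 :: 'a" "\<bar>r\<bar> + 1"]
      by (simp add: nn_integral_cmult_indicator V_def emeasure_eq_ennreal_measure ennreal_mult)
    also have "\<dots> \<le> ennreal e"
      using V e by (intro ennreal_leI) (simp add: sp field_simps)
    finally show "Lp_dist_powr p (\<lambda>x. h (x - z)) h \<le> e" .
  qed
qed

lemma Lp_dist_powr_translate:
  fixes f g :: "'a::euclidean_space \<Rightarrow> 'b::euclidean_space"
  assumes [measurable]: "f \<in> borel_measurable borel" "g \<in> borel_measurable borel"
  shows "Lp_dist_powr p (\<lambda>x. f (x - z)) (\<lambda>x. g (x - z)) = Lp_dist_powr p f g"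
  using lborel_nn_integral_affine[of 1 "\<lambda>x. ennreal (norm (f x - g x) powr p)" "- z"]
  by (simp add: Lp_dist_powr_def)

text \<open>
  Translations are isometries, so the claim passes from continuous functions with bounded support,
  where it is uniform continuity, to their limits.
\<close>

lemma Lp_translation_continuous:
  fixes f :: "'a::euclidean_space \<Rightarrow> 'b::euclidean_space"
  assumes p: "1 \<le> p" and f[measurable]: "f \<in> borel_measurable borel"
    and fin: "(\<integral>\<^sup>+x. ennreal (norm (f x) powr p) \<partial>lborel) < \<infinity>" and e: "0 < (e :: real)"
  obtains d where "0 < d" "\<And>z. norm z < d \<Longrightarrow> Lp_dist_powr p (\<lambda>x. f (x - z)) f \<le> e"
proof -
  have p0: "0 \<le> p" using p by simp
  define C where "C = (2 :: real) powr p"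
  have C: "1 \<le> C" using p0 by (simp add: C_def ge_one_powr_ge_zero)
  \<comment> \<open>Two uses of the triangle inequality after an approximation error of at most \<open>2 * C * s\<close> cost at most \<open>6 * C * C * C * s\<close>.\<close>
  define s where "s = e / (6 * C * C * C)"
  have s: "0 < s" "s * (6 * C * C * C) = e" using e C by (auto simp: s_def)
  obtain g and n :: nat where g[measurable]: "g \<in> borel_measurable borel" "\<And>x. norm (g x) \<le> n"
      "\<And>x. n < norm x \<Longrightarrow> g x = 0" "Lp_dist_powr p f g < ennreal s"
    using Lp_approx_bounded[OF p f fin, of "ennreal s"] s by auto
  obtain h where h: "continuous_on UNIV h" "\<And>x. real n + 1 \<le> norm x \<Longrightarrow> h x = 0" "Lp_dist_powr p g h < ennreal s"
    using Lp_approx_continuous_bounded[OF p g(1-3), of "ennreal s"] s by auto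
  have [measurable]: "h \<in> borel_measurable borel" by (rule borel_measurable_continuous_onI[OF h(1)])
  obtain d where d: "0 < d" "\<And>z. norm z < d \<Longrightarrow> Lp_dist_powr p (\<lambda>x. h (x - z)) h \<le> s"
    using Lp_dist_powr_translate_continuous[OF p h(1,2) s(1)] by blast
  have fh: "Lp_dist_powr p f h \<le> ennreal (2 * C * s)"
  proof -
    have "Lp_dist_powr p f h \<le> ennreal C * (Lp_dist_powr p f g + Lp_dist_powr p g h)"
      unfolding C_def by (rule Lp_dist_powr_triangle[OF p0]) auto
    also have "\<dots> \<le> ennreal C * (ennreal s + ennreal s)"
      using g(4) h(3) by (intro mult_left_mono add_mono) auto
    also have "\<dots> = ennreal (2 * C * s)"
      using s C by (simp flip: ennreal_plus ennreal_mult')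
    finally show ?thesis .
  qed
  have sym: "Lp_dist_powr p h f = Lp_dist_powr p f h" by (simp add: Lp_dist_powr_def norm_minus_commute)
  show ?thesis
  proof (rule that[OF d(1)])
    fix z :: 'a assume z: "norm z < d"
    have "Lp_dist_powr p (\<lambda>x. h (x - z)) f \<le> ennreal C * (Lp_dist_powr p (\<lambda>x. h (x - z)) h + Lp_dist_powr p h f)"
      unfolding C_def by (rule Lp_dist_powr_triangle[OF p0]) auto
    also have "\<dots> \<le> ennreal C * (ennreal s + ennreal (2 * C * s))"
      using fh sym d(2)[OF z] by (intro mult_left_mono add_mono) auto
    also have "\<dots> \<le> ennreal (3 * C * C * s)"
    proof -
      have "1 * (C * s) \<le> C * (C * s)" using C s by (intro mult_right_mono) auto
      then have "C * (s + 2 * C * s) \<le> 3 * C * C * s" by (simp add: algebra_simps)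
      then show ?thesis using s C by (simp flip: ennreal_plus ennreal_mult' add: ennreal_leI)
    qed
    finally have hf: "Lp_dist_powr p (\<lambda>x. h (x - z)) f \<le> ennreal (3 * C * C * s)" .
    have "Lp_dist_powr p (\<lambda>x. f (x - z)) f \<le> ennreal C * (Lp_dist_powr p (\<lambda>x. f (x - z)) (\<lambda>x. h (x - z)) + Lp_dist_powr p (\<lambda>x. h (x - z)) f)"
      unfolding C_def by (rule Lp_dist_powr_triangle[OF p0]) auto
    also have "\<dots> \<le> ennreal C * (ennreal (2 * C * s) + ennreal (3 * C * C * s))"
      using fh hf by (intro mult_left_mono add_mono) (auto simp: Lp_dist_powr_translate)
    also have "\<dots> \<le> ennreal e"
    proof -
      have "C * C * s \<le> C * (C * C * s)" using C s mult_right_mono[of 1 C "C * C * s"] by simp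
      moreover have "0 \<le> C * C * C * s" using C s by simp
      ultimately have "C * (2 * C * s + 3 * C * C * s) \<le> e" unfolding s(2)[symmetric] by (simp add: algebra_simps)
      then show ?thesis using s C by (simp flip: ennreal_plus ennreal_mult' add: ennreal_leI)
    qed
    finally show "Lp_dist_powr p (\<lambda>x. f (x - z)) f \<le> e" .
  qed
qed

section \<open>Convergence of mollifications\<close>

text \<open>
  The difference \<open>conv f (mollifier \<epsilon>) x - f x\<close> is an average of the differences \<open>f (x - z) - f x\<close> over
  \<open>|z| < \<epsilon>\<close>. By Jensen's inequality and Tonelli's theorem its norm is at most the corresponding
  average of the norms of \<open>f (x - z) - f x\<close> in \<open>x\<close>, which is small by continuity of translations.
\<close>

lemma mollification_converges:
  fixes f :: "'a::euclidean_space \<Rightarrow> 'b::{real_normed_field, euclidean_space}"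
  assumes p: "1 \<le> p" and f: "integrable lborel f"
    and fin: "(\<integral>\<^sup>+x. ennreal (norm (f x) powr p) \<partial>lborel) < \<infinity>" and e: "0 < (e :: real)"
  obtains d where "0 < d" "\<And>\<epsilon>. 0 < \<epsilon> \<Longrightarrow> \<epsilon> < d \<Longrightarrow> Lp_dist_powr p (conv f (mollifier \<epsilon>)) f \<le> e"
proof -
  have [measurable]: "f \<in> borel_measurable borel" using f by (auto dest: borel_measurable_integrable)
  obtain d where d: "0 < d" "\<And>z. norm z < d \<Longrightarrow> Lp_dist_powr p (\<lambda>x. f (x - z)) f \<le> e"
    using Lp_translation_continuous[OF p _ fin e] by auto
  show ?thesis
  proof (rule that[OF d(1)])
    fix \<epsilon> :: real assume \<epsilon>: "0 < \<epsilon>" "\<epsilon> < d"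
    let ?m = "mollifier \<epsilon> :: 'a \<Rightarrow> real" and ?n = "mollifier \<epsilon> :: 'a \<Rightarrow> 'b"
    have [measurable]: "?m \<in> borel_measurable borel" "?n \<in> borel_measurable borel"
      by (rule smooth_borel_measurable[OF smooth_mollifier[OF \<epsilon>(1)]])+
    have m0: "0 \<le> ?m z" for z using norm_mollifier[OF \<epsilon>(1), of z, where ?'b = real] by (metis norm_ge_zero)
    have nm: "norm (?n z) = ?m z" for z by (rule norm_mollifier[OF \<epsilon>(1)])
    have im: "integrable lborel (\<lambda>y. ?m (x - y))" and in': "integrable lborel (\<lambda>y. ?n (x - y))" for x
      using lborel_integrable_affine[OF _ Cc_inf_integrable[OF mollifier_in_Cc_inf[OF \<epsilon>(1)]], of "-1" x] by simp_all
    have Im: "(\<integral>y. ?m (x - y) \<partial>lborel) = 1" "(\<integral>y. ?n (x - y) \<partial>lborel) = 1" for x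
      using lborel_integral_reflect[of ?m x] lborel_integral_reflect[of ?n x]
      by (simp_all add: integral_mollifier[OF \<epsilon>(1)])
    have pointwise: "ennreal (norm (conv f ?n x - f x) powr p) \<le>
        (\<integral>\<^sup>+z. ennreal (norm (f (x - z) - f x) powr p * ?m z) \<partial>lborel)" for x
    proof -
      have i1: "integrable lborel (\<lambda>y. (f y - f x) * ?n (x - y))"
        using conv_integrable[OF f mollifier_in_Cc_inf[OF \<epsilon>(1)], of x] in' by (simp add: left_diff_distrib)
      have i2: "integrable lborel (\<lambda>y. norm (f y - f x) * ?m (x - y))"
        using integrable_norm[OF i1] by (simp add: norm_mult nm)
      have "conv f ?n x - f x = (\<integral>y. f y * ?n (x - y) \<partial>lborel) - f x * (\<integral>y. ?n (x - y) \<partial>lborel)"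
        by (simp add: conv_def Im)
      also have "\<dots> = (\<integral>y. (f y - f x) * ?n (x - y) \<partial>lborel)"
        using conv_integrable[OF f mollifier_in_Cc_inf[OF \<epsilon>(1)], of x] in'[of x]
        by (simp add: left_diff_distrib)
      finally have "norm (conv f ?n x - f x) \<le> (\<integral>y. norm (f y - f x) * ?m (x - y) \<partial>lborel)"
        using integral_norm_bound[of lborel "\<lambda>y. (f y - f x) * ?n (x - y)"] by (simp add: norm_mult nm)
      then have "ennreal (norm (conv f ?n x - f x) powr p) \<le> ennreal ((\<integral>y. norm (f y - f x) * ?m (x - y) \<partial>lborel) powr p)"
        using p by (intro ennreal_leI powr_mono2) auto
      also have "\<dots> \<le> (\<integral>\<^sup>+y. ennreal (norm (f y - f x) powr p * ?m (x - y)) \<partial>lborel)"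
        by (rule Jensen_powr[OF p _ _ im m0 Im(1) i2]) auto
      also have "\<dots> = (\<integral>\<^sup>+z. ennreal (norm (f (x - z) - f x) powr p * ?m z) \<partial>lborel)"
        using lborel_nn_integral_affine[of "-1" "\<lambda>y. ennreal (norm (f y - f x) powr p * ?m (x - y))" x] by simp
      finally show ?thesis .
    qed
    have "Lp_dist_powr p (conv f ?n) f \<le> (\<integral>\<^sup>+x. \<integral>\<^sup>+z. ennreal (norm (f (x - z) - f x) powr p * ?m z) \<partial>lborel \<partial>lborel)"
      unfolding Lp_dist_powr_def by (intro nn_integral_mono pointwise)
    also have "\<dots> = (\<integral>\<^sup>+z. \<integral>\<^sup>+x. ennreal (norm (f (x - z) - f x) powr p * ?m z) \<partial>lborel \<partial>lborel)"
      by (rule lborel_pair.Fubini') measurable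
    also have "\<dots> = (\<integral>\<^sup>+z. Lp_dist_powr p (\<lambda>x. f (x - z)) f * ennreal (?m z) \<partial>lborel)"
      unfolding Lp_dist_powr_def
      by (intro nn_integral_cong, subst nn_integral_multc[symmetric]) (auto simp: ennreal_mult' m0)
    also have "\<dots> \<le> (\<integral>\<^sup>+z. ennreal e * ennreal (?m z) \<partial>lborel)"
    proof (rule nn_integral_mono)
      fix z
      show "Lp_dist_powr p (\<lambda>x. f (x - z)) f * ennreal (?m z) \<le> ennreal e * ennreal (?m z)"
        using d(2)[of z] mollifier_eq_0[OF \<epsilon>(1), of z, where ?'b = real] \<epsilon>
        by (cases "norm z < \<epsilon>") (auto intro!: mult_right_mono)
    qed
    also have "\<dots> = ennreal e * ennreal (\<integral>z. ?m z \<partial>lborel)"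
    proof -
      have "integrable lborel ?m" by (rule Cc_inf_integrable[OF mollifier_in_Cc_inf[OF \<epsilon>(1)]])
      then have "(\<integral>\<^sup>+z. ennreal (?m z) \<partial>lborel) = ennreal (\<integral>z. ?m z \<partial>lborel)"
        using m0 by (intro nn_integral_eq_integral) auto
      then show ?thesis by (simp add: nn_integral_cmult)
    qed
    also have "\<dots> = ennreal e" by (simp add: integral_mollifier[OF \<epsilon>(1)])
    finally show "Lp_dist_powr p (conv f ?n) f \<le> e" .
  qed
qed

section \<open>Lebesgue spaces\<close>

lemma L_p_UNIV_iff:
  "f \<in> L_p p UNIV \<longleftrightarrow> f \<in> borel_measurable lebesgue \<and> (\<integral>\<^sup>+x. ennreal (norm (f x) powr p) \<partial>lborel) < \<infinity>"
proof -
  have "integrable lebesgue (\<lambda>x. norm (f x) powr p) \<longleftrightarrow> (\<integral>\<^sup>+x. ennreal (norm (f x) powr p) \<partial>lborel) < \<infinity>"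
    if "f \<in> borel_measurable lebesgue"
    using that by (auto simp: integrable_iff_bounded nn_integral_completion)
  then show ?thesis by (auto simp: L_p_def lebesgue_on_UNIV_eq)
qed

lemma L_p_iff_zero_extension:
  fixes f :: "'a::euclidean_space \<Rightarrow> 'b::euclidean_space"
  assumes "open \<Lambda>"
  shows "f \<in> L_p p \<Lambda> \<longleftrightarrow> (\<lambda>x. if x \<in> \<Lambda> then f x else 0) \<in> L_p p UNIV"
proof -
  have S: "\<Lambda> \<in> sets lebesgue" using assms by auto
  have "(\<lambda>x. norm (if x \<in> \<Lambda> then f x else 0) powr p) = (\<lambda>x. if x \<in> \<Lambda> then norm (f x) powr p else 0)"
    by auto
  then show ?thesis
    using borel_measurable_if[OF S, of f] Lebesgue_Measure.integrable_restrict_UNIV[OF S, of "\<lambda>x. norm (f x) powr p"]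
    by (simp add: L_p_def lebesgue_on_UNIV_eq)
qed

text \<open>
  Closure of the Lebesgue spaces under addition, multiplication by bounded smooth functions and
  restriction are instances.
\<close>

lemma L_p_dominated:
  fixes f g h :: "'a::euclidean_space \<Rightarrow> 'b::euclidean_space"
  assumes f: "f \<in> borel_measurable lebesgue" and g: "g \<in> L_p p UNIV" and h: "h \<in> L_p p UNIV" and p: "0 \<le> p"
    and B: "0 \<le> B" "\<And>x. norm (f x) \<le> B * (norm (g x) + norm (h x))"
  shows "f \<in> L_p p UNIV"
proof -
  have [measurable]: "g \<in> borel_measurable lebesgue" "h \<in> borel_measurable lebesgue"
    using g h by (auto simp: L_p_UNIV_iff)
  let ?g = "\<lambda>x. ennreal (norm (g x) powr p)" and ?h = "\<lambda>x. ennreal (norm (h x) powr p)"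
  have "(\<integral>\<^sup>+x. ennreal (norm (f x) powr p) \<partial>lebesgue) \<le> (\<integral>\<^sup>+x. ennreal (B powr p * 2 powr p) * (?g x + ?h x) \<partial>lebesgue)"
  proof (rule nn_integral_mono)
    fix x
    have "norm (f x) powr p \<le> (B * (norm (g x) + norm (h x))) powr p" using B p by (intro powr_mono2) auto
    also have "\<dots> = B powr p * (norm (g x) + norm (h x)) powr p" using B by (simp add: powr_mult)
    also have "\<dots> \<le> B powr p * (2 powr p * (norm (g x) powr p + norm (h x) powr p))"
      using p by (intro mult_left_mono add_powr_le) auto
    finally show "ennreal (norm (f x) powr p) \<le> ennreal (B powr p * 2 powr p) * (?g x + ?h x)"
      by (simp flip: ennreal_plus ennreal_mult' add: ennreal_leI mult.assoc)
  qed
  also have "\<dots> = ennreal (B powr p * 2 powr p) * ((\<integral>\<^sup>+x. ?g x \<partial>lebesgue) + (\<integral>\<^sup>+x. ?h x \<partial>lebesgue))"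
    by (simp add: nn_integral_cmult nn_integral_add)
  also have "\<dots> < \<infinity>"
    using g h by (auto simp: L_p_UNIV_iff nn_integral_completion ennreal_mult_less_top)
  finally show ?thesis using f by (simp add: L_p_UNIV_iff nn_integral_completion)
qed

lemma L_p_add:
  fixes f g :: "'a::euclidean_space \<Rightarrow> 'b::euclidean_space"
  assumes "f \<in> L_p p UNIV" "g \<in> L_p p UNIV" "0 \<le> p"
  shows "(\<lambda>x. f x + g x) \<in> L_p p UNIV"
  by (rule L_p_dominated[of _ f _ g 1])
    (use assms in \<open>auto simp: L_p_UNIV_iff norm_triangle_ineq intro: borel_measurable_add\<close>)

lemma smooth_lebesgue_measurable: "smooth \<phi> \<Longrightarrow> \<phi> \<in> borel_measurable lebesgue"
  by (rule measurable_completion) (simp add: smooth_borel_measurable)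

lemma L_p_smooth_mult:
  fixes f \<eta> :: "'a::euclidean_space \<Rightarrow> 'b::{real_normed_field, euclidean_space}"
  assumes f: "f \<in> L_p p UNIV" and \<eta>: "smooth \<eta>" "\<And>x. norm (\<eta> x) \<le> B" and p: "0 \<le> p"
  shows "(\<lambda>x. \<eta> x * f x) \<in> L_p p UNIV"
proof (rule L_p_dominated[OF _ f f p])
  have "f \<in> borel_measurable lebesgue" using f by (simp add: L_p_UNIV_iff)
  then show "(\<lambda>x. \<eta> x * f x) \<in> borel_measurable lebesgue"
    by (rule borel_measurable_times[OF smooth_lebesgue_measurable[OF \<eta>(1)]])
  show "0 \<le> \<bar>B\<bar>" by simp
  show "norm (\<eta> x * f x) \<le> \<bar>B\<bar> * (norm (f x) + norm (f x))" for x
  proof -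
    have "norm (\<eta> x) * norm (f x) \<le> \<bar>B\<bar> * (norm (f x) + norm (f x))"
      using \<eta>(2)[of x] by (intro mult_mono) auto
    then show ?thesis by (simp add: norm_mult)
  qed
qed

lemma L_p_restrict:
  fixes f :: "'a::euclidean_space \<Rightarrow> 'b::euclidean_space"
  assumes f: "f \<in> L_p p UNIV" and S: "S \<in> sets lebesgue" and p: "0 \<le> p"
  shows "(\<lambda>x. if x \<in> S then f x else 0) \<in> L_p p UNIV"
proof (rule L_p_dominated[OF _ f f p zero_le_one])
  have "f \<in> borel_measurable lebesgue" using f by (simp add: L_p_UNIV_iff)
  then show "(\<lambda>x. if x \<in> S then f x else 0) \<in> borel_measurable lebesgue"
    by (intro borel_measurable_if_I measurable_restrict_space1 S)
qed auto

lemma L_p_integrable_on_compact: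
  fixes f :: "'a::euclidean_space \<Rightarrow> 'b::euclidean_space"
  assumes f: "f \<in> L_p p UNIV" and p: "1 \<le> p" and K: "compact K"
  shows "integrable lebesgue (\<lambda>x. indicator K x *\<^sub>R f x)"
proof (rule Bochner_Integration.integrable_bound)
  have f': "f \<in> borel_measurable lebesgue" using f by (simp add: L_p_UNIV_iff)
  have K': "K \<in> lmeasurable" using K by (rule lmeasurable_compact)
  then have K'': "K \<in> sets lebesgue" by (rule fmeasurableD)
  have "integrable lebesgue (indicator K :: 'a \<Rightarrow> real)"
    using K' by (simp add: lmeasurable_iff_integrable)
  moreover have "integrable lebesgue (\<lambda>x. norm (f x) powr p)"
    using f by (simp add: L_p_def lebesgue_on_UNIV_eq)
  ultimately show "integrable lebesgue (\<lambda>x. indicator K x + norm (f x) powr p)"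
    by (rule Bochner_Integration.integrable_add)
  show "(\<lambda>x. indicator K x *\<^sub>R f x) \<in> borel_measurable lebesgue"
    by (rule borel_measurable_scaleR[OF borel_measurable_indicator[OF K''] f'])
  show "AE x in lebesgue. norm (indicator K x *\<^sub>R f x) \<le> norm (indicator K x + norm (f x) powr p)"
  proof (rule AE_I2)
    fix x
    \<comment> \<open>On a set of finite measure the constant 1 is integrable, and where \<open>|f|\<close> exceeds 1 it is below its \<open>p\<close>-th power.\<close>
    have "norm (f x) \<le> 1 + norm (f x) powr p"
    proof (cases "norm (f x) \<le> 1")
      case True
      then show ?thesis using powr_ge_zero[of "norm (f x)" p] by linarith
    next
      case False
      then have "norm (f x) powr 1 \<le> norm (f x) powr p" using p by (intro powr_mono) auto
      then show ?thesis using False by simp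
    qed
    then show "norm (indicator K x *\<^sub>R f x) \<le> norm (indicator K x + norm (f x) powr p)"
      by (auto simp: indicator_def)
  qed
qed

lemma L_p_locally_integrable:
  fixes f :: "'a::euclidean_space \<Rightarrow> 'b::euclidean_space"
  assumes "open \<Lambda>" "f \<in> L_p p \<Lambda>" "1 \<le> p"
  shows "locally_integrable_on f \<Lambda>"
  unfolding locally_integrable_on_def set_integrable_def
proof (intro allI impI)
  fix K assume K: "compact K \<and> K \<subseteq> \<Lambda>"
  have "integrable lebesgue (\<lambda>x. indicator K x *\<^sub>R (if x \<in> \<Lambda> then f x else 0))"
    using assms(3) K
    by (intro L_p_integrable_on_compact[OF iffD1[OF L_p_iff_zero_extension[OF assms(1)] assms(2)]]) auto
  moreover have "(\<lambda>x. indicator K x *\<^sub>R (if x \<in> \<Lambda> then f x else 0)) = (\<lambda>x. indicator K x *\<^sub>R f x)"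
    using K by (auto simp: indicator_def fun_eq_iff)
  ultimately show "integrable lebesgue (\<lambda>x. indicator K x *\<^sub>R f x)" by simp
qed

text \<open>
  Tonelli's theorem is applied on the product of two Borel spaces, where \<open>f (x - z)\<close> is jointly
  measurable if \<open>f\<close> is Borel; Lebesgue measurable functions are therefore replaced by Borel ones.
\<close>

lemma lebesgue_borel_representative:
  fixes f :: "'a::euclidean_space \<Rightarrow> 'b::euclidean_space"
  assumes "f \<in> borel_measurable lebesgue"
  obtains g where "g \<in> borel_measurable borel" "AE x in lebesgue. f x = g x"
proof -
  have "\<exists>g\<in>borel_measurable lborel. AE x in lborel. f x \<bullet> i = g x" for i
    by (intro completion_ex_borel_measurable_real borel_measurable_inner[OF assms borel_measurable_const])
  then obtain g where g: "\<And>i. g i \<in> borel_measurable lborel" "\<And>i. AE x in lborel. f x \<bullet> i = g i x"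
    by metis
  show ?thesis
  proof (rule that)
    show "(\<lambda>x. \<Sum>i\<in>Basis. g i x *\<^sub>R i) \<in> borel_measurable borel"
      using g(1) by (intro borel_measurable_sum borel_measurable_scaleR) auto
    have "AE x in lborel. \<forall>i\<in>Basis. f x \<bullet> i = g i x"
      using g(2) by (intro AE_finite_allI) auto
    then have "AE x in lebesgue. \<forall>i\<in>Basis. f x \<bullet> i = g i x" by (rule AE_completion)
    then show "AE x in lebesgue. f x = (\<Sum>i\<in>Basis. g i x *\<^sub>R i)"
    proof eventually_elim
      case (elim x)
      then show ?case using euclidean_representation[of "f x"] by (metis (no_types, lifting) sum.cong)
    qed
  qed
qed

section \<open>Weak derivatives\<close>

lemma integral_lebesgue_on_eq:
  fixes f :: "'a::euclidean_space \<Rightarrow> 'b::euclidean_space"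
  assumes "open \<Lambda>" "\<And>x. x \<notin> \<Lambda> \<Longrightarrow> f x = 0"
  shows "(LINT x|lebesgue_on \<Lambda>. f x) = (LINT x|lebesgue. f x)"
proof -
  have "(\<lambda>x. if x \<in> \<Lambda> then f x else 0) = f" using assms(2) by auto
  then show ?thesis using Lebesgue_Measure.integral_restrict_UNIV[of \<Lambda> f] assms(1) by auto
qed

text \<open>
  Test functions vanish off \<open>\<Lambda>\<close>, so the integrals may be taken over the whole space. This makes
  domains of different size comparable.
\<close>

lemma has_weak_deriv_iff:
  fixes u g :: "'a::euclidean_space \<Rightarrow> 'b::{real_normed_field, euclidean_space}"
  assumes "open \<Lambda>"
  shows "has_weak_deriv \<Lambda> i u g \<longleftrightarrow>
     locally_integrable_on u \<Lambda> \<and> locally_integrable_on g \<Lambda> \<and>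
     (\<forall>\<phi>\<in>Cc_inf \<Lambda>. (LINT x|lebesgue. u x * partial_deriv i \<phi> x) = - (LINT x|lebesgue. g x * \<phi> x))"
proof -
  have "(LINT x|lebesgue_on \<Lambda>. u x * partial_deriv i \<phi> x) = (LINT x|lebesgue. u x * partial_deriv i \<phi> x) \<and>
    (LINT x|lebesgue_on \<Lambda>. g x * \<phi> x) = (LINT x|lebesgue. g x * \<phi> x)"
    if "\<phi> \<in> Cc_inf \<Lambda>" for \<phi>
  proof -
    have "x \<notin> supp \<phi>" if "x \<notin> \<Lambda>" for x using that \<open>\<phi> \<in> Cc_inf \<Lambda>\<close> by (auto simp: Cc_inf_iff)
    then show ?thesis
      by (intro conjI integral_lebesgue_on_eq[OF assms])
        (simp_all add: partial_deriv_notin_supp[of _ \<phi>] eq_0_if_notin_supp[of _ \<phi>])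
  qed
  then show ?thesis unfolding has_weak_deriv_def by simp
qed

lemma locally_integrable_test:
  fixes u \<psi> :: "'a::euclidean_space \<Rightarrow> 'b::{real_normed_field, euclidean_space}"
  assumes u: "locally_integrable_on u \<Lambda>" and \<psi>: "\<psi> \<in> Cc_inf \<Lambda>"
  shows "integrable lebesgue (\<lambda>x. u x * \<psi> x)"
proof -
  have "integrable lebesgue (\<lambda>x. indicator (supp \<psi>) x *\<^sub>R u x)"
    using assms unfolding locally_integrable_on_def set_integrable_def Cc_inf_iff by blast
  moreover obtain B where "\<And>x. norm (\<psi> x) \<le> B" using Cc_inf_bounded[OF \<psi>] by blast
  ultimately have "integrable lebesgue (\<lambda>x. (indicator (supp \<psi>) x *\<^sub>R u x) * \<psi> x)"
    by (intro integrable_mult_bounded[of _ _ _ B] smooth_lebesgue_measurable Cc_inf_smooth[OF \<psi>])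
  moreover have "(\<lambda>x. (indicator (supp \<psi>) x *\<^sub>R u x) * \<psi> x) = (\<lambda>x. u x * \<psi> x)"
    using eq_0_if_notin_supp[of _ \<psi>] by (auto simp: indicator_def fun_eq_iff)
  ultimately show ?thesis by simp
qed

lemma locally_integrable_on_mono:
  "locally_integrable_on u \<Lambda> \<Longrightarrow> \<Lambda>' \<subseteq> \<Lambda> \<Longrightarrow> locally_integrable_on u \<Lambda>'"
  unfolding locally_integrable_on_def by blast

lemma has_weak_deriv_subset:
  assumes "has_weak_deriv \<Lambda> i u g" "open \<Lambda>" "open \<Lambda>'" "\<Lambda>' \<subseteq> \<Lambda>"
  shows "has_weak_deriv \<Lambda>' i u g"
  using assms Cc_inf_mono[OF _ assms(4)] locally_integrable_on_mono[OF _ assms(4)]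
  unfolding has_weak_deriv_iff[OF assms(2)] has_weak_deriv_iff[OF assms(3)] by blast

lemma has_weak_deriv_add_scaled:
  fixes u v g h :: "'a::euclidean_space \<Rightarrow> 'b::{real_normed_field, euclidean_space}"
  assumes "open \<Lambda>" "has_weak_deriv \<Lambda> i u g" "has_weak_deriv \<Lambda> i v h" "i \<in> Basis"
  shows "has_weak_deriv \<Lambda> i (\<lambda>x. u x + c *\<^sub>R v x) (\<lambda>x. g x + c *\<^sub>R h x)"
  unfolding has_weak_deriv_iff[OF assms(1)]
proof (intro conjI ballI)
  note 1 = assms(2)[unfolded has_weak_deriv_iff[OF assms(1)]] and 2 = assms(3)[unfolded has_weak_deriv_iff[OF assms(1)]]
  show "locally_integrable_on (\<lambda>x. u x + c *\<^sub>R v x) \<Lambda>" "locally_integrable_on (\<lambda>x. g x + c *\<^sub>R h x) \<Lambda>"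
    using 1 2 unfolding locally_integrable_on_def by (auto intro!: set_integral_add(1) absolutely_integrable_scaleR_left)
  fix \<phi> :: "'a \<Rightarrow> 'b" assume \<phi>: "\<phi> \<in> Cc_inf \<Lambda>"
  note \<phi>' = Cc_inf_partial_deriv[OF \<phi> assms(4)]
  have "integrable lebesgue (\<lambda>x. u x * partial_deriv i \<phi> x)" "integrable lebesgue (\<lambda>x. v x * partial_deriv i \<phi> x)"
    "integrable lebesgue (\<lambda>x. g x * \<phi> x)" "integrable lebesgue (\<lambda>x. h x * \<phi> x)"
    using 1 2 locally_integrable_test[OF _ \<phi>] locally_integrable_test[OF _ \<phi>'] by auto
  then show "(LINT x|lebesgue. (u x + c *\<^sub>R v x) * partial_deriv i \<phi> x) = - (LINT x|lebesgue. (g x + c *\<^sub>R h x) * \<phi> x)"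
    using 1 2 \<phi> by (simp add: distrib_right)
qed

lemma has_weak_deriv_add:
  assumes "open \<Lambda>" "has_weak_deriv \<Lambda> i u g" "has_weak_deriv \<Lambda> i v h" "i \<in> Basis"
  shows "has_weak_deriv \<Lambda> i (\<lambda>x. u x + v x) (\<lambda>x. g x + h x)"
  using has_weak_deriv_add_scaled[OF assms, of 1] by simp

lemma has_weak_deriv_diff:
  assumes "open \<Lambda>" "has_weak_deriv \<Lambda> i u g" "has_weak_deriv \<Lambda> i v h" "i \<in> Basis"
  shows "has_weak_deriv \<Lambda> i (\<lambda>x. u x - v x) (\<lambda>x. g x - h x)"
  using has_weak_deriv_add_scaled[OF assms, of "-1"] by simp

text \<open>
  The product rule, combined with extension by zero from \<open>\<Lambda>\<close> to \<open>\<Lambda>'\<close>. It holds because \<open>\<eta> \<phi>\<close> is a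
  test function on \<open>\<Lambda>\<close> for every test function \<open>\<phi>\<close> on \<open>\<Lambda>'\<close>; the hypothesis on the supports says
  just that. With \<open>\<Lambda> = \<Lambda>'\<close> it is automatic, and for \<open>\<Lambda>' = UNIV\<close> it holds if \<open>\<eta>\<close> has compact support in \<open>\<Lambda>\<close>.
\<close>

lemma has_weak_deriv_smooth_mult:
  fixes u g \<eta> :: "'a::euclidean_space \<Rightarrow> 'b::{real_normed_field, euclidean_space}"
  assumes \<Lambda>: "open \<Lambda>" "open \<Lambda>'" and i: "i \<in> Basis" and ug: "has_weak_deriv \<Lambda> i u g" and \<eta>: "smooth \<eta>"
    and supp: "\<And>\<phi> :: 'a \<Rightarrow> 'b. \<phi> \<in> Cc_inf \<Lambda>' \<Longrightarrow> supp \<eta> \<inter> supp \<phi> \<subseteq> \<Lambda>"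
    and li: "locally_integrable_on (\<lambda>x. if x \<in> \<Lambda> then \<eta> x * u x else 0) \<Lambda>'"
      "locally_integrable_on (\<lambda>x. if x \<in> \<Lambda> then \<eta> x * g x + partial_deriv i \<eta> x * u x else 0) \<Lambda>'"
  shows "has_weak_deriv \<Lambda>' i (\<lambda>x. if x \<in> \<Lambda> then \<eta> x * u x else 0)
    (\<lambda>x. if x \<in> \<Lambda> then \<eta> x * g x + partial_deriv i \<eta> x * u x else 0)"
  unfolding has_weak_deriv_iff[OF \<Lambda>(2)]
proof (intro conjI ballI li)
  fix \<phi> :: "'a \<Rightarrow> 'b" assume \<phi>: "\<phi> \<in> Cc_inf \<Lambda>'"
  note wd = ug[unfolded has_weak_deriv_iff[OF \<Lambda>(1)]]
  have K: "compact (supp \<eta> \<inter> supp \<phi>)"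
    using \<phi> closed_supp by (auto simp: Cc_inf_iff intro: closed_Int_compact)
  have off: "\<eta> x = 0 \<and> partial_deriv i \<eta> x = 0 \<or> \<phi> x = 0 \<and> partial_deriv i \<phi> x = 0"
    if "x \<notin> supp \<eta> \<inter> supp \<phi>" for x
    using that eq_0_if_notin_supp[of x] partial_deriv_notin_supp[of x] by auto
  have out: "x \<notin> supp \<eta> \<inter> supp \<phi>" if "x \<notin> \<Lambda>" for x using that supp[OF \<phi>] by blast
  have \<eta>\<phi>: "(\<lambda>x. \<eta> x * \<phi> x) \<in> Cc_inf \<Lambda>"
    by (rule Cc_infI[OF smooth_mult[OF \<eta> Cc_inf_smooth[OF \<phi>]] K supp[OF \<phi>]]) (use off in auto)
  have \<eta>'\<phi>: "(\<lambda>x. partial_deriv i \<eta> x * \<phi> x) \<in> Cc_inf \<Lambda>"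
    by (rule Cc_infI[OF smooth_mult[OF smooth_partial_deriv[OF \<eta> i] Cc_inf_smooth[OF \<phi>]] K supp[OF \<phi>]]) (use off in auto)
  have d: "partial_deriv i (\<lambda>x. \<eta> x * \<phi> x) x = \<eta> x * partial_deriv i \<phi> x + partial_deriv i \<eta> x * \<phi> x" for x
    by (rule partial_deriv_mult[OF smooth_differentiable[OF \<eta>] Cc_inf_differentiable[OF \<phi>]])
  have i1: "integrable lebesgue (\<lambda>x. u x * partial_deriv i (\<lambda>x. \<eta> x * \<phi> x) x)"
    "integrable lebesgue (\<lambda>x. u x * (partial_deriv i \<eta> x * \<phi> x))"
    "integrable lebesgue (\<lambda>x. g x * (\<eta> x * \<phi> x))"
    using wd by (auto intro!: locally_integrable_test[of _ \<Lambda>] Cc_inf_partial_deriv \<eta>\<phi> \<eta>'\<phi> i)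
  have "(LINT x|lebesgue. (if x \<in> \<Lambda> then \<eta> x * u x else 0) * partial_deriv i \<phi> x) =
      (LINT x|lebesgue. u x * partial_deriv i (\<lambda>x. \<eta> x * \<phi> x) x - u x * (partial_deriv i \<eta> x * \<phi> x))"
  proof (rule Bochner_Integration.integral_cong[OF refl])
    fix x
    show "(if x \<in> \<Lambda> then \<eta> x * u x else 0) * partial_deriv i \<phi> x =
        u x * partial_deriv i (\<lambda>x. \<eta> x * \<phi> x) x - u x * (partial_deriv i \<eta> x * \<phi> x)"
      using off[OF out, of x] by (auto simp: d algebra_simps)
  qed
  also have "\<dots> = - (LINT x|lebesgue. g x * (\<eta> x * \<phi> x)) - (LINT x|lebesgue. u x * (partial_deriv i \<eta> x * \<phi> x))"
    using i1 wd \<eta>\<phi> by (simp add: Bochner_Integration.integral_diff)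
  also have "\<dots> = - (LINT x|lebesgue. g x * (\<eta> x * \<phi> x) + u x * (partial_deriv i \<eta> x * \<phi> x))"
    using i1 by simp
  also have "(LINT x|lebesgue. g x * (\<eta> x * \<phi> x) + u x * (partial_deriv i \<eta> x * \<phi> x)) =
      (LINT x|lebesgue. (if x \<in> \<Lambda> then \<eta> x * g x + partial_deriv i \<eta> x * u x else 0) * \<phi> x)"
  proof (rule Bochner_Integration.integral_cong[OF refl])
    fix x
    show "g x * (\<eta> x * \<phi> x) + u x * (partial_deriv i \<eta> x * \<phi> x) =
      (if x \<in> \<Lambda> then \<eta> x * g x + partial_deriv i \<eta> x * u x else 0) * \<phi> x"
      using off[OF out, of x] by (auto simp: algebra_simps)
  qed
  finally show "(LINT x|lebesgue. (if x \<in> \<Lambda> then \<eta> x * u x else 0) * partial_deriv i \<phi> x) =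
      - (LINT x|lebesgue. (if x \<in> \<Lambda> then \<eta> x * g x + partial_deriv i \<eta> x * u x else 0) * \<phi> x)" .
qed

section \<open>Weak derivatives are unique\<close>

lemma Cc_inf_reflect:
  fixes \<phi> :: "'a::euclidean_space \<Rightarrow> 'b::real_normed_field"
  assumes \<phi>: "\<phi> \<in> Cc_inf UNIV"
  shows "(\<lambda>y. \<phi> (x - y)) \<in> Cc_inf UNIV"
    and "partial_deriv i (\<lambda>y. \<phi> (x - y)) y = - partial_deriv i \<phi> (x - y)"
proof -
  have "smooth (\<lambda>y. 1 *\<^sub>R \<phi> ((- 1) *\<^sub>R y + x))" by (rule smooth_affine[OF Cc_inf_smooth[OF \<phi>]])
  then have s: "smooth (\<lambda>y. \<phi> (x - y))" by simp
  show "(\<lambda>y. \<phi> (x - y)) \<in> Cc_inf UNIV"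
  proof (rule Cc_infI[OF s])
    show "compact ((\<lambda>y. x - y) ` supp \<phi>)"
      using \<phi> by (intro compact_continuous_image continuous_intros) (auto simp: Cc_inf_iff)
    show "\<phi> (x - y) = 0" if "y \<notin> (\<lambda>y. x - y) ` supp \<phi>" for y
    proof (rule eq_0_if_notin_supp[of "x - y" \<phi>])
      show "x - y \<notin> supp \<phi>" using that by (auto simp: image_iff dest: bspec[of _ _ "x - y"])
    qed
  qed simp
  show "partial_deriv i (\<lambda>y. \<phi> (x - y)) y = - partial_deriv i \<phi> (x - y)"
    using partial_deriv_affine[OF Cc_inf_differentiable[OF \<phi>], of i "-1" x y] by simp
qed

lemma integrable_borel_representative:
  fixes f g :: "'a::euclidean_space \<Rightarrow> 'b::euclidean_space"
  assumes f: "integrable lebesgue f" and g: "g \<in> borel_measurable borel" and eq: "AE x in lebesgue. f x = g x"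
  shows "integrable lborel g"
proof -
  have "g \<in> borel_measurable lebesgue" using g by (intro measurable_completion) simp
  then have "integrable lebesgue g"
    using f integrable_cong_AE[OF borel_measurable_integrable[OF f] _ eq] by simp
  then show ?thesis using g by (subst (asm) integrable_completion) auto
qed

lemma conv_borel_representative:
  fixes f g \<phi> :: "'a::euclidean_space \<Rightarrow> 'b::{real_normed_field, euclidean_space}"
  assumes f: "f \<in> borel_measurable lebesgue" and g: "g \<in> borel_measurable borel"
    and eq: "AE x in lebesgue. f x = g x" and \<phi>: "\<phi> \<in> Cc_inf UNIV"
  shows "conv g \<phi> x = (LINT y|lebesgue. f y * \<phi> (x - y))"
proof -
  note \<phi>x = Cc_inf_smooth[OF Cc_inf_reflect(1)[OF \<phi>, of x]]
  have m: "(\<lambda>y. g y * \<phi> (x - y)) \<in> borel_measurable lborel"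
    using g smooth_borel_measurable[OF \<phi>x] by (intro borel_measurable_times) auto
  have "conv g \<phi> x = (LINT y|lebesgue. g y * \<phi> (x - y))"
    unfolding conv_def using integral_completion[OF m] by simp
  also have "\<dots> = (LINT y|lebesgue. f y * \<phi> (x - y))"
  proof (rule integral_cong_AE)
    show "(\<lambda>y. g y * \<phi> (x - y)) \<in> borel_measurable lebesgue" by (rule measurable_completion[OF m])
    show "(\<lambda>y. f y * \<phi> (x - y)) \<in> borel_measurable lebesgue"
      by (rule borel_measurable_times[OF f smooth_lebesgue_measurable[OF \<phi>x]])
    show "AE y in lebesgue. g y * \<phi> (x - y) = f y * \<phi> (x - y)" using eq by eventually_elim simp
  qed
  finally show ?thesis .
qed

text \<open>
  Near a compact subset of \<open>\<Lambda>\<close> multiply \<open>k\<close> by a test function \<open>\<theta>\<close> equal to one there. Then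
  \<open>\<theta> (y) mollifier \<epsilon> (x - y)\<close> is a test function on \<open>\<Lambda>\<close>, so all mollifications of \<open>\<theta> k\<close> vanish, and
  hence so does their limit.
\<close>

lemma test_functions_determine:
  fixes k :: "'a::euclidean_space \<Rightarrow> 'b::{real_normed_field, euclidean_space}"
  assumes \<Lambda>: "open \<Lambda>" and k: "locally_integrable_on k \<Lambda>"
    and zero: "\<And>\<phi>. \<phi> \<in> Cc_inf \<Lambda> \<Longrightarrow> (LINT x|lebesgue. k x * \<phi> x) = 0"
  shows "AE x in lebesgue. x \<in> \<Lambda> \<longrightarrow> k x = 0"
proof -
  have compact_case: "AE x in lebesgue. x \<in> K \<longrightarrow> k x = 0" if K: "compact K" "K \<subseteq> \<Lambda>" for K
  proof -
    obtain \<theta> :: "'a \<Rightarrow> 'b" and V where \<theta>: "\<theta> \<in> Cc_inf \<Lambda>" "open V" "K \<subseteq> V" "\<And>x. x \<in> V \<Longrightarrow> \<theta> x = 1"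
    proof (rule smooth_Urysohn[OF K(1) \<Lambda> K(2), where ?'b = 'b])
      fix \<theta> :: "'a \<Rightarrow> 'b" and V
      assume "\<theta> \<in> Cc_inf \<Lambda>" "open V" "K \<subseteq> V" "\<And>x. x \<in> V \<Longrightarrow> \<theta> x = 1"
      then show thesis by (rule that)
    qed
    have int: "integrable lebesgue (\<lambda>x. k x * \<theta> x)" by (rule locally_integrable_test[OF k \<theta>(1)])
    then have meas: "(\<lambda>x. k x * \<theta> x) \<in> borel_measurable lebesgue" by (rule borel_measurable_integrable)
    obtain f where f: "f \<in> borel_measurable borel" "AE x in lebesgue. k x * \<theta> x = f x"
      by (rule lebesgue_borel_representative[OF meas])
    have fi: "integrable lborel f" by (rule integrable_borel_representative[OF int f])
    have conv0: "conv f (mollifier \<epsilon>) = (\<lambda>x. 0)" if \<epsilon>: "0 < \<epsilon>" for \<epsilon>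
    proof
      fix x
      note m = mollifier_in_Cc_inf[OF \<epsilon>, where ?'a = 'a and ?'b = 'b]
      have "(\<lambda>y. mollifier \<epsilon> (x - y) * \<theta> y) \<in> Cc_inf \<Lambda>"
        by (rule Cc_inf_mult[OF Cc_inf_smooth[OF Cc_inf_reflect(1)[OF m]] \<theta>(1)])
      from zero[OF this] show "conv f (mollifier \<epsilon>) x = 0"
        unfolding conv_borel_representative[OF meas f m] by (simp add: mult_ac)
    qed
    have fin: "(\<integral>\<^sup>+x. ennreal (norm (f x) powr 1) \<partial>lborel) < \<infinity>"
      using fi by (simp add: integrable_iff_bounded)
    have small: "(\<integral>\<^sup>+x. ennreal (norm (f x)) \<partial>lborel) \<le> ennreal e" if e: "0 < e" for e
    proof -
      obtain d where d: "0 < d" "\<And>\<epsilon>. 0 < \<epsilon> \<Longrightarrow> \<epsilon> < d \<Longrightarrow> Lp_dist_powr 1 (conv f (mollifier \<epsilon>)) f \<le> e"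
        using mollification_converges[OF order_refl fi fin e] by blast
      then have "Lp_dist_powr 1 (conv f (mollifier (d / 2))) f \<le> e" by simp
      then show ?thesis using d(1) by (simp add: conv0 Lp_dist_powr_def)
    qed
    have "(\<integral>\<^sup>+x. ennreal (norm (f x)) \<partial>lborel) \<le> 0"
      by (rule ennreal_le_epsilon) (simp only: add_0_left small)
    then have zero_int: "(\<integral>\<^sup>+x. ennreal (norm (f x)) \<partial>lborel) = 0" by (simp only: le_zero_eq)
    have "(\<lambda>x. ennreal (norm (f x))) \<in> borel_measurable lborel"
      using f(1) by (intro measurable_compose[OF _ measurable_ennreal] measurable_compose[OF _ borel_measurable_norm]) simp
    from nn_integral_0_iff_AE[OF this] zero_int have "AE x in lborel. ennreal (norm (f x)) = 0" by (simp only: simp_thms)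
    then have "AE x in lborel. f x = 0" by eventually_elim simp
    then have "AE x in lebesgue. f x = 0" by (rule AE_completion)
    with f(2) show ?thesis
    proof eventually_elim
      case (elim x)
      then show ?case using \<theta>(3,4) by auto
    qed
  qed
  obtain C where C: "\<And>n. compact (C n)" "\<And>n. C n \<subseteq> \<Lambda>" "(\<Union>n. C (n::nat)) = \<Lambda>"
    using open_Union_compact_subsets[OF \<Lambda>] by metis
  have "AE x in lebesgue. \<forall>n. x \<in> C n \<longrightarrow> k x = 0"
    unfolding AE_all_countable using compact_case C by blast
  then show ?thesis
    by eventually_elim (use C(3) in blast)
qed

lemma has_weak_deriv_unique:
  fixes u v :: "'a::euclidean_space \<Rightarrow> 'b::{real_normed_field, euclidean_space}"
  assumes \<Lambda>: "open \<Lambda>" and i: "i \<in> Basis" and ug: "has_weak_deriv \<Lambda> i u g" and vh: "has_weak_deriv \<Lambda> i v h"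
    and eq: "AE x in lebesgue. x \<in> \<Lambda> \<longrightarrow> u x = v x"
  shows "AE x in lebesgue. x \<in> \<Lambda> \<longrightarrow> g x = h x"
proof -
  note d = has_weak_deriv_diff[OF \<Lambda> ug vh i, unfolded has_weak_deriv_iff[OF \<Lambda>]]
  have "AE x in lebesgue. x \<in> \<Lambda> \<longrightarrow> g x - h x = 0"
  proof (rule test_functions_determine[OF \<Lambda>])
    fix \<phi> :: "'a \<Rightarrow> 'b" assume \<phi>: "\<phi> \<in> Cc_inf \<Lambda>"
    have "AE x in lebesgue. (u x - v x) * partial_deriv i \<phi> x = 0"
      using eq
    proof eventually_elim
      case (elim x)
      then show ?case using \<phi> partial_deriv_notin_supp[of x \<phi> i] by (cases "x \<in> \<Lambda>") (auto simp: Cc_inf_iff)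
    qed
    then have "(LINT x|lebesgue. (u x - v x) * partial_deriv i \<phi> x) = 0"
      by (rule integral_eq_zero_AE)
    with d \<phi> show "(LINT x|lebesgue. (g x - h x) * \<phi> x) = 0" by simp
  qed (use d in blast)
  then show ?thesis by eventually_elim simp
qed

section \<open>Integration by parts\<close>

text \<open>
  The integral of \<open>\<psi>\<close> does not change under translation. Convolution with the indicator function of a
  large ball realises these translated integrals as a function that is constant near the origin, and
  its derivative is the integral of the derivative.
\<close>

lemma integral_partial_deriv_eq_0:
  fixes \<psi> :: "'a::euclidean_space \<Rightarrow> 'b::{real_normed_field, euclidean_space}"
  assumes \<psi>: "\<psi> \<in> Cc_inf UNIV" and i: "i \<in> Basis"
  shows "(LINT x|lborel. partial_deriv i \<psi> x) = 0"
proof -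
  have "bounded (supp \<psi>)" using \<psi> by (auto simp: Cc_inf_iff compact_imp_bounded)
  then obtain R where R: "\<And>x. x \<in> supp \<psi> \<Longrightarrow> norm x \<le> R" by (auto simp: bounded_iff)
  let ?B = "cball (0 :: 'a) (R + 1)"
  let ?f = "(\<lambda>x. indicator ?B x *\<^sub>R 1) :: 'a \<Rightarrow> 'b"
  have f: "integrable lborel ?f"
    by (intro integrable_scaleR_left integrable_real_indicator emeasure_lborel_cball_finite) auto
  have conv: "conv ?f \<phi> x = (\<integral>y. \<phi> y \<partial>lborel)"
    if "norm x \<le> 1" and \<phi>: "smooth \<phi>" "\<And>x. x \<notin> supp \<psi> \<Longrightarrow> \<phi> x = 0" for x \<phi>
  proof -
    have "?f y * \<phi> (x - y) = \<phi> (x - y)" for y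
    proof (cases "x - y \<in> supp \<psi>")
      case True
      then have "norm y \<le> R + 1" using R[of "x - y"] that(1) norm_triangle_ineq4[of x "x - y"] by auto
      then show ?thesis by simp
    qed (use \<phi> in simp)
    then have "conv ?f \<phi> x = (\<integral>y. \<phi> (x - y) \<partial>lborel)" by (simp add: conv_def)
    also have "\<dots> = (\<integral>y. \<phi> y \<partial>lborel)" by (rule lborel_integral_reflect[OF smooth_borel_measurable[OF \<phi>(1)]])
    finally show ?thesis .
  qed
  have const: "conv ?f \<psi> x = (\<integral>y. \<psi> y \<partial>lborel)" if "x \<in> ball 0 1" for x
    using that by (intro conv Cc_inf_smooth[OF \<psi>] eq_0_if_notin_supp) auto
  have "((\<lambda>x. \<integral>y. \<psi> y \<partial>lborel) has_derivative (\<lambda>h. 0)) (at (0 :: 'a))" by (rule has_derivative_const)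
  then have "(conv ?f \<psi> has_derivative (\<lambda>h. 0)) (at 0)"
    by (rule has_derivative_transform_within_open[where s = "ball 0 1"]) (simp_all add: const)
  then have "partial_deriv i (conv ?f \<psi>) 0 = 0" by (rule partial_deriv_eq)
  moreover have "partial_deriv i (conv ?f \<psi>) 0 = (\<integral>y. partial_deriv i \<psi> y \<partial>lborel)"
    unfolding partial_deriv_conv[OF f \<psi> i]
    by (rule conv) (auto intro: smooth_partial_deriv Cc_inf_smooth[OF \<psi>] i partial_deriv_notin_supp)
  ultimately show ?thesis by simp
qed

lemma integrable_lebesgue_Cc_inf:
  fixes \<phi> :: "'a::euclidean_space \<Rightarrow> 'b::euclidean_space"
  assumes "\<phi> \<in> Cc_inf \<Lambda>"
  shows "integrable lebesgue \<phi>"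
  using Cc_inf_integrable[OF assms] smooth_borel_measurable[OF Cc_inf_smooth[OF assms]]
  by (subst integrable_completion) auto

lemma integrable_imp_locally_integrable:
  assumes "integrable lebesgue f"
  shows "locally_integrable_on f \<Lambda>"
  unfolding locally_integrable_on_def set_integrable_def
  using integrable_mult_indicator[OF _ assms] lmeasurable_compact by blast

lemma has_weak_deriv_Cc_inf:
  fixes v :: "'a::euclidean_space \<Rightarrow> 'b::{real_normed_field, euclidean_space}"
  assumes v: "v \<in> Cc_inf UNIV" and i: "i \<in> Basis"
  shows "has_weak_deriv UNIV i v (partial_deriv i v)"
  unfolding has_weak_deriv_iff[OF open_UNIV]
proof (intro conjI ballI integrable_imp_locally_integrable)
  note v' = Cc_inf_partial_deriv[OF v i]
  show "integrable lebesgue v" "integrable lebesgue (partial_deriv i v)"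
    using v v' by (auto intro: integrable_lebesgue_Cc_inf)
  fix \<phi> :: "'a \<Rightarrow> 'b" assume \<phi>: "\<phi> \<in> Cc_inf UNIV"
  note \<phi>' = Cc_inf_partial_deriv[OF \<phi> i]
  have 1: "(\<lambda>x. v x * \<phi> x) \<in> Cc_inf UNIV" "(\<lambda>x. v x * partial_deriv i \<phi> x) \<in> Cc_inf UNIV"
    "(\<lambda>x. partial_deriv i v x * \<phi> x) \<in> Cc_inf UNIV"
    using v v' \<phi> \<phi>' by (auto intro: Cc_inf_mult Cc_inf_smooth)
  have "partial_deriv i (\<lambda>x. v x * \<phi> x) = (\<lambda>x. v x * partial_deriv i \<phi> x + partial_deriv i v x * \<phi> x)"
    by (intro ext partial_deriv_mult Cc_inf_differentiable[OF v] Cc_inf_differentiable[OF \<phi>])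
  then have "0 = (LINT x|lborel. v x * partial_deriv i \<phi> x + partial_deriv i v x * \<phi> x)"
    using integral_partial_deriv_eq_0[OF 1(1) i] by simp
  also have "\<dots> = (LINT x|lborel. v x * partial_deriv i \<phi> x) + (LINT x|lborel. partial_deriv i v x * \<phi> x)"
    by (intro Bochner_Integration.integral_add Cc_inf_integrable[OF 1(2)] Cc_inf_integrable[OF 1(3)])
  also have "\<dots> = (LINT x|lebesgue. v x * partial_deriv i \<phi> x) + (LINT x|lebesgue. partial_deriv i v x * \<phi> x)"
    using smooth_borel_measurable[OF Cc_inf_smooth[OF 1(2)]] smooth_borel_measurable[OF Cc_inf_smooth[OF 1(3)]]
    by (simp add: integral_completion)
  finally show "(LINT x|lebesgue. v x * partial_deriv i \<phi> x) = - (LINT x|lebesgue. partial_deriv i v x * \<phi> x)"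
    by (simp add: eq_neg_iff_add_eq_0)
qed

section \<open>Smooth approximation in Sobolev spaces\<close>

lemma L_p_borel_representative:
  fixes f :: "'a::euclidean_space \<Rightarrow> 'b::euclidean_space"
  assumes f: "f \<in> L_p p UNIV" and p: "1 \<le> p" and K: "compact K" "AE x in lebesgue. x \<notin> K \<longrightarrow> f x = 0"
  obtains g where "g \<in> borel_measurable borel" "AE x in lebesgue. f x = g x" "\<And>x. x \<notin> K \<Longrightarrow> g x = 0"
    "integrable lborel g" "(\<integral>\<^sup>+x. ennreal (norm (g x) powr p) \<partial>lborel) < \<infinity>"
proof -
  have "f \<in> borel_measurable lebesgue" using f by (simp add: L_p_UNIV_iff)
  then obtain h where h: "h \<in> borel_measurable borel" "AE x in lebesgue. f x = h x"
    by (rule lebesgue_borel_representative)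
  let ?g = "\<lambda>x. indicator K x *\<^sub>R h x"
  have "K \<in> sets borel" using K(1) by (simp add: borel_compact)
  then have g: "?g \<in> borel_measurable borel" using h(1) by (intro borel_measurable_scaleR borel_measurable_indicator) auto
  have fg: "AE x in lebesgue. f x = ?g x"
    using h(2) K(2) by eventually_elim (auto simp: indicator_def)
  have "integrable lebesgue (\<lambda>x. indicator K x *\<^sub>R f x)"
    by (rule L_p_integrable_on_compact[OF f p K(1)])
  moreover have "AE x in lebesgue. indicator K x *\<^sub>R f x = ?g x"
    using h(2) by eventually_elim simp
  ultimately have int: "integrable lborel ?g" by (rule integrable_borel_representative[OF _ g])
  have "AE x in lborel. f x = ?g x" using fg by (simp add: AE_completion_iff)
  then have "(\<integral>\<^sup>+x. ennreal (norm (f x) powr p) \<partial>lborel) = (\<integral>\<^sup>+x. ennreal (norm (?g x) powr p) \<partial>lborel)"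
    by (intro nn_integral_cong_AE) (auto elim: eventually_mono)
  then have "(\<integral>\<^sup>+x. ennreal (norm (?g x) powr p) \<partial>lborel) < \<infinity>"
    using f by (simp add: L_p_UNIV_iff)
  with g fg int show ?thesis by (intro that[of ?g]) auto
qed

lemma Lp_dist_powr_cong_AE:
  assumes "AE x in lebesgue. g x = h x"
  shows "Lp_dist_powr p f g = Lp_dist_powr p f h"
proof -
  have "AE x in lborel. g x = h x" using assms by (simp add: AE_completion_iff)
  then show ?thesis unfolding Lp_dist_powr_def by (intro nn_integral_cong_AE) (auto elim: eventually_mono)
qed

text \<open>
  Shifting the derivative from the mollifier to \<open>w\<close>, by the definition of weak derivatives, shows that
  the partial derivatives of the mollified \<open>w\<close> are the mollified weak derivatives of \<open>w\<close>. Hence one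
  small radius approximates \<open>w\<close> and its derivatives at the same time.
\<close>

lemma Sobolev_mollification:
  fixes w :: "'a::euclidean_space \<Rightarrow> 'b::{real_normed_field, euclidean_space}"
  assumes p: "1 \<le> p" and w: "w \<in> L_p p UNIV"
    and G: "\<And>i. i \<in> Basis \<Longrightarrow> G i \<in> L_p p UNIV" "\<And>i. i \<in> Basis \<Longrightarrow> has_weak_deriv UNIV i w (G i)"
    and K: "compact K" "\<And>x. x \<notin> K \<Longrightarrow> w x = 0" and e: "0 < (e :: real)"
  obtains v where "v \<in> Cc_inf UNIV" "supp v \<subseteq> (\<Union>k\<in>K. cball k e)" "Lp_dist_powr p v w \<le> e"
    "\<And>i. i \<in> Basis \<Longrightarrow> Lp_dist_powr p (partial_deriv i v) (G i) \<le> e"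
proof -
  have open_K: "open (- K)" using K(1) by (simp add: compact_imp_closed open_Compl)
  \<comment> \<open>Integrability of \<open>G i\<close>, needed for its mollification, comes from its vanishing off a bounded set.\<close>
  have G0: "AE x in lebesgue. x \<notin> K \<longrightarrow> G i x = 0" if i: "i \<in> Basis" for i
  proof -
    have "has_weak_deriv (- K) i (\<lambda>x. 0 :: 'b) (\<lambda>x. 0)"
      unfolding has_weak_deriv_iff[OF open_K] locally_integrable_on_def set_integrable_def by simp
    from has_weak_deriv_unique[OF open_K i has_weak_deriv_subset[OF G(2)[OF i] open_UNIV open_K subset_UNIV] this]
    show ?thesis using K(2) by simp
  qed
  obtain w' where w': "w' \<in> borel_measurable borel" "AE x in lebesgue. w x = w' x" "\<And>x. x \<notin> K \<Longrightarrow> w' x = 0"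
    "integrable lborel w'" "(\<integral>\<^sup>+x. ennreal (norm (w' x) powr p) \<partial>lborel) < \<infinity>"
    by (rule L_p_borel_representative[OF w p K(1)]) (use K(2) in auto)
  have "\<exists>g. g \<in> borel_measurable borel \<and> (AE x in lebesgue. G i x = g x) \<and> integrable lborel g \<and>
      (\<integral>\<^sup>+x. ennreal (norm (g x) powr p) \<partial>lborel) < \<infinity>" if "i \<in> Basis" for i
    by (rule L_p_borel_representative[OF G(1)[OF that] p K(1) G0[OF that]]) blast
  then have "\<forall>i\<in>Basis. \<exists>g. g \<in> borel_measurable borel \<and> (AE x in lebesgue. G i x = g x) \<and> integrable lborel g \<and>
      (\<integral>\<^sup>+x. ennreal (norm (g x) powr p) \<partial>lborel) < \<infinity>" by (rule ballI)
  from bchoice[OF this] obtain G' where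
    all: "\<forall>i\<in>Basis. G' i \<in> borel_measurable borel \<and> (AE x in lebesgue. G i x = G' i x) \<and> integrable lborel (G' i) \<and>
      (\<integral>\<^sup>+x. ennreal (norm (G' i x) powr p) \<partial>lborel) < \<infinity>" by (elim exE)
  have G': "G' i \<in> borel_measurable borel" "AE x in lebesgue. G i x = G' i x" "integrable lborel (G' i)"
      "(\<integral>\<^sup>+x. ennreal (norm (G' i x) powr p) \<partial>lborel) < \<infinity>" if "i \<in> Basis" for i
    using bspec[OF all that] by simp_all
  have small: "\<forall>\<^sub>F \<epsilon> in at_right 0. Lp_dist_powr p (conv f (mollifier \<epsilon>)) f \<le> ennreal e"
    if f: "integrable lborel f" "(\<integral>\<^sup>+x. ennreal (norm (f x) powr p) \<partial>lborel) < \<infinity>" for f :: "'a \<Rightarrow> 'b"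
  proof -
    obtain d where "0 < d" "\<And>\<epsilon>. 0 < \<epsilon> \<Longrightarrow> \<epsilon> < d \<Longrightarrow> Lp_dist_powr p (conv f (mollifier \<epsilon>)) f \<le> e"
      using mollification_converges[OF p f e] by blast
    then show ?thesis by (intro eventually_at_rightI[of 0 d]) auto
  qed
  have e1: "\<forall>\<^sub>F \<epsilon> in at_right 0. \<epsilon> \<in> {0<..<e}"
    by (rule eventually_at_rightI[OF _ e])
  have e2: "\<forall>\<^sub>F \<epsilon> in at_right 0. Lp_dist_powr p (conv w' (mollifier \<epsilon>)) w' \<le> ennreal e"
    by (rule small[OF w'(4,5)])
  have e3: "\<forall>\<^sub>F \<epsilon> in at_right 0. \<forall>i\<in>Basis. Lp_dist_powr p (conv (G' i) (mollifier \<epsilon>)) (G' i) \<le> ennreal e"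
    by (rule eventually_ball_finite[OF finite_Basis]) (rule ballI, rule small[OF G'(3,4)])
  obtain \<epsilon> where all_small: "\<epsilon> \<in> {0<..<e} \<and> Lp_dist_powr p (conv w' (mollifier \<epsilon>)) w' \<le> ennreal e \<and>
      (\<forall>i\<in>Basis. Lp_dist_powr p (conv (G' i) (mollifier \<epsilon>)) (G' i) \<le> ennreal e)"
    using eventually_happens'[OF trivial_limit_at_right_real eventually_conj[OF e1 eventually_conj[OF e2 e3]]]
    by (elim exE)
  then have \<epsilon>: "0 < \<epsilon>" "\<epsilon> < e" "Lp_dist_powr p (conv w' (mollifier \<epsilon>)) w' \<le> e"
      "i \<in> Basis \<Longrightarrow> Lp_dist_powr p (conv (G' i) (mollifier \<epsilon>)) (G' i) \<le> e" for i
    by simp_all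
  let ?m = "mollifier \<epsilon> :: 'a \<Rightarrow> 'b"
  have m: "?m \<in> Cc_inf UNIV" by (rule mollifier_in_Cc_inf[OF \<epsilon>(1)])
  define v where "v = conv w' ?m"
  have v0: "v x = 0" if "x \<notin> (\<Union>k\<in>K. cball k \<epsilon>)" for x
    unfolding v_def
    by (rule conv_eq_0[of K _ \<epsilon>]) (use w'(3) mollifier_eq_0[OF \<epsilon>(1)] that in \<open>auto simp: dist_commute not_le\<close>)
  have supp: "supp v \<subseteq> (\<Union>k\<in>K. cball k \<epsilon>)"
    by (rule supp_minimal[OF compact_imp_closed[OF compact_cball_neighbourhood[OF K(1)]] v0])
  have meas: "w \<in> borel_measurable lebesgue" "i \<in> Basis \<Longrightarrow> G i \<in> borel_measurable lebesgue" for i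
    using w G(1) by (auto simp: L_p_UNIV_iff)
  have deriv: "partial_deriv i v = conv (G' i) ?m" if i: "i \<in> Basis" for i
  proof
    fix x
    note r = Cc_inf_reflect[OF m]
    have "partial_deriv i v x = (LINT y|lebesgue. w y * partial_deriv i ?m (x - y))"
      unfolding v_def partial_deriv_conv[OF w'(4) m i]
      by (rule conv_borel_representative[OF meas(1) w'(1,2) Cc_inf_partial_deriv[OF m i]])
    also have "\<dots> = - (LINT y|lebesgue. w y * partial_deriv i (\<lambda>y. ?m (x - y)) y)"
      by (simp add: r(2))
    also have "\<dots> = (LINT y|lebesgue. G i y * ?m (x - y))"
      using G(2)[OF i] r(1) by (simp add: has_weak_deriv_iff[OF open_UNIV])
    also have "\<dots> = conv (G' i) ?m x"
      by (rule conv_borel_representative[OF meas(2)[OF i] G'(1,2)[OF i] m, symmetric])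
    finally show "partial_deriv i v x = conv (G' i) ?m x" .
  qed
  show ?thesis
  proof (rule that)
    show "v \<in> Cc_inf UNIV"
      by (rule Cc_infI[OF _ compact_cball_neighbourhood[OF K(1), of \<epsilon>] subset_UNIV v0])
        (simp add: v_def smooth_conv[OF w'(4) m])
    have "(\<Union>k\<in>K. cball k \<epsilon>) \<subseteq> (\<Union>k\<in>K. cball k e)" using \<epsilon>(2) by force
    with supp show "supp v \<subseteq> (\<Union>k\<in>K. cball k e)" by blast
    show "Lp_dist_powr p v w \<le> e" using \<epsilon>(3) unfolding Lp_dist_powr_cong_AE[OF w'(2)] v_def .
    show "Lp_dist_powr p (partial_deriv i v) (G i) \<le> e" if "i \<in> Basis" for i
      using \<epsilon>(4)[OF that] unfolding Lp_dist_powr_cong_AE[OF G'(2)[OF that]] deriv[OF that] .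
  qed
qed

text \<open>
  The norm refers to a chosen weak derivative; by uniqueness any weak derivatives \<open>h\<close> may be used to
  estimate it. In the constant, \<open>DIM('a) powr p\<close> compares the \<open>p\<close>-th power of the Euclidean length of the
  gradient with the sum over its \<open>DIM('a)\<close> components, and the summand 1 accounts for \<open>z\<close> itself.
\<close>

lemma W1p_norm_less:
  fixes z :: "'a::euclidean_space \<Rightarrow> 'b::{real_normed_field, euclidean_space}"
  assumes \<Lambda>: "open \<Lambda>" and p: "1 \<le> p" and z: "z \<in> borel_measurable (lebesgue_on \<Lambda>)"
    and h: "\<And>i. i \<in> Basis \<Longrightarrow> h i \<in> borel_measurable (lebesgue_on \<Lambda>)" "\<And>i. i \<in> Basis \<Longrightarrow> has_weak_deriv \<Lambda> i z (h i)"
    and d: "0 \<le> \<delta>" "(\<integral>\<^sup>+x. ennreal (norm (z x) powr p) \<partial>lebesgue_on \<Lambda>) \<le> ennreal \<delta>"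
      "\<And>i. i \<in> Basis \<Longrightarrow> (\<integral>\<^sup>+x. ennreal (norm (h i x) powr p) \<partial>lebesgue_on \<Lambda>) \<le> ennreal \<delta>"
    and e: "0 < \<epsilon>" "(real DIM('a) powr p * real DIM('a) + 1) * \<delta> < \<epsilon> powr p"
  shows "W1p_norm p \<Lambda> z < \<epsilon>"
proof -
  let ?M = "lebesgue_on \<Lambda>"
  let ?d = "real DIM('a)"
  have S: "\<Lambda> \<inter> space lebesgue \<in> sets lebesgue" using \<Lambda> by auto
  have "AE x in ?M. weak_deriv \<Lambda> i z x = h i x" if i: "i \<in> Basis" for i
  proof -
    have "has_weak_deriv \<Lambda> i z (weak_deriv \<Lambda> i z)"
      unfolding weak_deriv_def using h(2)[OF i] by (rule someI[of "has_weak_deriv \<Lambda> i z"])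
    from has_weak_deriv_unique[OF \<Lambda> i this h(2)[OF i]] show ?thesis
      using S by (simp add: AE_restrict_space_iff)
  qed
  then have ae: "AE x in ?M. \<forall>i\<in>Basis. weak_deriv \<Lambda> i z x = h i x"
    by (intro AE_finite_allI) auto
  let ?F = "\<lambda>x. norm_weak_grad \<Lambda> z x powr p + norm (z x) powr p"
  have F: "AE x in ?M. ennreal (?F x) \<le> ennreal (?d powr p) * (\<Sum>i\<in>Basis. ennreal (norm (h i x) powr p)) + ennreal (norm (z x) powr p)"
    using ae
  proof eventually_elim
    case (elim x)
    have "norm_weak_grad \<Lambda> z x = L2_set (\<lambda>i. norm (h i x)) Basis"
      unfolding norm_weak_grad_def using elim by (intro L2_set_cong) auto
    also have "\<dots> \<le> (\<Sum>i\<in>Basis. norm (h i x))" by (rule L2_set_le_sum) simp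
    finally have "norm_weak_grad \<Lambda> z x powr p \<le> (\<Sum>i\<in>Basis. norm (h i x)) powr p"
      using p by (intro powr_mono2) (auto simp: norm_weak_grad_def L2_set_nonneg)
    also have "\<dots> \<le> ?d powr p * (\<Sum>i\<in>Basis. norm (h i x) powr p)"
      using p by (intro sum_powr_le) auto
    finally have "ennreal (?F x) \<le> ennreal (?d powr p * (\<Sum>i\<in>Basis. norm (h i x) powr p) + norm (z x) powr p)"
      by (intro ennreal_leI) simp
    then show ?case by (simp add: ennreal_mult' sum_nonneg)
  qed
  have "ennreal (\<integral>x. ?F x \<partial>?M) \<le> (\<integral>\<^sup>+x. ennreal (?F x) \<partial>?M)"
  proof (cases "integrable ?M ?F")
    case True
    then show ?thesis by (subst nn_integral_eq_integral) auto
  qed (simp add: not_integrable_integral_eq)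
  also have "\<dots> \<le> (\<integral>\<^sup>+x. ennreal (?d powr p) * (\<Sum>i\<in>Basis. ennreal (norm (h i x) powr p)) + ennreal (norm (z x) powr p) \<partial>?M)"
    by (rule nn_integral_mono_AE[OF F])
  also have "\<dots> = ennreal (?d powr p) * (\<Sum>i\<in>Basis. \<integral>\<^sup>+x. ennreal (norm (h i x) powr p) \<partial>?M) + (\<integral>\<^sup>+x. ennreal (norm (z x) powr p) \<partial>?M)"
  proof -
    have mz: "(\<lambda>x. ennreal (norm (z x) powr p)) \<in> borel_measurable ?M"
      by (intro measurable_compose[OF _ measurable_ennreal] powr_real_measurable measurable_compose[OF z borel_measurable_norm] borel_measurable_const)
    have mh: "(\<lambda>x. ennreal (norm (h i x) powr p)) \<in> borel_measurable ?M" if "i \<in> Basis" for i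
      by (intro measurable_compose[OF _ measurable_ennreal] powr_real_measurable measurable_compose[OF h(1)[OF that] borel_measurable_norm] borel_measurable_const)
    show ?thesis
      using mz mh
      by (simp add: nn_integral_add nn_integral_cmult nn_integral_sum borel_measurable_sum del: sum_ennreal)
  qed
  also have "\<dots> \<le> ennreal (?d powr p) * (\<Sum>i\<in>(Basis :: 'a set). ennreal \<delta>) + ennreal \<delta>"
    using d by (intro add_mono mult_left_mono sum_mono) auto
  also have "\<dots> = ennreal ((?d powr p * ?d + 1) * \<delta>)"
  proof -
    have "(\<Sum>i\<in>(Basis :: 'a set). ennreal \<delta>) = ennreal (?d * \<delta>)"
      using d(1) by (subst sum_ennreal) auto
    then show ?thesis
      using d(1) by (simp flip: ennreal_plus ennreal_mult' add: algebra_simps)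
  qed
  finally have "(\<integral>x. ?F x \<partial>?M) \<le> (?d powr p * ?d + 1) * \<delta>"
    using d(1) by (subst (asm) ennreal_le_iff) auto
  then have I: "(\<integral>x. ?F x \<partial>?M) < \<epsilon> powr p" using e(2) by linarith
  have "0 \<le> (\<integral>x. ?F x \<partial>?M)" by (intro Bochner_Integration.integral_nonneg) simp
  then have "(\<integral>x. ?F x \<partial>?M) powr (1 / p) < (\<epsilon> powr p) powr (1 / p)"
    using I p by (intro powr_less_mono2) auto
  also have "(\<epsilon> powr p) powr (1 / p) = \<epsilon>" using e p by (simp add: powr_powr)
  finally show ?thesis by (simp add: W1p_norm_def)
qed

section \<open>Products of Sobolev functions with smooth functions\<close>

lemma L_p_UNIV_imp_L_p:
  fixes f :: "'a::euclidean_space \<Rightarrow> 'b::euclidean_space"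
  assumes "f \<in> L_p p UNIV" "open \<Lambda>" "0 \<le> p"
  shows "f \<in> L_p p \<Lambda>"
  using L_p_restrict[OF assms(1) _ assms(3), of \<Lambda>] assms(2) L_p_iff_zero_extension[OF assms(2), of f] by auto

lemma L_p_subset:
  fixes f :: "'a::euclidean_space \<Rightarrow> 'b::euclidean_space"
  assumes f: "f \<in> L_p p \<Lambda>" and \<Lambda>: "open \<Lambda>" "open \<Lambda>'" "\<Lambda>' \<subseteq> \<Lambda>" and p: "0 \<le> p"
  shows "f \<in> L_p p \<Lambda>'"
proof -
  have "(\<lambda>x. if x \<in> \<Lambda> then f x else 0) \<in> L_p p UNIV" using L_p_iff_zero_extension[OF \<Lambda>(1)] f by blast
  from L_p_restrict[OF this _ p, of \<Lambda>'] \<Lambda>(2)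
  have "(\<lambda>x. if x \<in> \<Lambda>' then if x \<in> \<Lambda> then f x else 0 else 0) \<in> L_p p UNIV" by auto
  moreover have "(\<lambda>x. if x \<in> \<Lambda>' then if x \<in> \<Lambda> then f x else 0 else 0) = (\<lambda>x. if x \<in> \<Lambda>' then f x else 0)"
    using \<Lambda>(3) by (intro ext) (auto dest: subsetD)
  ultimately show ?thesis using L_p_iff_zero_extension[OF \<Lambda>(2), of f] by simp
qed

lemma W1pE:
  assumes "u \<in> W1p p \<Lambda>"
  obtains g where "u \<in> L_p p \<Lambda>" "\<And>i. i \<in> Basis \<Longrightarrow> g i \<in> L_p p \<Lambda>" "\<And>i. i \<in> Basis \<Longrightarrow> has_weak_deriv \<Lambda> i u (g i)"
proof -
  have "\<forall>i\<in>Basis. \<exists>g. g \<in> L_p p \<Lambda> \<and> has_weak_deriv \<Lambda> i u g" using assms unfolding W1p_def by blast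
  from bchoice[OF this] obtain g where g: "\<forall>i\<in>Basis. g i \<in> L_p p \<Lambda> \<and> has_weak_deriv \<Lambda> i u (g i)" by (elim exE)
  show ?thesis
    by (rule that[of g]) (use assms g in \<open>auto simp: W1p_def\<close>)
qed

lemma W1pI:
  assumes "u \<in> L_p p \<Lambda>" "\<And>i. i \<in> Basis \<Longrightarrow> g i \<in> L_p p \<Lambda>" "\<And>i. i \<in> Basis \<Longrightarrow> has_weak_deriv \<Lambda> i u (g i)"
  shows "u \<in> W1p p \<Lambda>"
  using assms unfolding W1p_def by blast

lemma W1p_add:
  assumes u: "u \<in> W1p p UNIV" and v: "v \<in> W1p p UNIV" and p: "0 \<le> p"
  shows "(\<lambda>x. u x + v x) \<in> W1p p UNIV"
proof -
  obtain g where g: "u \<in> L_p p UNIV" "\<And>i. i \<in> Basis \<Longrightarrow> g i \<in> L_p p UNIV" "\<And>i. i \<in> Basis \<Longrightarrow> has_weak_deriv UNIV i u (g i)"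
    using W1pE[OF u] by blast
  obtain h where h: "v \<in> L_p p UNIV" "\<And>i. i \<in> Basis \<Longrightarrow> h i \<in> L_p p UNIV" "\<And>i. i \<in> Basis \<Longrightarrow> has_weak_deriv UNIV i v (h i)"
    using W1pE[OF v] by blast
  show ?thesis
  proof (rule W1pI[where g = "\<lambda>i x. g i x + h i x"])
    show "(\<lambda>x. u x + v x) \<in> L_p p UNIV" by (rule L_p_add[OF g(1) h(1) p])
    fix i :: 'a assume i: "i \<in> Basis"
    show "(\<lambda>x. g i x + h i x) \<in> L_p p UNIV" by (rule L_p_add[OF g(2)[OF i] h(2)[OF i] p])
    show "has_weak_deriv UNIV i (\<lambda>x. u x + v x) (\<lambda>x. g i x + h i x)"
      by (rule has_weak_deriv_add[OF open_UNIV g(3)[OF i] h(3)[OF i] i])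
  qed
qed

lemma smooth_mult_weak_deriv:
  fixes u g \<eta> :: "'a::euclidean_space \<Rightarrow> 'b::{real_normed_field, euclidean_space}"
  assumes \<Lambda>: "open \<Lambda>" "open \<Lambda>'" and p: "1 \<le> p" and i: "i \<in> Basis"
    and u: "u \<in> L_p p \<Lambda>" and g: "g \<in> L_p p \<Lambda>" "has_weak_deriv \<Lambda> i u g"
    and \<eta>: "smooth \<eta>" "\<And>x. norm (\<eta> x) \<le> B" "\<And>x. norm (partial_deriv i \<eta> x) \<le> B"
    and supp: "\<And>\<phi> :: 'a \<Rightarrow> 'b. \<phi> \<in> Cc_inf \<Lambda>' \<Longrightarrow> supp \<eta> \<inter> supp \<phi> \<subseteq> \<Lambda>"
  defines "U \<equiv> \<lambda>x. if x \<in> \<Lambda> then \<eta> x * u x else 0"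
    and "G \<equiv> \<lambda>x. if x \<in> \<Lambda> then \<eta> x * g x + partial_deriv i \<eta> x * u x else 0"
  shows "U \<in> L_p p UNIV" "G \<in> L_p p UNIV" "has_weak_deriv \<Lambda>' i U G"
proof -
  have p0: "0 \<le> p" using p by simp
  let ?u = "\<lambda>x. if x \<in> \<Lambda> then u x else 0" and ?g = "\<lambda>x. if x \<in> \<Lambda> then g x else 0"
  have u0: "?u \<in> L_p p UNIV" using u L_p_iff_zero_extension[OF \<Lambda>(1), of u] by simp
  have g0: "?g \<in> L_p p UNIV" using g(1) L_p_iff_zero_extension[OF \<Lambda>(1), of g] by simp
  have "U = (\<lambda>x. \<eta> x * ?u x)" by (auto simp: U_def)
  then show U: "U \<in> L_p p UNIV" using L_p_smooth_mult[OF u0 \<eta>(1,2) p0] by simp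
  have "G = (\<lambda>x. \<eta> x * ?g x + partial_deriv i \<eta> x * ?u x)" by (auto simp: G_def)
  then show G: "G \<in> L_p p UNIV"
    using L_p_add[OF L_p_smooth_mult[OF g0 \<eta>(1,2) p0] L_p_smooth_mult[OF u0 smooth_partial_deriv[OF \<eta>(1) i] \<eta>(3) p0] p0] by simp
  show "has_weak_deriv \<Lambda>' i U G"
    unfolding U_def G_def
    by (rule has_weak_deriv_smooth_mult[OF \<Lambda> i g(2) \<eta>(1) supp])
      (fold U_def G_def, auto intro!: L_p_locally_integrable[OF \<Lambda>(2) L_p_UNIV_imp_L_p[OF _ \<Lambda>(2) p0] p] U G)
qed

lemma W1p_mult_Cc_inf:
  fixes u \<theta> :: "'a::euclidean_space \<Rightarrow> 'b::{real_normed_field, euclidean_space}"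
  assumes \<Lambda>: "open \<Lambda>" and p: "1 \<le> p" and u: "u \<in> W1p p \<Lambda>" and \<theta>: "\<theta> \<in> Cc_inf \<Lambda>"
  shows "(\<lambda>x. if x \<in> \<Lambda> then \<theta> x * u x else 0) \<in> W1p p UNIV"
proof -
  obtain g where g: "u \<in> L_p p \<Lambda>" "\<And>i. i \<in> Basis \<Longrightarrow> g i \<in> L_p p \<Lambda>" "\<And>i. i \<in> Basis \<Longrightarrow> has_weak_deriv \<Lambda> i u (g i)"
    using W1pE[OF u] by blast
  have supp: "supp \<theta> \<inter> supp \<phi> \<subseteq> \<Lambda>" for \<phi> :: "'a \<Rightarrow> 'b" using \<theta> by (auto simp: Cc_inf_iff)
  have main: "(\<lambda>x. if x \<in> \<Lambda> then \<theta> x * u x else 0) \<in> L_p p UNIV \<and>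
    (\<lambda>x. if x \<in> \<Lambda> then \<theta> x * g i x + partial_deriv i \<theta> x * u x else 0) \<in> L_p p UNIV \<and>
    has_weak_deriv UNIV i (\<lambda>x. if x \<in> \<Lambda> then \<theta> x * u x else 0)
      (\<lambda>x. if x \<in> \<Lambda> then \<theta> x * g i x + partial_deriv i \<theta> x * u x else 0)" if i: "i \<in> Basis" for i
  proof -
    obtain B where B: "\<And>x. norm (\<theta> x) \<le> B" using Cc_inf_bounded[OF \<theta>] by blast
    obtain B' where B': "\<And>x. norm (partial_deriv i \<theta> x) \<le> B'" using Cc_inf_bounded[OF Cc_inf_partial_deriv[OF \<theta> i]] by blast
    note * = smooth_mult_weak_deriv[OF \<Lambda> open_UNIV p i g(1) g(2)[OF i] g(3)[OF i] Cc_inf_smooth[OF \<theta>], of "max B B'"]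
    show ?thesis using * B B' supp by (simp add: le_max_iff_disj)
  qed
  obtain i :: 'a where "i \<in> Basis" using nonempty_Basis by blast
  with main show ?thesis by (intro W1pI[where g = "\<lambda>i x. if x \<in> \<Lambda> then \<theta> x * g i x + partial_deriv i \<theta> x * u x else 0"]) blast+
qed

section \<open>Locally extendable functions\<close>

text \<open>
  An open set is good for \<open>u\<close> if every localisation of \<open>u\<close> to it extends from \<open>\<Omega>\<close> to a Sobolev function
  on the whole space without enlarging the support of the cutoff function. Quantifying over all cutoff
  functions makes the notion local, so that extension operators on small sets can be glued.
\<close>

definition extendable_on :: "real \<Rightarrow> 'a set \<Rightarrow> ('a::euclidean_space \<Rightarrow> 'b::{real_normed_field, euclidean_space}) \<Rightarrow> 'a set \<Rightarrow> bool" where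
  "extendable_on p \<Omega> u V \<longleftrightarrow> open V \<and>
    (\<forall>\<theta>\<in>Cc_inf V. \<exists>w\<in>W1p p UNIV. (\<forall>x. x \<notin> supp \<theta> \<longrightarrow> w x = 0) \<and> (AE x in lebesgue. x \<in> \<Omega> \<longrightarrow> w x = \<theta> x * u x))"

lemma extendable_on_disjoint:
  fixes u :: "'a::euclidean_space \<Rightarrow> 'b::{real_normed_field, euclidean_space}"
  assumes "open V" "V \<inter> \<Omega> = {}"
  shows "extendable_on p \<Omega> u V"
  unfolding extendable_on_def
proof (intro conjI ballI assms(1) bexI allI impI)
  fix \<theta> :: "'a \<Rightarrow> 'b" assume "\<theta> \<in> Cc_inf V"
  then have "\<theta> x = 0" if "x \<in> \<Omega>" for x
    using that assms(2) by (intro eq_0_if_notin_supp[of x \<theta>]) (auto simp: Cc_inf_iff)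
  then show "AE x in lebesgue. x \<in> \<Omega> \<longrightarrow> 0 = \<theta> x * u x" by simp
  show "(\<lambda>x. 0) \<in> W1p p UNIV"
    by (rule W1pI[where g = "\<lambda>i x. 0"])
      (simp_all add: L_p_UNIV_iff has_weak_deriv_iff locally_integrable_on_def set_integrable_def)
qed simp

lemma extendable_on_self:
  fixes u :: "'a::euclidean_space \<Rightarrow> 'b::{real_normed_field, euclidean_space}"
  assumes "open \<Omega>" "1 \<le> p" "u \<in> W1p p \<Omega>"
  shows "extendable_on p \<Omega> u \<Omega>"
  unfolding extendable_on_def
proof (intro conjI ballI assms(1))
  fix \<theta> :: "'a \<Rightarrow> 'b" assume \<theta>: "\<theta> \<in> Cc_inf \<Omega>"
  show "\<exists>w\<in>W1p p UNIV. (\<forall>x. x \<notin> supp \<theta> \<longrightarrow> w x = 0) \<and> (AE x in lebesgue. x \<in> \<Omega> \<longrightarrow> w x = \<theta> x * u x)"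
    using eq_0_if_notin_supp[of _ \<theta>] by (intro bexI[OF _ W1p_mult_Cc_inf[OF assms \<theta>]]) simp
qed

text \<open>
  Apply the extension operator to the restriction of \<open>u\<close> and then the cutoff function. On the part of
  \<open>\<Omega>\<close> outside \<open>U\<close> the result is zero, as it should be.
\<close>

lemma extendable_on_extension_domain:
  fixes u :: "'a::euclidean_space \<Rightarrow> 'b::{real_normed_field, euclidean_space}"
  assumes \<Omega>: "open \<Omega>" and U: "open U" and p: "1 \<le> p" and u: "u \<in> W1p p \<Omega>"
    and ext: "W1p_extension_domain TYPE('b) p (\<Omega> \<inter> U)"
  shows "extendable_on p \<Omega> u U"
  unfolding extendable_on_def
proof (intro conjI ballI U)
  fix \<theta> :: "'a \<Rightarrow> 'b" assume \<theta>: "\<theta> \<in> Cc_inf U"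
  have p0: "0 \<le> p" using p by simp
  have \<Omega>U: "open (\<Omega> \<inter> U)" using \<Omega> U by auto
  obtain g where g: "u \<in> L_p p \<Omega>" "\<And>i. i \<in> Basis \<Longrightarrow> g i \<in> L_p p \<Omega>" "\<And>i. i \<in> Basis \<Longrightarrow> has_weak_deriv \<Omega> i u (g i)"
    using W1pE[OF u] by blast
  have u': "u \<in> W1p p (\<Omega> \<inter> U)"
    by (rule W1pI[where g = g])
      (auto intro: L_p_subset[OF _ \<Omega> \<Omega>U _ p0] g has_weak_deriv_subset[OF _ \<Omega> \<Omega>U])
  obtain E :: "('a \<Rightarrow> 'b) \<Rightarrow> 'a \<Rightarrow> 'b" where "W1p_extension_operator p (\<Omega> \<inter> U) E"
    using ext unfolding W1p_extension_domain_def by blast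
  then have E: "E u \<in> W1p p UNIV" "AE x in lebesgue_on (\<Omega> \<inter> U). E u x = u x"
    using u' unfolding W1p_extension_operator_def by blast+
  from E(2) \<Omega>U have ae: "AE x in lebesgue. x \<in> \<Omega> \<inter> U \<longrightarrow> E u x = u x"
    by (subst (asm) AE_restrict_space_iff) auto
  have w: "(\<lambda>x. \<theta> x * E u x) \<in> W1p p UNIV"
    using W1p_mult_Cc_inf[OF open_UNIV p E(1) Cc_inf_mono[OF \<theta> subset_UNIV]] by simp
  have "AE x in lebesgue. x \<in> \<Omega> \<longrightarrow> \<theta> x * E u x = \<theta> x * u x"
    using ae
  proof eventually_elim
    case (elim x)
    have "\<theta> x = 0" if "x \<notin> U" using \<theta> that by (intro eq_0_if_notin_supp[of x \<theta>]) (auto simp: Cc_inf_iff)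
    with elim show ?case by (cases "x \<in> U") auto
  qed
  with w show "\<exists>w\<in>W1p p UNIV. (\<forall>x. x \<notin> supp \<theta> \<longrightarrow> w x = 0) \<and> (AE x in lebesgue. x \<in> \<Omega> \<longrightarrow> w x = \<theta> x * u x)"
    using eq_0_if_notin_supp[of _ \<theta>] by (intro bexI[OF _ w]) simp
qed

text \<open>
  A test function on the union is a sum of one on each set: split it with a cutoff function \<open>\<eta>\<close> on \<open>V\<close>
  that equals one around the part of the support missing from \<open>V'\<close>.
\<close>

lemma extendable_on_Un:
  fixes u :: "'a::euclidean_space \<Rightarrow> 'b::{real_normed_field, euclidean_space}"
  assumes V: "extendable_on p \<Omega> u V" and V': "extendable_on p \<Omega> u V'" and p: "0 \<le> p"
  shows "extendable_on p \<Omega> u (V \<union> V')"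
  unfolding extendable_on_def
proof (intro conjI ballI)
  have op: "open V" "open V'" using V V' by (auto simp: extendable_on_def)
  then show "open (V \<union> V')" by auto
  fix \<theta> :: "'a \<Rightarrow> 'b" assume \<theta>: "\<theta> \<in> Cc_inf (V \<union> V')"
  have \<theta>': "smooth \<theta>" "compact (supp \<theta>)" "supp \<theta> \<subseteq> V \<union> V'" using \<theta> by (auto simp: Cc_inf_iff)
  have K: "compact (supp \<theta> - V')" "supp \<theta> - V' \<subseteq> V" using \<theta>' op by (auto intro: compact_diff)
  obtain \<eta> :: "'a \<Rightarrow> 'b" and W where \<eta>: "\<eta> \<in> Cc_inf V" "open W" "supp \<theta> - V' \<subseteq> W" "\<And>x. x \<in> W \<Longrightarrow> \<eta> x = 1"
  proof (rule smooth_Urysohn[OF K(1) op(1) K(2), where ?'b = 'b])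
    fix \<eta> :: "'a \<Rightarrow> 'b" and W
    assume "\<eta> \<in> Cc_inf V" "open W" "supp \<theta> - V' \<subseteq> W" "\<And>x. x \<in> W \<Longrightarrow> \<eta> x = 1"
    then show thesis by (rule that)
  qed
  let ?\<theta>1 = "\<lambda>x. \<theta> x * \<eta> x" and ?\<theta>2 = "\<lambda>x. \<theta> x * (1 - \<eta> x)"
  have 1: "?\<theta>1 \<in> Cc_inf V" by (rule Cc_inf_mult[OF \<theta>'(1) \<eta>(1)])
  have 2: "?\<theta>2 \<in> Cc_inf V'"
  proof (rule Cc_infI)
    show "smooth ?\<theta>2"
      by (rule smooth_mult[OF \<theta>'(1) smooth_diff[OF smooth_const Cc_inf_smooth[OF \<eta>(1)]]])
    show "compact (supp \<theta> - W)" by (rule compact_diff[OF \<theta>'(2) \<eta>(2)])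
    show "supp \<theta> - W \<subseteq> V'" using \<eta>(3) by auto
    show "?\<theta>2 x = 0" if "x \<notin> supp \<theta> - W" for x
      using that \<eta>(4)[of x] eq_0_if_notin_supp[of x \<theta>] by auto
  qed
  obtain w1 where w1: "w1 \<in> W1p p UNIV" "\<And>x. x \<notin> supp ?\<theta>1 \<Longrightarrow> w1 x = 0" "AE x in lebesgue. x \<in> \<Omega> \<longrightarrow> w1 x = ?\<theta>1 x * u x"
    using V 1 unfolding extendable_on_def by blast
  obtain w2 where w2: "w2 \<in> W1p p UNIV" "\<And>x. x \<notin> supp ?\<theta>2 \<Longrightarrow> w2 x = 0" "AE x in lebesgue. x \<in> \<Omega> \<longrightarrow> w2 x = ?\<theta>2 x * u x"
    using V' 2 unfolding extendable_on_def by blast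
  have s1: "supp ?\<theta>1 \<subseteq> supp \<theta>"
    by (rule supp_minimal[OF closed_supp]) (simp add: eq_0_if_notin_supp[of _ \<theta>])
  have s2: "supp ?\<theta>2 \<subseteq> supp \<theta>"
    by (rule supp_minimal[OF closed_supp]) (simp add: eq_0_if_notin_supp[of _ \<theta>])
  have zero: "w1 x + w2 x = 0" if "x \<notin> supp \<theta>" for x
    using w1(2)[OF contra_subsetD[OF s1 that]] w2(2)[OF contra_subsetD[OF s2 that]] by simp
  have "AE x in lebesgue. x \<in> \<Omega> \<longrightarrow> w1 x + w2 x = \<theta> x * u x"
    using w1(3) w2(3)
  proof eventually_elim
    case (elim x)
    then show ?case by (auto simp: algebra_simps)
  qed
  with zero show "\<exists>w\<in>W1p p UNIV. (\<forall>x. x \<notin> supp \<theta> \<longrightarrow> w x = 0) \<and> (AE x in lebesgue. x \<in> \<Omega> \<longrightarrow> w x = \<theta> x * u x)"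
    by (intro bexI[OF _ W1p_add[OF w1(1) w2(1) p]]) simp
qed

lemma extendable_on_finite_Union:
  assumes "finite \<V>" "\<And>V. V \<in> \<V> \<Longrightarrow> extendable_on p \<Omega> u V" "0 \<le> p"
  shows "extendable_on p \<Omega> u (\<Union>\<V>)"
  using assms
proof (induction \<V>)
  case empty
  show ?case by (rule extendable_on_disjoint) auto
next
  case (insert V \<V>)
  then have "extendable_on p \<Omega> u V" "extendable_on p \<Omega> u (\<Union>\<V>)" by simp_all
  from extendable_on_Un[OF this insert.prems(2)] show ?case by simp
qed

lemma extendable_on_local:
  fixes u :: "'a::euclidean_space \<Rightarrow> 'b::{real_normed_field, euclidean_space}"
  assumes V: "open V" and loc: "\<And>x. x \<in> V \<Longrightarrow> \<exists>W. x \<in> W \<and> extendable_on p \<Omega> u W" and p: "0 \<le> p"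
  shows "extendable_on p \<Omega> u V"
  unfolding extendable_on_def
proof (intro conjI ballI V)
  fix \<theta> :: "'a \<Rightarrow> 'b" assume \<theta>: "\<theta> \<in> Cc_inf V"
  let ?\<W> = "{W. extendable_on p \<Omega> u W}"
  have "compact (supp \<theta>)" "supp \<theta> \<subseteq> \<Union>?\<W>" using \<theta> loc by (auto simp: Cc_inf_iff)
  moreover have "open W" if "W \<in> ?\<W>" for W using that by (simp add: extendable_on_def)
  ultimately obtain \<T> where \<T>: "\<T> \<subseteq> ?\<W>" "finite \<T>" "supp \<theta> \<subseteq> \<Union>\<T>"
    by (meson compactE)
  have "extendable_on p \<Omega> u (\<Union>\<T>)" by (rule extendable_on_finite_Union[OF \<T>(2) _ p]) (use \<T>(1) in auto)
  moreover have "\<theta> \<in> Cc_inf (\<Union>\<T>)" using \<theta> \<T>(3) by (auto simp: Cc_inf_iff)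
  ultimately show "\<exists>w\<in>W1p p UNIV. (\<forall>x. x \<notin> supp \<theta> \<longrightarrow> w x = 0) \<and> (AE x in lebesgue. x \<in> \<Omega> \<longrightarrow> w x = \<theta> x * u x)"
    unfolding extendable_on_def by blast
qed

section \<open>Cutting off near the Dirichlet part\<close>

lemma L_p_nn_integral:
  assumes "f \<in> L_p p \<Lambda>"
  shows "f \<in> borel_measurable (lebesgue_on \<Lambda>)" "(\<integral>\<^sup>+x. ennreal (norm (f x) powr p) \<partial>lebesgue_on \<Lambda>) < \<infinity>"
  using assms by (auto simp: L_p_def integrable_iff_bounded)

lemma measurable_norm_powr:
  fixes f :: "'c \<Rightarrow> 'b::euclidean_space"
  assumes "f \<in> borel_measurable M"
  shows "(\<lambda>x. ennreal (norm (f x) powr p)) \<in> borel_measurable M"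
  by (intro measurable_compose[OF _ measurable_ennreal] powr_real_measurable
      measurable_compose[OF assms borel_measurable_norm] borel_measurable_const)

lemma nn_integral_norm_powr_add_le:
  fixes f g :: "'c \<Rightarrow> 'b::euclidean_space"
  assumes f: "f \<in> borel_measurable M" and g: "g \<in> borel_measurable M" and p: "0 \<le> p"
    and h: "AE x in M. h x = f x + g x"
  shows "(\<integral>\<^sup>+x. ennreal (norm (h x) powr p) \<partial>M) \<le>
    ennreal (2 powr p) * ((\<integral>\<^sup>+x. ennreal (norm (f x) powr p) \<partial>M) + (\<integral>\<^sup>+x. ennreal (norm (g x) powr p) \<partial>M))"
proof -
  have "(\<integral>\<^sup>+x. ennreal (norm (h x) powr p) \<partial>M) \<le>
      (\<integral>\<^sup>+x. ennreal (2 powr p) * (ennreal (norm (f x) powr p) + ennreal (norm (g x) powr p)) \<partial>M)"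
  proof (rule nn_integral_mono_AE)
    show "AE x in M. ennreal (norm (h x) powr p) \<le> ennreal (2 powr p) * (ennreal (norm (f x) powr p) + ennreal (norm (g x) powr p))"
      using h
    proof eventually_elim
      case (elim x)
      show ?case
        using norm_add_powr_le[OF p, of "f x" "g x"] elim
        by (simp flip: ennreal_plus ennreal_mult' add: ennreal_leI)
    qed
  qed
  also have "\<dots> = ennreal (2 powr p) * ((\<integral>\<^sup>+x. ennreal (norm (f x) powr p) \<partial>M) + (\<integral>\<^sup>+x. ennreal (norm (g x) powr p) \<partial>M))"
    using measurable_norm_powr[OF f] measurable_norm_powr[OF g]
    by (simp add: nn_integral_cmult nn_integral_add)
  finally show ?thesis .
qed

lemma nn_integral_lebesgue_on_le:
  assumes "open \<Lambda>"
  shows "(\<integral>\<^sup>+x. F x \<partial>lebesgue_on \<Lambda>) \<le> (\<integral>\<^sup>+x. F x \<partial>lborel)"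
proof -
  have "(\<integral>\<^sup>+x. F x \<partial>lebesgue_on \<Lambda>) = (\<integral>\<^sup>+x. F x * indicator \<Lambda> x \<partial>lebesgue)"
    using assms by (intro nn_integral_restrict_space) auto
  also have "\<dots> \<le> (\<integral>\<^sup>+x. F x \<partial>lebesgue)" by (intro nn_integral_mono) (simp add: indicator_def)
  finally show ?thesis by (simp add: nn_integral_completion)
qed

text \<open>
  This is where the integrability of \<open>u\<close> divided by the distance enters. For the cutoff functions of
  radius \<open>r\<close> around \<open>D\<close> both terms in the derivative of \<open>\<theta> u\<close> live where the distance to \<open>D\<close> is at
  most \<open>3 r\<close>, and there the dangerous factor satisfies \<open>C / r \<le> 3 C / infdist x D\<close>. So everything is
  bounded by one fixed integrable function \<open>H\<close>, integrated over sets that shrink to the empty set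
  because \<open>\<Omega>\<close> does not meet \<open>D\<close>.
\<close>

lemma Hardy_cutoff:
  fixes u :: "'a::euclidean_space \<Rightarrow> 'b::{real_normed_field, euclidean_space}"
  assumes p: "1 \<le> p" and D: "compact D" "D \<noteq> {}" "D \<inter> \<Omega> = {}"
    and u: "u \<in> L_p p \<Omega>" and g: "\<And>i. i \<in> Basis \<Longrightarrow> g i \<in> L_p p \<Omega>"
    and Hardy: "(\<lambda>x. u x /\<^sub>R infdist x D) \<in> L_p p \<Omega>" and \<delta>: "0 < (\<delta> :: real)"
  obtains \<theta> :: "'a \<Rightarrow> 'b" and V B where "smooth \<theta>" "open V" "D \<subseteq> V" "\<And>x. x \<in> V \<Longrightarrow> \<theta> x = 1"
    "\<And>x. norm (\<theta> x) \<le> B" "\<And>i x. i \<in> Basis \<Longrightarrow> norm (partial_deriv i \<theta> x) \<le> B"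
    "(\<integral>\<^sup>+x. ennreal (norm (\<theta> x * u x) powr p) \<partial>lebesgue_on \<Omega>) \<le> \<delta>"
    "\<And>i. i \<in> Basis \<Longrightarrow> (\<integral>\<^sup>+x. ennreal (norm (\<theta> x * g i x + partial_deriv i \<theta> x * u x) powr p) \<partial>lebesgue_on \<Omega>) \<le> \<delta>"
proof -
  let ?M = "lebesgue_on \<Omega>"
  let ?q = "\<lambda>x. u x /\<^sub>R infdist x D"
  have p0: "0 \<le> p" using p by simp
  obtain C where C: "0 \<le> C" "\<And>K \<delta>. compact (K :: 'a set) \<Longrightarrow> 0 < \<delta> \<Longrightarrow>
    \<exists>\<theta>. smooth (\<theta> :: 'a \<Rightarrow> 'b) \<and>
      supp \<theta> \<subseteq> (\<Union>k\<in>K. cball k (3 * \<delta>)) \<and> (\<forall>x. norm (\<theta> x) \<le> 1) \<and>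
      (\<forall>x. (\<exists>k\<in>K. dist x k < \<delta>) \<longrightarrow> \<theta> x = 1) \<and> (\<forall>i\<in>Basis. \<forall>x. norm (partial_deriv i \<theta> x) \<le> C / \<delta>)"
    using cutoff_exists[where ?'a = 'a and ?'b = 'b] by blast
  define H where "H x = ennreal (norm (u x) powr p) +
    (\<Sum>i\<in>Basis. ennreal (2 powr p) * (ennreal (norm (g i x) powr p) + ennreal ((3 * C) powr p) * ennreal (norm (?q x) powr p)))" for x
  have mu: "(\<lambda>x. ennreal (norm (u x) powr p)) \<in> borel_measurable ?M"
    and mq: "(\<lambda>x. ennreal (norm (?q x) powr p)) \<in> borel_measurable ?M"
    and mg: "i \<in> Basis \<Longrightarrow> (\<lambda>x. ennreal (norm (g i x) powr p)) \<in> borel_measurable ?M" for i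
    using measurable_norm_powr[OF L_p_nn_integral(1)] u g Hardy by blast+
  have mH: "H \<in> borel_measurable ?M"
    unfolding H_def[abs_def]
    by (intro borel_measurable_add borel_measurable_sum borel_measurable_times_ennreal borel_measurable_const mu mq mg)
  have "(\<integral>\<^sup>+x. H x \<partial>?M) = (\<integral>\<^sup>+x. ennreal (norm (u x) powr p) \<partial>?M) +
    (\<Sum>i\<in>Basis. ennreal (2 powr p) * ((\<integral>\<^sup>+x. ennreal (norm (g i x) powr p) \<partial>?M) +
       ennreal ((3 * C) powr p) * (\<integral>\<^sup>+x. ennreal (norm (?q x) powr p) \<partial>?M)))"
  proof -
    have m1: "(\<lambda>x. ennreal ((3 * C) powr p) * ennreal (norm (?q x) powr p)) \<in> borel_measurable ?M"
      by (rule borel_measurable_times_ennreal[OF borel_measurable_const mq])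
    have m2: "(\<lambda>x. ennreal (norm (g i x) powr p) + ennreal ((3 * C) powr p) * ennreal (norm (?q x) powr p)) \<in> borel_measurable ?M"
      if "i \<in> Basis" for i
      by (rule borel_measurable_add[OF mg[OF that] m1])
    have m3: "(\<lambda>x. ennreal (2 powr p) * (ennreal (norm (g i x) powr p) + ennreal ((3 * C) powr p) * ennreal (norm (?q x) powr p))) \<in> borel_measurable ?M"
      if "i \<in> Basis" for i
      by (rule borel_measurable_times_ennreal[OF borel_measurable_const m2[OF that]])
    let ?T = "\<lambda>i x. ennreal (2 powr p) * (ennreal (norm (g i x) powr p) + ennreal ((3 * C) powr p) * ennreal (norm (?q x) powr p))"
    have "(\<integral>\<^sup>+x. H x \<partial>?M) = (\<integral>\<^sup>+x. ennreal (norm (u x) powr p) \<partial>?M) + (\<integral>\<^sup>+x. (\<Sum>i\<in>Basis. ?T i x) \<partial>?M)"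
      unfolding H_def by (intro nn_integral_add mu borel_measurable_sum m3)
    also have "(\<integral>\<^sup>+x. (\<Sum>i\<in>Basis. ?T i x) \<partial>?M) = (\<Sum>i\<in>Basis. \<integral>\<^sup>+x. ?T i x \<partial>?M)"
      by (intro nn_integral_sum m3)
    also have "\<dots> = (\<Sum>i\<in>Basis. ennreal (2 powr p) * ((\<integral>\<^sup>+x. ennreal (norm (g i x) powr p) \<partial>?M) +
       ennreal ((3 * C) powr p) * (\<integral>\<^sup>+x. ennreal (norm (?q x) powr p) \<partial>?M)))"
      by (intro sum.cong refl)
        (simp only: nn_integral_cmult[OF m2] nn_integral_add[OF mg m1] nn_integral_cmult[OF mq])
    finally show ?thesis .
  qed
  also have "\<dots> < \<infinity>"
    using L_p_nn_integral(2)[OF u] L_p_nn_integral(2)[OF g] L_p_nn_integral(2)[OF Hardy]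
    by (auto simp: ennreal_mult_less_top)
  finally have fin: "(\<integral>\<^sup>+x. H x \<partial>?M) < \<infinity>" .
  define A where "A n = {x. infdist x D \<le> 3 / (real n + 1)}" for n
  have "closed (A n)" for n
    unfolding A_def by (intro closed_Collect_le continuous_intros)
  then have "A n \<in> sets lebesgue" for n by (simp add: lebesgue_closedin)
  then have mA: "(indicator (A n) :: 'a \<Rightarrow> ennreal) \<in> borel_measurable ?M" for n
    by (intro measurable_restrict_space1 borel_measurable_indicator)
  have "(\<lambda>n. \<integral>\<^sup>+x. H x * indicator (A n) x \<partial>?M) \<longlonglongrightarrow> (\<integral>\<^sup>+x. 0 \<partial>?M)"
  proof (rule nn_integral_dominated_convergence[where w = H])
    show "(\<lambda>x. H x * indicator (A n) x) \<in> borel_measurable ?M" for n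
      by (rule borel_measurable_times_ennreal[OF mH mA])
    show "AE x in ?M. H x * indicator (A j) x \<le> H x" for j by (simp add: indicator_def)
    show "AE x in ?M. (\<lambda>n. H x * indicator (A n) x) \<longlonglongrightarrow> 0"
    proof (rule AE_I2)
      fix x assume "x \<in> space ?M"
      then have "x \<notin> D" using D(3) by (auto simp: space_restrict_space)
      then have pos: "0 < infdist x D"
        using D infdist_nonneg[of x D] in_closed_iff_infdist_zero[OF compact_imp_closed[OF D(1)] D(2), of x] by force
      have "(\<lambda>n. 3 / (real n + 1)) \<longlonglongrightarrow> 0"
        using LIMSEQ_Suc[OF lim_const_over_n[of "3 :: real"]] by (simp add: add.commute)
      from order_tendstoD(2)[OF this pos]
      have "\<forall>\<^sub>F n in sequentially. H x * indicator (A n) x = 0"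
        by eventually_elim (auto simp: A_def)
      then show "(\<lambda>n. H x * indicator (A n) x) \<longlonglongrightarrow> 0" by (rule tendsto_eventually)
    qed
  qed (rule mH fin borel_measurable_const)+
  then have "(\<lambda>n. \<integral>\<^sup>+x. H x * indicator (A n) x \<partial>?M) \<longlonglongrightarrow> 0" by simp
  moreover have "0 < ennreal \<delta>" using \<delta> by simp
  ultimately obtain n where n: "(\<integral>\<^sup>+x. H x * indicator (A n) x \<partial>?M) < \<delta>" by (rule tendsto_zero_ennrealE)
  define r where "r = 1 / (real n + 1)"
  have r: "0 < r" by (simp add: r_def)
  obtain \<theta> :: "'a \<Rightarrow> 'b" where \<theta>: "smooth \<theta>" "supp \<theta> \<subseteq> (\<Union>k\<in>D. cball k (3 * r))" "\<And>x. norm (\<theta> x) \<le> 1"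
      "\<And>x k. k \<in> D \<Longrightarrow> dist x k < r \<Longrightarrow> \<theta> x = 1" "\<And>i x. i \<in> Basis \<Longrightarrow> norm (partial_deriv i \<theta> x) \<le> C / r"
    using C(2)[OF D(1) r] by blast
  have near: "x \<in> A n" if "x \<in> supp \<theta>" for x
  proof -
    from that \<theta>(2) obtain k where k: "k \<in> D" "dist k x \<le> 3 * r" by auto
    then have "infdist x D \<le> 3 * r" using infdist_le[OF k(1), of x] by (simp add: dist_commute)
    then show ?thesis by (simp add: A_def r_def)
  qed
  have off: "\<theta> x = 0" "partial_deriv i \<theta> x = 0" if "x \<notin> A n" for x i
    using near[of x] that eq_0_if_notin_supp[of x \<theta>] partial_deriv_notin_supp[of x \<theta>] by auto
  have le1: "(\<integral>\<^sup>+x. ennreal (norm (\<theta> x * u x) powr p) \<partial>?M) \<le> \<delta>"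
  proof -
    have "(\<integral>\<^sup>+x. ennreal (norm (\<theta> x * u x) powr p) \<partial>?M) \<le> (\<integral>\<^sup>+x. H x * indicator (A n) x \<partial>?M)"
    proof (rule nn_integral_mono)
      fix x
      show "ennreal (norm (\<theta> x * u x) powr p) \<le> H x * indicator (A n) x"
      proof (cases "x \<in> A n")
        case True
        have "norm (\<theta> x * u x) \<le> norm (u x)"
          using mult_right_mono[OF \<theta>(3), of "norm (u x)" x] by (simp add: norm_mult)
        then have "ennreal (norm (\<theta> x * u x) powr p) \<le> ennreal (norm (u x) powr p)"
          using p0 by (intro ennreal_leI powr_mono2) auto
        also have "\<dots> \<le> H x" unfolding H_def by (rule add_increasing2) auto
        finally show ?thesis using True by simp
      qed (simp add: off)
    qed
    with n show ?thesis by simp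
  qed
  have le2: "(\<integral>\<^sup>+x. ennreal (norm (\<theta> x * g i x + partial_deriv i \<theta> x * u x) powr p) \<partial>?M) \<le> \<delta>" if i: "i \<in> Basis" for i
  proof -
    have "(\<integral>\<^sup>+x. ennreal (norm (\<theta> x * g i x + partial_deriv i \<theta> x * u x) powr p) \<partial>?M) \<le> (\<integral>\<^sup>+x. H x * indicator (A n) x \<partial>?M)"
    proof (rule nn_integral_mono)
      fix x assume "x \<in> space ?M"
      then have "x \<notin> D" using D(3) by (auto simp: space_restrict_space)
      then have pos: "0 < infdist x D"
        using D infdist_nonneg[of x D] in_closed_iff_infdist_zero[OF compact_imp_closed[OF D(1)] D(2), of x] by force
      show "ennreal (norm (\<theta> x * g i x + partial_deriv i \<theta> x * u x) powr p) \<le> H x * indicator (A n) x"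
      proof (cases "x \<in> A n")
        case True
        then have "infdist x D \<le> 3 * r" by (simp add: A_def r_def)
        then have "1 / r \<le> 3 / infdist x D" using r pos by (simp add: field_simps)
        then have "C * (1 / r) \<le> C * (3 / infdist x D)" using C(1) by (rule mult_left_mono)
        then have "norm (partial_deriv i \<theta> x) \<le> 3 * C / infdist x D" using \<theta>(5)[OF i, of x] by (simp add: mult.commute)
        then have "norm (partial_deriv i \<theta> x) * norm (u x) \<le> (3 * C / infdist x D) * norm (u x)"
          by (rule mult_right_mono) simp
        then have b: "norm (partial_deriv i \<theta> x * u x) \<le> 3 * C * norm (?q x)"
          using pos by (simp add: norm_mult field_simps)
        have a: "norm (\<theta> x * g i x) \<le> norm (g i x)"
          using mult_right_mono[OF \<theta>(3), of "norm (g i x)" x] by (simp add: norm_mult)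
        have "norm (\<theta> x * g i x + partial_deriv i \<theta> x * u x) powr p \<le>
            2 powr p * (norm (\<theta> x * g i x) powr p + norm (partial_deriv i \<theta> x * u x) powr p)"
          by (rule norm_add_powr_le[OF p0])
        also have "\<dots> \<le> 2 powr p * (norm (g i x) powr p + (3 * C * norm (?q x)) powr p)"
          using a b p0 by (intro mult_left_mono add_mono powr_mono2) auto
        also have "(3 * C * norm (?q x)) powr p = (3 * C) powr p * norm (?q x) powr p"
          using C(1) by (intro powr_mult)
        finally have "ennreal (norm (\<theta> x * g i x + partial_deriv i \<theta> x * u x) powr p) \<le>
            ennreal (2 powr p * (norm (g i x) powr p + (3 * C) powr p * norm (?q x) powr p))"
          by (rule ennreal_leI)
        also have "\<dots> = ennreal (2 powr p) * (ennreal (norm (g i x) powr p) + ennreal ((3 * C) powr p) * ennreal (norm (?q x) powr p))"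
          by (simp add: ennreal_mult')
        also have "\<dots> \<le> (\<Sum>i\<in>Basis. ennreal (2 powr p) * (ennreal (norm (g i x) powr p) + ennreal ((3 * C) powr p) * ennreal (norm (?q x) powr p)))"
          by (rule member_le_sum[OF i]) auto
        also have "\<dots> \<le> H x" unfolding H_def by (rule add_increasing) auto
        finally show ?thesis using True by simp
      qed (simp add: off)
    qed
    with n show ?thesis by simp
  qed
  show ?thesis
  proof (rule that[of \<theta> "\<Union>k\<in>D. ball k r" "max 1 (C / r)"])
    show "\<theta> x = 1" if "x \<in> (\<Union>k\<in>D. ball k r)" for x
      using that \<theta>(4)[of _ x] by (auto simp: dist_commute)
    show "norm (\<theta> x) \<le> max 1 (C / r)" for x using \<theta>(3)[of x] by simp
    show "norm (partial_deriv i \<theta> x) \<le> max 1 (C / r)" if "i \<in> Basis" for i x using \<theta>(5)[OF that, of x] by simp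
  qed (use \<theta>(1) le1 le2 r in auto)
qed

section \<open>Approximation by smooth functions vanishing near the Dirichlet part\<close>

theorem theorem3p4:
  fixes \<Omega> D :: "'a::euclidean_space set"
    and p :: real
    and u :: "'a \<Rightarrow> 'b::{real_normed_field, euclidean_space}"
  assumes "is_domain \<Omega>" and "bounded \<Omega>"
    and "1 < p"
    and "D \<subseteq> frontier \<Omega>"
    and "porous D"
    and "\<exists>l\<in>{real DIM('a) - p<..real DIM('a)}. l_thick l D"
    and "\<forall>x\<in>closure (frontier \<Omega> - D).
           \<exists>U. open U \<and> x \<in> U \<and> W1p_extension_domain TYPE('b) p (\<Omega> \<inter> U)"
    and "u \<in> W1p p \<Omega>"
    and "(\<lambda>x. u x /\<^sub>R infdist x D) \<in> L_p p \<Omega>"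
  shows "u \<in> W1p_vanishing D p \<Omega>"
proof -
  have \<Omega>: "open \<Omega>" using assms(1) by (simp add: is_domain_def)
  have p: "1 \<le> p" "0 \<le> p" using assms(3) by auto
  have D: "compact D" "D \<noteq> {}" using assms(6) by (auto simp: l_thick_def)
  have D\<Omega>: "D \<inter> \<Omega> = {}" using assms(4) \<Omega> by (auto simp: frontier_def interior_open)
  have open_D: "open (- D)" using D(1) by (simp add: compact_imp_closed open_Compl)
  \<comment> \<open>Points off \<open>D\<close> lie inside \<open>\<Omega>\<close>, outside its closure, or on the part of the boundary with extension domains.\<close>
  have ext: "extendable_on p \<Omega> u (- D)"
  proof (rule extendable_on_local[OF open_D _ p(2)])
    fix x assume x: "x \<in> - D"
    consider "x \<in> \<Omega>" | "x \<in> - closure \<Omega>" | "x \<in> frontier \<Omega> - D"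
      using x \<Omega> by (auto simp: frontier_def interior_open)
    then show "\<exists>W. x \<in> W \<and> extendable_on p \<Omega> u W"
    proof cases
      case 1
      then show ?thesis by (intro exI[of _ \<Omega>] conjI extendable_on_self[OF \<Omega> p(1) assms(8)])
    next
      case 2
      have "extendable_on p \<Omega> u (- closure \<Omega>)"
        using closure_subset[of \<Omega>] by (intro extendable_on_disjoint) auto
      with 2 show ?thesis by blast
    next
      case 3
      then have "x \<in> closure (frontier \<Omega> - D)" by (rule subsetD[OF closure_subset])
      then obtain U where U: "open U" "x \<in> U" "W1p_extension_domain TYPE('b) p (\<Omega> \<inter> U)"
        by (elim bspec[OF assms(7), elim_format] exE conjE)
      show ?thesis
        by (intro exI[of _ U] conjI U(2) extendable_on_extension_domain[OF \<Omega> U(1) p(1) assms(8) U(3)])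
    qed
  qed
  obtain g where g: "u \<in> L_p p \<Omega>" "\<And>i. i \<in> Basis \<Longrightarrow> g i \<in> L_p p \<Omega>" "\<And>i. i \<in> Basis \<Longrightarrow> has_weak_deriv \<Omega> i u (g i)"
    using W1pE[OF assms(8)] by blast
  have mu: "u \<in> borel_measurable (lebesgue_on \<Omega>)" and mg: "i \<in> Basis \<Longrightarrow> g i \<in> borel_measurable (lebesgue_on \<Omega>)" for i
    using L_p_nn_integral(1) g by blast+
  have "\<exists>v\<in>C_inf_vanishing D \<Omega>. W1p_norm p \<Omega> (\<lambda>x. u x - v x) < \<epsilon>" if \<epsilon>: "0 < \<epsilon>" for \<epsilon>
  proof -
    \<comment> \<open>With the constant of \<open>W1p_norm_less\<close>, errors below \<open>\<delta>\<close> suffice; each is split into a cutoff and a mollification error.\<close>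
    define c where "c = real DIM('a) powr p * real DIM('a) + 1"
    have c: "0 < c" unfolding c_def by (intro add_nonneg_pos) auto
    define \<delta> where "\<delta> = \<epsilon> powr p / (2 * c)"
    define \<delta>' where "\<delta>' = \<delta> / (2 * 2 powr p)"
    have \<delta>: "0 < \<delta>" "c * \<delta> < \<epsilon> powr p" using c \<epsilon> by (auto simp: \<delta>_def)
    have \<delta>': "0 < \<delta>'" "2 powr p * (\<delta>' + \<delta>') = \<delta>" using \<delta> by (auto simp: \<delta>'_def)
    obtain \<theta> :: "'a \<Rightarrow> 'b" and V B where \<theta>: "smooth \<theta>" "open V" "D \<subseteq> V" "\<And>x. x \<in> V \<Longrightarrow> \<theta> x = 1"
        "\<And>x. norm (\<theta> x) \<le> B" "\<And>i x. i \<in> Basis \<Longrightarrow> norm (partial_deriv i \<theta> x) \<le> B"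
        "(\<integral>\<^sup>+x. ennreal (norm (\<theta> x * u x) powr p) \<partial>lebesgue_on \<Omega>) \<le> \<delta>'"
        "\<And>i. i \<in> Basis \<Longrightarrow> (\<integral>\<^sup>+x. ennreal (norm (\<theta> x * g i x + partial_deriv i \<theta> x * u x) powr p) \<partial>lebesgue_on \<Omega>) \<le> \<delta>'"
    proof (rule Hardy_cutoff[OF p(1) D D\<Omega> g(1,2) assms(9) \<delta>'(1)])
      fix \<theta> :: "'a \<Rightarrow> 'b" and V B
      assume "smooth \<theta>" "open V" "D \<subseteq> V" "\<And>x. x \<in> V \<Longrightarrow> \<theta> x = 1"
        "\<And>x. norm (\<theta> x) \<le> B" "\<And>i x. i \<in> Basis \<Longrightarrow> norm (partial_deriv i \<theta> x) \<le> B"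
        "(\<integral>\<^sup>+x. ennreal (norm (\<theta> x * u x) powr p) \<partial>lebesgue_on \<Omega>) \<le> \<delta>'"
        "\<And>i. i \<in> Basis \<Longrightarrow> (\<integral>\<^sup>+x. ennreal (norm (\<theta> x * g i x + partial_deriv i \<theta> x * u x) powr p) \<partial>lebesgue_on \<Omega>) \<le> \<delta>'"
      then show thesis by (rule that)
    qed
    let ?\<eta> = "\<lambda>x. 1 - \<theta> x"
    have \<eta>: "smooth ?\<eta>" by (rule smooth_diff[OF smooth_const \<theta>(1)])
    have \<eta>': "partial_deriv i ?\<eta> x = - partial_deriv i \<theta> x" for i x
    proof -
      have "((\<lambda>x. 1 - \<theta> x) has_derivative (\<lambda>h. 0 - frechet_derivative \<theta> (at x) h)) (at x)"
        by (rule has_derivative_diff[OF has_derivative_const has_derivative_works[OF smooth_differentiable[OF \<theta>(1)]]])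
      from partial_deriv_eq[OF this, of i] show ?thesis by (simp add: partial_deriv_def)
    qed
    have comp: "compact (closure \<Omega>)" using assms(2) by simp
    \<comment> \<open>A second cutoff function makes \<open>1 - \<theta>\<close> compactly supported without changing it on \<open>\<Omega>\<close>.\<close>
    obtain \<kappa> :: "'a \<Rightarrow> 'b" and V' where \<kappa>: "\<kappa> \<in> Cc_inf UNIV" "open V'" "closure \<Omega> \<subseteq> V'" "\<And>x. x \<in> V' \<Longrightarrow> \<kappa> x = 1"
    proof (rule smooth_Urysohn[OF comp open_UNIV subset_UNIV, where ?'b = 'b])
      fix \<kappa> :: "'a \<Rightarrow> 'b" and V'
      assume "\<kappa> \<in> Cc_inf UNIV" "open V'" "closure \<Omega> \<subseteq> V'" "\<And>x. x \<in> V' \<Longrightarrow> \<kappa> x = 1"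
      then show thesis by (rule that)
    qed
    have \<kappa>1: "\<kappa> x = 1" if "x \<in> \<Omega>" for x using \<kappa>(3,4) that closure_subset[of \<Omega>] by blast
    let ?\<zeta> = "\<lambda>x. ?\<eta> x * \<kappa> x"
    have \<zeta>: "?\<zeta> \<in> Cc_inf (- D)"
    proof (rule Cc_infI[OF smooth_mult[OF \<eta> Cc_inf_smooth[OF \<kappa>(1)]]])
      show "compact (supp \<kappa> - V)" using \<kappa>(1) \<theta>(2) by (intro compact_diff) (auto simp: Cc_inf_iff)
      show "supp \<kappa> - V \<subseteq> - D" using \<theta>(3) by auto
      show "?\<zeta> x = 0" if "x \<notin> supp \<kappa> - V" for x
        using that \<theta>(4)[of x] eq_0_if_notin_supp[of x \<kappa>] by auto
    qed
    obtain w where w: "w \<in> W1p p UNIV" "\<And>x. x \<notin> supp ?\<zeta> \<Longrightarrow> w x = 0" "AE x in lebesgue. x \<in> \<Omega> \<longrightarrow> w x = ?\<zeta> x * u x"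
      using ext \<zeta> unfolding extendable_on_def by blast
    obtain G where G: "w \<in> L_p p UNIV" "\<And>i. i \<in> Basis \<Longrightarrow> G i \<in> L_p p UNIV" "\<And>i. i \<in> Basis \<Longrightarrow> has_weak_deriv UNIV i w (G i)"
      using W1pE[OF w(1)] by blast
    have K: "compact (supp ?\<zeta>)" "supp ?\<zeta> \<subseteq> - D" using \<zeta> by (auto simp: Cc_inf_iff)
    obtain r where r: "0 < r" "(\<Union>k\<in>supp ?\<zeta>. cball k r) \<subseteq> - D"
      using compact_subset_open_imp_cball_epsilon_subset[OF K(1) open_D K(2)] by blast
    have r\<delta>: "0 < min r \<delta>'" using r \<delta>' by simp
    obtain v where v: "v \<in> Cc_inf UNIV" "supp v \<subseteq> (\<Union>k\<in>supp ?\<zeta>. cball k (min r \<delta>'))"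
        "Lp_dist_powr p v w \<le> min r \<delta>'" "\<And>i. i \<in> Basis \<Longrightarrow> Lp_dist_powr p (partial_deriv i v) (G i) \<le> min r \<delta>'"
    proof (rule Sobolev_mollification[OF p(1) G K(1) w(2) r\<delta>])
      fix v :: "'a \<Rightarrow> 'b"
      assume "v \<in> Cc_inf UNIV" "supp v \<subseteq> (\<Union>k\<in>supp ?\<zeta>. cball k (min r \<delta>'))"
        "Lp_dist_powr p v w \<le> min r \<delta>'" "\<And>i. i \<in> Basis \<Longrightarrow> Lp_dist_powr p (partial_deriv i v) (G i) \<le> min r \<delta>'"
      then show thesis by (rule that)
    qed
    have "(\<Union>k\<in>supp ?\<zeta>. cball k (min r \<delta>')) \<subseteq> (\<Union>k\<in>supp ?\<zeta>. cball k r)" by auto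
    with v(2) r(2) have "supp v \<inter> D = {}" by blast
    with v(1) have vD: "v \<in> C_inf_vanishing D \<Omega>" unfolding C_inf_vanishing_def by blast
    have mv: "v \<in> borel_measurable (lebesgue_on \<Omega>)"
      by (rule measurable_restrict_space1[OF smooth_lebesgue_measurable[OF Cc_inf_smooth[OF v(1)]]])
    have mv': "partial_deriv i v \<in> borel_measurable (lebesgue_on \<Omega>)" if "i \<in> Basis" for i
      by (rule measurable_restrict_space1[OF smooth_lebesgue_measurable[OF Cc_inf_smooth[OF Cc_inf_partial_deriv[OF v(1) that]]]])
    have m\<theta>: "\<theta> \<in> borel_measurable (lebesgue_on \<Omega>)"
      by (rule measurable_restrict_space1[OF smooth_lebesgue_measurable[OF \<theta>(1)]])
    have m\<theta>': "partial_deriv i \<theta> \<in> borel_measurable (lebesgue_on \<Omega>)" if "i \<in> Basis" for i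
      by (rule measurable_restrict_space1[OF smooth_lebesgue_measurable[OF smooth_partial_deriv[OF \<theta>(1) that]]])
    have mw: "w \<in> borel_measurable (lebesgue_on \<Omega>)"
      using G(1) by (intro measurable_restrict_space1) (simp add: L_p_UNIV_iff)
    have mG: "G i \<in> borel_measurable (lebesgue_on \<Omega>)" if "i \<in> Basis" for i
      using G(2)[OF that] by (intro measurable_restrict_space1) (simp add: L_p_UNIV_iff)
    have \<Omega>_sets: "\<Omega> \<inter> space lebesgue \<in> sets lebesgue" using \<Omega> by auto
    \<comment> \<open>Applied to \<open>u - v\<close> and to each of its derivatives: \<open>f1\<close> is the error of the cutoff, \<open>f2 - f3\<close> that of the mollification.\<close>
    have bound: "(\<integral>\<^sup>+x. ennreal (norm (h x) powr p) \<partial>lebesgue_on \<Omega>) \<le> \<delta>"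
      if h: "AE x in lebesgue_on \<Omega>. h x = f1 x + (f2 x - f3 x)"
        and f1: "f1 \<in> borel_measurable (lebesgue_on \<Omega>)" "(\<integral>\<^sup>+x. ennreal (norm (f1 x) powr p) \<partial>lebesgue_on \<Omega>) \<le> \<delta>'"
        and f23: "f2 \<in> borel_measurable (lebesgue_on \<Omega>)" "f3 \<in> borel_measurable (lebesgue_on \<Omega>)" "Lp_dist_powr p f3 f2 \<le> min r \<delta>'"
      for h f1 f2 f3 :: "'a \<Rightarrow> 'b"
    proof -
      have "(\<integral>\<^sup>+x. ennreal (norm (f2 x - f3 x) powr p) \<partial>lebesgue_on \<Omega>) \<le> Lp_dist_powr p f3 f2"
        unfolding Lp_dist_powr_def using nn_integral_lebesgue_on_le[OF \<Omega>] by (simp add: norm_minus_commute)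
      also have "\<dots> \<le> ennreal \<delta>'" using f23(3) by (rule order_trans) (simp add: ennreal_leI)
      finally have 2: "(\<integral>\<^sup>+x. ennreal (norm (f2 x - f3 x) powr p) \<partial>lebesgue_on \<Omega>) \<le> \<delta>'" .
      have "(\<integral>\<^sup>+x. ennreal (norm (h x) powr p) \<partial>lebesgue_on \<Omega>) \<le> ennreal (2 powr p) *
          ((\<integral>\<^sup>+x. ennreal (norm (f1 x) powr p) \<partial>lebesgue_on \<Omega>) + (\<integral>\<^sup>+x. ennreal (norm (f2 x - f3 x) powr p) \<partial>lebesgue_on \<Omega>))"
        by (rule nn_integral_norm_powr_add_le[OF f1(1) borel_measurable_diff[OF f23(1,2)] p(2) h])
      also have "\<dots> \<le> ennreal (2 powr p) * (ennreal \<delta>' + ennreal \<delta>')"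
        using f1(2) 2 by (intro mult_left_mono add_mono) auto
      also have "\<dots> = ennreal \<delta>"
        using \<delta>'(1) unfolding \<delta>'(2)[symmetric] by (simp flip: ennreal_plus ennreal_mult')
      finally show ?thesis .
    qed
    have aew: "AE x in lebesgue. x \<in> \<Omega> \<longrightarrow> w x = (if x \<in> \<Omega> then ?\<eta> x * u x else 0)"
      using w(3) by eventually_elim (simp add: \<kappa>1)
    have "W1p_norm p \<Omega> (\<lambda>x. u x - v x) < \<epsilon>"
    proof (rule W1p_norm_less[where h = "\<lambda>i x. g i x - partial_deriv i v x" and \<delta> = \<delta>, OF \<Omega> p(1)])
      show "(\<lambda>x. u x - v x) \<in> borel_measurable (lebesgue_on \<Omega>)" by (rule borel_measurable_diff[OF mu mv])
      show "0 \<le> \<delta>" using \<delta> by simp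
      show "0 < \<epsilon>" by (rule \<epsilon>)
      show "(real DIM('a) powr p * real DIM('a) + 1) * \<delta> < \<epsilon> powr p" using \<delta>(2) by (simp add: c_def)
      show "(\<integral>\<^sup>+x. ennreal (norm (u x - v x) powr p) \<partial>lebesgue_on \<Omega>) \<le> ennreal \<delta>"
      proof (rule bound[OF _ borel_measurable_times[OF m\<theta> mu] \<theta>(7) mw mv v(3)])
        have "AE x in lebesgue. x \<in> \<Omega> \<longrightarrow> u x - v x = \<theta> x * u x + (w x - v x)"
          using aew by eventually_elim (simp add: algebra_simps)
        then show "AE x in lebesgue_on \<Omega>. u x - v x = \<theta> x * u x + (w x - v x)"
          using \<Omega>_sets by (simp add: AE_restrict_space_iff)
      qed
      fix i :: 'a assume i: "i \<in> Basis"
      show "(\<lambda>x. g i x - partial_deriv i v x) \<in> borel_measurable (lebesgue_on \<Omega>)"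
        by (rule borel_measurable_diff[OF mg[OF i] mv'[OF i]])
      show "has_weak_deriv \<Omega> i (\<lambda>x. u x - v x) (\<lambda>x. g i x - partial_deriv i v x)"
        by (rule has_weak_deriv_diff[OF \<Omega> g(3)[OF i]
              has_weak_deriv_subset[OF has_weak_deriv_Cc_inf[OF v(1) i] open_UNIV \<Omega> subset_UNIV] i])
      show "(\<integral>\<^sup>+x. ennreal (norm (g i x - partial_deriv i v x) powr p) \<partial>lebesgue_on \<Omega>) \<le> ennreal \<delta>"
      proof (rule bound[OF _ borel_measurable_add[OF borel_measurable_times[OF m\<theta> mg[OF i]] borel_measurable_times[OF m\<theta>'[OF i] mu]]
              \<theta>(8)[OF i] mG[OF i] mv'[OF i] v(4)[OF i]])
        have b1: "norm (?\<eta> x) \<le> 1 + B" for x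
          using norm_triangle_ineq4[of 1 "\<theta> x"] \<theta>(5)[of x] by simp
        have b2: "norm (partial_deriv i ?\<eta> x) \<le> 1 + B" for x
          unfolding \<eta>' using \<theta>(6)[OF i, of x] by simp
        have "has_weak_deriv \<Omega> i (\<lambda>x. if x \<in> \<Omega> then ?\<eta> x * u x else 0)
            (\<lambda>x. if x \<in> \<Omega> then ?\<eta> x * g i x + partial_deriv i ?\<eta> x * u x else 0)"
          by (rule smooth_mult_weak_deriv(3)[OF \<Omega> \<Omega> p(1) i g(1) g(2)[OF i] g(3)[OF i] \<eta> b1 b2]) (auto simp: Cc_inf_iff)
        from has_weak_deriv_unique[OF \<Omega> i has_weak_deriv_subset[OF G(3)[OF i] open_UNIV \<Omega> subset_UNIV] this aew]
        have "AE x in lebesgue. x \<in> \<Omega> \<longrightarrow>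
            g i x - partial_deriv i v x = (\<theta> x * g i x + partial_deriv i \<theta> x * u x) + (G i x - partial_deriv i v x)"
        proof eventually_elim
          case (elim x)
          then show ?case unfolding \<eta>' by (simp add: algebra_simps)
        qed
        then show "AE x in lebesgue_on \<Omega>.
            g i x - partial_deriv i v x = (\<theta> x * g i x + partial_deriv i \<theta> x * u x) + (G i x - partial_deriv i v x)"
          using \<Omega>_sets by (simp add: AE_restrict_space_iff)
      qed
    qed
    with vD show ?thesis by blast
  qed
  with assms(8) show ?thesis unfolding W1p_vanishing_def by blast
qed

end
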